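(* Let $\mathcal{I}$ be a locally finite structure in a language $L'$ that is qfi, and suppose $L'$ contains a binary relation symbol $<$ interpreted as a linear order on the underlying set $I$. Then $\mathcal{I}$-indexed indiscernible sets have the modeling property if and only if $\mathrm{age}(\mathcal{I})$ is a Ramsey class.
   Context: $\mathcal{I}$ is locally finite if every finitely generated substructure is finite. $\mathcal{I}$ is qfi if for every complete quantifier-free type $q(\bar x)$ (in finitely many variables) realized in $\mathcal{I}$ there is a quantifier-free formula $\theta_q(\bar x)$ with $\mathrm{Th}(\mathcal{I})_\forall\cup\{\theta_q(\bar x)\}\vdash q(\bar x)$, where $\mathrm{Th}(\mathcal{I})_\forall$ is the set of universal sentences true in $\mathcal{I}$. $\mathrm{age}(\mathcal{I})$ is the class of finitely generated substructures of $\mathcal{I}$, closed under isomorphism. Indiscernibles: given a monster model $\mathbb{M}$ of a complete theory in a language $L$, an $I$-indexed set $(b_i:i\in I)$ of same-length tuples from $\mathbb{M}$ is an $\mathcal{I}$-indexed indiscernible if whenever $(i_1,\dots,i_n)$ and $(j_1,\dots,j_n)$ from $I$ have the same complete quantifier-free $L'$-type in $\mathcal{I}$, $(b_{i_1},\dots,b_{i_n})$ and $(b_{j_1},\dots,b_{j_n})$ have the same complete $L$-type in $\mathbb{M}$; indiscernibles are assumed nontrivial ($b_i\ne b_j$ for $i\ne j$). A set $(b_i:i\in I)$ is locally based on $(a_i:i\in I)$ if for every finite set $\Delta$ of $L$-formulas and every finite tuple $\bar t$ from $I$ there is $\bar s$ from $I$ with the same quantifier-free $L'$-type in $\mathcal{I}$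 as $\bar t$ such that $\bar b_{\bar t}$ and $\bar a_{\bar s}$ satisfy the same formulas from $\Delta$ (and their negations). $\mathcal{I}$-indexed indiscernibles have the modeling property if for every complete theory (in any language $L$), every $I$-indexed set of parameters $(a_i:i\in I)$ (same-length tuples) in its monster model $\mathbb{M}$, there is an $\mathcal{I}$-indexed indiscernible $(b_i:i\in I)$ in $\mathbb{M}$ locally based on the $a_i$. Ramsey class: for $L'$-structures $A\subseteq C$ type, an $A$-substructure of $C$ is a substructure $A'\subseteq C$ isomorphic to $A$ (as a set, no enumeration); $\binom{C}{A}$ denotes the set of these. For $k\ge1$, $C\to(B)^A_k$ means that for every function $f:\binom{C}{A}\to\{0,\dots,k-1\}$ there is a substructure $B'\subseteq C$ isomorphic to $B$ such that $f$ is constant on $\binom{B'}{A}$. A class $\mathcal{K}$ of finite $L'$-structures is a Ramsey class if for all $A,B\in\mathcal{K}$ and every positive integer $k$ there is $C\in\mathcal{K}$ with $C\to(B)^A_k$.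
   Formalization: Parameters are finite tuples of a common length, and the indiscernible is required to be nontrivial only when the parameters a_i are pairwise distinct; requiring nontriviality for all parameter sets (e.g. constant ones) or for infinite tuples would make the claim false. *)

theory Defs
  imports Main
begin

unbundle cardinal_syntax

section \<open>First-order logic with equality\<close>

text \<open>
  A language is given by sets of function and relation symbols with their arities (constants are
  function symbols of arity 0); these are sets rather than whole types so that a language may have
  no function symbols or no relation symbols at all.
\<close>

record ('f, 'r) lang =
  Funs :: "'f set"
  Rels :: "'r set"
  fun_ar :: "'f \<Rightarrow> nat"
  rel_ar :: "'r \<Rightarrow> nat"

text \<open>
  Variables are de Bruijn indices: in \<open>All \<phi>\<close> the index 0 of \<open>\<phi>\<close> is bound and the index
  \<open>Suc n\<close> of \<open>\<phi>\<close> stands for the variable \<open>n\<close> of the whole formula.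
\<close>

datatype 'f tm = Var nat | Fn 'f "'f tm list"

datatype ('f, 'r) fm =
    Bot
  | Eq "'f tm" "'f tm"
  | Rl 'r "'f tm list"
  | Imp "('f, 'r) fm" "('f, 'r) fm"
  | All "('f, 'r) fm"

abbreviation Neg :: "('f, 'r) fm \<Rightarrow> ('f, 'r) fm" where
  "Neg \<phi> \<equiv> Imp \<phi> Bot"

primrec wf_tm :: "('f, 'r) lang \<Rightarrow> 'f tm \<Rightarrow> bool" where
  "wf_tm L (Var n) \<longleftrightarrow> True"
| "wf_tm L (Fn f ts) \<longleftrightarrow> f \<in> Funs L \<and> length ts = fun_ar L f \<and> list_all (wf_tm L) ts"

primrec wf_fm :: "('f, 'r) lang \<Rightarrow> ('f, 'r) fm \<Rightarrow> bool" where
  "wf_fm L Bot \<longleftrightarrow> True"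
| "wf_fm L (Eq s t) \<longleftrightarrow> wf_tm L s \<and> wf_tm L t"
| "wf_fm L (Rl r ts) \<longleftrightarrow> r \<in> Rels L \<and> length ts = rel_ar L r \<and> list_all (wf_tm L) ts"
| "wf_fm L (Imp \<phi> \<psi>) \<longleftrightarrow> wf_fm L \<phi> \<and> wf_fm L \<psi>"
| "wf_fm L (All \<phi>) \<longleftrightarrow> wf_fm L \<phi>"

primrec fv_tm :: "'f tm \<Rightarrow> nat set" where
  "fv_tm (Var n) = {n}"
| "fv_tm (Fn f ts) = \<Union> (set (map fv_tm ts))"

primrec fv :: "('f, 'r) fm \<Rightarrow> nat set" where
  "fv Bot = {}"
| "fv (Eq s t) = fv_tm s \<union> fv_tm t"
| "fv (Rl r ts) = \<Union> (set (map fv_tm ts))"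
| "fv (Imp \<phi> \<psi>) = fv \<phi> \<union> fv \<psi>"
| "fv (All \<phi>) = {n. Suc n \<in> fv \<phi>}"

primrec qfree :: "('f, 'r) fm \<Rightarrow> bool" where
  "qfree Bot \<longleftrightarrow> True"
| "qfree (Eq s t) \<longleftrightarrow> True"
| "qfree (Rl r ts) \<longleftrightarrow> True"
| "qfree (Imp \<phi> \<psi>) \<longleftrightarrow> qfree \<phi> \<and> qfree \<psi>"
| "qfree (All \<phi>) \<longleftrightarrow> False"

text \<open>The \<open>L\<close>-formulas in the free variables \<open>0, \<dots>, n - 1\<close>.\<close>

definition formulas :: "('f, 'r) lang \<Rightarrow> nat \<Rightarrow> ('f, 'r) fm set" where
  "formulas L n = {\<phi>. wf_fm L \<phi> \<and> fv \<phi> \<subseteq> {..<n}}"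

definition qf_formulas :: "('f, 'r) lang \<Rightarrow> nat \<Rightarrow> ('f, 'r) fm set" where
  "qf_formulas L n = {\<phi> \<in> formulas L n. qfree \<phi>}"

abbreviation sentences :: "('f, 'r) lang \<Rightarrow> ('f, 'r) fm set" where
  "sentences L \<equiv> formulas L 0"

definition universal_sentences :: "('f, 'r) lang \<Rightarrow> ('f, 'r) fm set" where
  "universal_sentences L = {(All ^^ n) \<phi> | n \<phi>. \<phi> \<in> qf_formulas L n}"

record ('f, 'r, 'a) struct =
  universe :: "'a set"
  fn :: "'f \<Rightarrow> 'a list \<Rightarrow> 'a"
  rl :: "'r \<Rightarrow> 'a list \<Rightarrow> bool"

definition tuples :: "('f, 'r, 'a) struct \<Rightarrow> nat \<Rightarrow> 'a list set" where
  "tuples M n = {xs. set xs \<subseteq> universe M \<and> length xs = n}"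

definition is_struct :: "('f, 'r) lang \<Rightarrow> ('f, 'r, 'a) struct \<Rightarrow> bool" where
  "is_struct L M \<longleftrightarrow> universe M \<noteq> {} \<and>
     (\<forall>f\<in>Funs L. \<forall>xs\<in>tuples M (fun_ar L f). fn M f xs \<in> universe M)"

primrec eval :: "('f, 'r, 'a) struct \<Rightarrow> (nat \<Rightarrow> 'a) \<Rightarrow> 'f tm \<Rightarrow> 'a" where
  "eval M e (Var n) = e n"
| "eval M e (Fn f ts) = fn M f (map (eval M e) ts)"

primrec sat :: "('f, 'r, 'a) struct \<Rightarrow> (nat \<Rightarrow> 'a) \<Rightarrow> ('f, 'r) fm \<Rightarrow> bool" where
  "sat M e Bot \<longleftrightarrow> False"
| "sat M e (Eq s t) \<longleftrightarrow> eval M e s = eval M e t"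
| "sat M e (Rl r ts) \<longleftrightarrow> rl M r (map (eval M e) ts)"
| "sat M e (Imp \<phi> \<psi>) \<longleftrightarrow> (sat M e \<phi> \<longrightarrow> sat M e \<psi>)"
| "sat M e (All \<phi>) \<longleftrightarrow> (\<forall>a\<in>universe M. sat M (case_nat a e) \<phi>)"

text \<open>
  \<open>holds M \<phi> xs\<close> is \<open>M \<Turnstile> \<phi>(xs)\<close>; it is only used for \<open>\<phi> \<in> formulas L (length xs)\<close>, so that
  the values of \<open>xs ! n\<close> beyond the length of \<open>xs\<close> are irrelevant.
\<close>

definition holds :: "('f, 'r, 'a) struct \<Rightarrow> ('f, 'r) fm \<Rightarrow> 'a list \<Rightarrow> bool" where
  "holds M \<phi> xs \<longleftrightarrow> sat M (\<lambda>n. xs ! n) \<phi>"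

definition tp :: "('f, 'r) lang \<Rightarrow> ('f, 'r, 'a) struct \<Rightarrow> 'a list \<Rightarrow> ('f, 'r) fm set" where
  "tp L M xs = {\<phi> \<in> formulas L (length xs). holds M \<phi> xs}"

definition qftp :: "('f, 'r) lang \<Rightarrow> ('f, 'r, 'a) struct \<Rightarrow> 'a list \<Rightarrow> ('f, 'r) fm set" where
  "qftp L M xs = {\<phi> \<in> qf_formulas L (length xs). holds M \<phi> xs}"


subsection \<open>Provability\<close>

primrec subst_tm :: "(nat \<Rightarrow> 'f tm) \<Rightarrow> 'f tm \<Rightarrow> 'f tm" where
  "subst_tm s (Var n) = s n"
| "subst_tm s (Fn f ts) = Fn f (map (subst_tm s) ts)"

definition shift :: "nat \<Rightarrow> 'f tm" where
  "shift n = Var (Suc n)"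

primrec subst :: "(nat \<Rightarrow> 'f tm) \<Rightarrow> ('f, 'r) fm \<Rightarrow> ('f, 'r) fm" where
  "subst s Bot = Bot"
| "subst s (Eq t u) = Eq (subst_tm s t) (subst_tm s u)"
| "subst s (Rl r ts) = Rl r (map (subst_tm s) ts)"
| "subst s (Imp \<phi> \<psi>) = Imp (subst s \<phi>) (subst s \<psi>)"
| "subst s (All \<phi>) = All (subst (case_nat (Var 0) (\<lambda>n. subst_tm shift (s n))) \<phi>)"

text \<open>\<open>inst t \<phi>\<close> is the formula under the quantifier of \<open>All \<phi>\<close>, instantiated with \<open>t\<close>.\<close>

definition inst :: "'f tm \<Rightarrow> ('f, 'r) fm \<Rightarrow> ('f, 'r) fm" where
  "inst t \<phi> = subst (case_nat t Var) \<phi>"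

text \<open>
  Classical natural deduction with equality. The free variables of the formulas on the left of the
  turnstile are fixed parameters: there is no implicit universal closure.
\<close>

inductive proves :: "('f, 'r) lang \<Rightarrow> ('f, 'r) fm set \<Rightarrow> ('f, 'r) fm \<Rightarrow> bool" for L where
  Assm: "\<phi> \<in> \<Gamma> \<Longrightarrow> wf_fm L \<phi> \<Longrightarrow> proves L \<Gamma> \<phi>"
| ImpI: "wf_fm L \<phi> \<Longrightarrow> proves L (insert \<phi> \<Gamma>) \<psi> \<Longrightarrow> proves L \<Gamma> (Imp \<phi> \<psi>)"
| ImpE: "proves L \<Gamma> (Imp \<phi> \<psi>) \<Longrightarrow> proves L \<Gamma> \<phi> \<Longrightarrow> proves L \<Gamma> \<psi>"
| Class: "wf_fm L \<phi> \<Longrightarrow> proves L (insert (Neg \<phi>) \<Gamma>) Bot \<Longrightarrow> proves L \<Gamma> \<phi>"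
| AllI: "proves L (subst shift ` \<Gamma>) \<phi> \<Longrightarrow> proves L \<Gamma> (All \<phi>)"
| AllE: "proves L \<Gamma> (All \<phi>) \<Longrightarrow> wf_tm L t \<Longrightarrow> proves L \<Gamma> (inst t \<phi>)"
| EqI: "wf_tm L t \<Longrightarrow> proves L \<Gamma> (Eq t t)"
| EqE: "wf_fm L \<phi> \<Longrightarrow> proves L \<Gamma> (Eq t u) \<Longrightarrow> proves L \<Gamma> (inst t \<phi>) \<Longrightarrow> proves L \<Gamma> (inst u \<phi>)"

definition complete_theory :: "('f, 'r) lang \<Rightarrow> ('f, 'r) fm set \<Rightarrow> bool" where
  "complete_theory L T \<longleftrightarrow> T \<subseteq> sentences L \<and> \<not> proves L T Bot \<and>
     (\<forall>\<phi>\<in>sentences L. proves L T \<phi> \<or> proves L T (Neg \<phi>))"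

definition is_model :: "('f, 'r) lang \<Rightarrow> ('f, 'r) fm set \<Rightarrow> ('f, 'r, 'a) struct \<Rightarrow> bool" where
  "is_model L T M \<longleftrightarrow> is_struct L M \<and> (\<forall>\<phi>\<in>T. holds M \<phi> [])"


section \<open>Substructures, isomorphisms, age\<close>

definition is_iso ::
  "('f, 'r) lang \<Rightarrow> ('f, 'r, 'a) struct \<Rightarrow> ('f, 'r, 'b) struct \<Rightarrow> ('a \<Rightarrow> 'b) \<Rightarrow> bool" where
  "is_iso L A B h \<longleftrightarrow> bij_betw h (universe A) (universe B) \<and>
     (\<forall>f\<in>Funs L. \<forall>xs\<in>tuples A (fun_ar L f). h (fn A f xs) = fn B f (map h xs)) \<and>
     (\<forall>r\<in>Rels L. \<forall>xs\<in>tuples A (rel_ar L r). rl A r xs \<longleftrightarrow> rl B r (map h xs))"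

definition isomorphic ::
  "('f, 'r) lang \<Rightarrow> ('f, 'r, 'a) struct \<Rightarrow> ('f, 'r, 'b) struct \<Rightarrow> bool" where
  "isomorphic L A B \<longleftrightarrow> (\<exists>h. is_iso L A B h)"

definition restrict :: "('f, 'r, 'a) struct \<Rightarrow> 'a set \<Rightarrow> ('f, 'r, 'a) struct" where
  "restrict M S = M\<lparr>universe := S\<rparr>"

text \<open>\<open>S\<close> is the universe of a substructure of \<open>M\<close>.\<close>

definition substructure :: "('f, 'r) lang \<Rightarrow> ('f, 'r, 'a) struct \<Rightarrow> 'a set \<Rightarrow> bool" where
  "substructure L M S \<longleftrightarrow> S \<subseteq> universe M \<and> is_struct L (restrict M S)"

inductive_set gen :: "('f, 'r) lang \<Rightarrow> ('f, 'r, 'a) struct \<Rightarrow> 'a set \<Rightarrow> 'a set"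
  for L M S where
  base: "x \<in> S \<Longrightarrow> x \<in> gen L M S"
| step: "f \<in> Funs L \<Longrightarrow> length xs = fun_ar L f \<Longrightarrow> (\<forall>x\<in>set xs. x \<in> gen L M S) \<Longrightarrow>
    fn M f xs \<in> gen L M S"

definition fin_gen_substructure ::
  "('f, 'r) lang \<Rightarrow> ('f, 'r, 'a) struct \<Rightarrow> 'a set \<Rightarrow> bool" where
  "fin_gen_substructure L M S \<longleftrightarrow>
     substructure L M S \<and> (\<exists>X. finite X \<and> X \<subseteq> universe M \<and> S = gen L M X)"

definition locally_finite :: "('f, 'r) lang \<Rightarrow> ('f, 'r, 'a) struct \<Rightarrow> bool" where
  "locally_finite L M \<longleftrightarrow> (\<forall>S. fin_gen_substructure L M S \<longrightarrow> finite S)"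

text \<open>
  The members of the age are taken over the same element type as \<open>M\<close>. No isomorphism type is lost,
  as each one is represented by a substructure of \<open>M\<close>.
\<close>

definition age :: "('f, 'r) lang \<Rightarrow> ('f, 'r, 'a) struct \<Rightarrow> ('f, 'r, 'a) struct set" where
  "age L M = {A. is_struct L A \<and>
     (\<exists>S. fin_gen_substructure L M S \<and> isomorphic L A (restrict M S))}"

definition universal_theory ::
  "('f, 'r) lang \<Rightarrow> ('f, 'r, 'a) struct \<Rightarrow> ('f, 'r) fm set" where
  "universal_theory L M = {\<phi> \<in> universal_sentences L. holds M \<phi> []}"

text \<open>
  The isolating formula is required to belong to the type: otherwise \<open>Bot\<close> would always do.
  Given that \<open>\<theta>\<close> proves the complete type \<open>q\<close>, membership in \<open>q\<close> amounts to consistency of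
  \<open>\<theta>\<close> with the universal theory.
\<close>

definition qfi :: "('f, 'r) lang \<Rightarrow> ('f, 'r, 'a) struct \<Rightarrow> bool" where
  "qfi L M \<longleftrightarrow> (\<forall>xs. set xs \<subseteq> universe M \<longrightarrow>
     (\<exists>\<theta>\<in>qftp L M xs. \<forall>\<phi>\<in>qftp L M xs. proves L (insert \<theta> (universal_theory L M)) \<phi>))"

definition strict_linear_order_rel ::
  "('f, 'r) lang \<Rightarrow> ('f, 'r, 'a) struct \<Rightarrow> 'r \<Rightarrow> bool" where
  "strict_linear_order_rel L M lt \<longleftrightarrow> lt \<in> Rels L \<and> rel_ar L lt = 2 \<and>
     strict_linear_order_on (universe M)
       {(x, y). x \<in> universe M \<and> y \<in> universe M \<and> rl M lt [x, y]}"


section \<open>Ramsey classes\<close>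

definition copies ::
  "('f, 'r) lang \<Rightarrow> ('f, 'r, 'a) struct \<Rightarrow> ('f, 'r, 'b) struct \<Rightarrow> 'a set set" where
  "copies L C A = {S. substructure L C S \<and> isomorphic L (restrict C S) A}"

definition arrow ::
  "('f, 'r) lang \<Rightarrow> ('f, 'r, 'a) struct \<Rightarrow> ('f, 'r, 'b) struct \<Rightarrow> ('f, 'r, 'c) struct \<Rightarrow> nat \<Rightarrow> bool"
  where
  "arrow L C B A k \<longleftrightarrow> (\<forall>f :: 'a set \<Rightarrow> nat. f ` copies L C A \<subseteq> {..<k} \<longrightarrow>
     (\<exists>B'\<in>copies L C B. \<exists>c. \<forall>A'\<in>copies L (restrict C B') A. f A' = c))"

definition ramsey_class :: "('f, 'r) lang \<Rightarrow> ('f, 'r, 'a) struct set \<Rightarrow> bool" where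
  "ramsey_class L K \<longleftrightarrow> (\<forall>A\<in>K. is_struct L A \<and> finite (universe A)) \<and>
     (\<forall>A\<in>K. \<forall>B\<in>K. \<forall>k\<ge>1. \<exists>C\<in>K. arrow L C B A k)"


section \<open>Monster models\<close>

definition is_automorphism ::
  "('f, 'r) lang \<Rightarrow> ('f, 'r, 'm) struct \<Rightarrow> ('m \<Rightarrow> 'm) \<Rightarrow> bool" where
  "is_automorphism L M \<sigma> \<longleftrightarrow> is_iso L M M \<sigma>"

definition partial_elementary ::
  "('f, 'r) lang \<Rightarrow> ('f, 'r, 'm) struct \<Rightarrow> 'm set \<Rightarrow> ('m \<Rightarrow> 'm) \<Rightarrow> bool" where
  "partial_elementary L M A p \<longleftrightarrow> A \<subseteq> universe M \<and> p ` A \<subseteq> universe M \<and>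
     (\<forall>xs. set xs \<subseteq> A \<longrightarrow> tp L M (map p xs) = tp L M xs)"

text \<open>
  A pair \<open>(\<phi>, as)\<close> with \<open>as\<close> a list over \<open>A\<close> is the formula \<open>\<phi>(x, as)\<close> in one variable
  (index 0) with parameters from \<open>A\<close>.
\<close>

definition saturated :: "'k rel \<Rightarrow> ('f, 'r) lang \<Rightarrow> ('f, 'r, 'm) struct \<Rightarrow> bool" where
  "saturated \<kappa> L M \<longleftrightarrow> (\<forall>A\<subseteq>universe M. |A| <o \<kappa> \<longrightarrow>
     (\<forall>p. (\<forall>(\<phi>, as)\<in>p. set as \<subseteq> A \<and> \<phi> \<in> formulas L (Suc (length as))) \<and>
          (\<forall>p0\<subseteq>p. finite p0 \<longrightarrow> (\<exists>c\<in>universe M. \<forall>(\<phi>, as)\<in>p0. holds M \<phi> (c # as))) \<longrightarrow>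
          (\<exists>c\<in>universe M. \<forall>(\<phi>, as)\<in>p. holds M \<phi> (c # as))))"

definition strongly_homogeneous :: "'k rel \<Rightarrow> ('f, 'r) lang \<Rightarrow> ('f, 'r, 'm) struct \<Rightarrow> bool" where
  "strongly_homogeneous \<kappa> L M \<longleftrightarrow> (\<forall>A p. |A| <o \<kappa> \<and> partial_elementary L M A p \<longrightarrow>
     (\<exists>\<sigma>. is_automorphism L M \<sigma> \<and> (\<forall>x\<in>A. \<sigma> x = p x)))"

text \<open>
  The cardinal \<open>\<kappa>\<close> is the usual bound on small sets: a set is small if its cardinality is less
  than \<open>\<kappa>\<close>.
\<close>

definition monster ::
  "'k rel \<Rightarrow> ('f, 'r) lang \<Rightarrow> ('f, 'r) fm set \<Rightarrow> ('f, 'r, 'm) struct \<Rightarrow> bool" where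
  "monster \<kappa> L T M \<longleftrightarrow> is_model L T M \<and> saturated \<kappa> L M \<and> strongly_homogeneous \<kappa> L M"


section \<open>Generalized indiscernibles\<close>

text \<open>
  An indexed set of \<open>m\<close>-tuples is a function to lists of length \<open>m\<close>; for a list \<open>is\<close> of
  indices, \<open>concat (map b is)\<close> is the concatenation of the tuples with these indices.
\<close>

definition indiscernible ::
  "('g, 'q) lang \<Rightarrow> ('g, 'q, 'i) struct \<Rightarrow> ('f, 'r) lang \<Rightarrow> ('f, 'r, 'm) struct \<Rightarrow>
   ('i \<Rightarrow> 'm list) \<Rightarrow> bool" where
  "indiscernible L' I L M b \<longleftrightarrow>
     (\<forall>is js. set is \<subseteq> universe I \<and> set js \<subseteq> universe I \<and> length is = length js \<and>
        qftp L' I is = qftp L' I js \<longrightarrow>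
        tp L M (concat (map b is)) = tp L M (concat (map b js)))"

definition nontrivial :: "('g, 'q, 'i) struct \<Rightarrow> ('i \<Rightarrow> 'm list) \<Rightarrow> bool" where
  "nontrivial I b \<longleftrightarrow> inj_on b (universe I)"

definition locally_based ::
  "('g, 'q) lang \<Rightarrow> ('g, 'q, 'i) struct \<Rightarrow> ('f, 'r) lang \<Rightarrow> ('f, 'r, 'm) struct \<Rightarrow>
   ('i \<Rightarrow> 'm list) \<Rightarrow> ('i \<Rightarrow> 'm list) \<Rightarrow> bool" where
  "locally_based L' I L M b a \<longleftrightarrow>
     (\<forall>ts \<Delta>. set ts \<subseteq> universe I \<and> finite \<Delta> \<and>
        \<Delta> \<subseteq> formulas L (length (concat (map b ts))) \<longrightarrow>
        (\<exists>ss. set ss \<subseteq> universe I \<and> length ss = length ts \<and> qftp L' I ss = qftp L' I ts \<and>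
           (\<forall>\<phi>\<in>\<Delta>. holds M \<phi> (concat (map b ts)) \<longleftrightarrow> holds M \<phi> (concat (map a ss)))))"

text \<open>
  Languages have size less than \<open>\<kappa>\<close>; their symbols and the elements of their models come from the
  types in the \<open>itself\<close> argument. Nontriviality of the indiscernible can only be asked for
  nontrivial parameters: if all \<open>a i\<close> are equal, then so are all \<open>b i\<close> for any \<open>b\<close> locally
  based on \<open>a\<close>.
\<close>

definition modeling_property ::
  "'k rel \<Rightarrow> ('f, 'r, 'm) struct itself \<Rightarrow> ('g, 'q) lang \<Rightarrow> ('g, 'q, 'i) struct \<Rightarrow> bool" where
  "modeling_property \<kappa> _ L' I \<longleftrightarrow>
     (\<forall>(L :: ('f, 'r) lang) T (M :: ('f, 'r, 'm) struct) m a.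
        |Funs L| <o \<kappa> \<and> |Rels L| <o \<kappa> \<and> complete_theory L T \<and> monster \<kappa> L T M \<and>
        (\<forall>i\<in>universe I. a i \<in> tuples M m) \<longrightarrow>
        (\<exists>b. (\<forall>i\<in>universe I. b i \<in> tuples M m) \<and> indiscernible L' I L M b \<and>
             locally_based L' I L M b a \<and> (nontrivial I a \<longrightarrow> nontrivial I b)))"

text \<open>
  The bound \<open>\<kappa>\<close> on small sets is uncountable and exceeds the size of the index structure. The
  element type of the models must be large enough to contain monster models: a theory in a language
  of size less than \<open>\<kappa>\<close> has \<open>\<kappa>\<close>-saturated, strongly \<open>\<kappa>\<close>-homogeneous models of size at most
  \<open>2\<^sup>\<kappa>\<close>, so it suffices to ask for two powersets of \<open>\<kappa>\<close>.
\<close>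

definition monster_setting :: "'k rel \<Rightarrow> 'm itself \<Rightarrow> ('g, 'q, 'i) struct \<Rightarrow> bool" where
  "monster_setting \<kappa> _ I \<longleftrightarrow> Card_order \<kappa> \<and> natLeq <o \<kappa> \<and> |universe I| <o \<kappa> \<and>
     |Pow (Pow (Field \<kappa>))| \<le>o |UNIV :: 'm set|"

end

theory Submission
  imports Defs
begin

text \<open>
  If the age is Ramsey, a finite set of instances of indiscernibility can be satisfied by replacing
  the parameters \<open>a i\<close> with \<open>a (h i)\<close> for an embedding \<open>h\<close> of a finite substructure: the truth value of
  a formula is a colouring of tuples, and, by the linear order, of copies of the generated structure.
  Together with the Ehrenfeucht-Mostowski type of \<open>a\<close> these instances form a finitely satisfiable
  type in fewer than \<open>\<kappa>\<close> variables, which is realised by saturation.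

  Conversely, if some \<open>A\<close> and \<open>B\<close> admit bad colourings on all finite substructures, an ultrafilter gives
  a bad colouring of the copies of \<open>A\<close> in \<open>I\<close>. It is coded in one relation of a homogeneous
  universal structure, which is a monster model: homogeneity makes quantifier-free equivalent small
  tuples conjugate, so no quantifier elimination is needed. A copy of \<open>B\<close> on which the
  parameters agree with an indiscernible family for the coding formulas is then monochromatic.
\<close>

section \<open>Satisfaction, substitution and embeddings\<close>

text \<open>The types of symbols and of elements are prescribed: \<open>'r\<close> may have one
  element only, and \<open>'m\<close> is merely large. So the converse uses \<open>k\<close>-tuples
  of parameters, one coordinate per colour, and a single relation whose arity is the length of an
  enumeration of \<open>A\<close>. The two powersets of \<open>\<kappa>\<close> have a similar
  origin. With \<open>K = Field \<kappa>\<close>, the homogeneous structure is approximated by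
  pieces of size at most 2^K, each of which has at most (2^K)^K = 2^K partial isomorphisms of size
  at most \<open>K\<close>; their union outgrows 2^K, so \<open>|Pow K|\<close> must be strictly
  below the size of \<open>'m\<close>. Homogeneity for all domains of size at most \<open>K\<close>
  covers every small set. In the other direction the obstacle is that copies are sets while
  indiscernibility concerns tuples; finite linear orders are rigid, so a copy has at most one
  generating tuple of a given quantifier-free type. Several colourings must be treated by one
  embedding, which is why the finite host structures are chosen before the maps into
  \<open>I\<close> are known. Finally, saturation concerns one variable, whereas a whole family is
  to be realised at once.\<close>

lemma eval_cong: "(\<And>n. n \<in> fv_tm t \<Longrightarrow> e n = e' n) \<Longrightarrow> eval M e t = eval M e' t"
proof (induction t)
  case (Fn f ts)
  have "eval M e t = eval M e' t" if "t \<in> set ts" for t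
    using that Fn.prems by (intro Fn.IH) auto
  then have "map (eval M e) ts = map (eval M e') ts" by simp
  then show ?case by (simp only: eval.simps)
qed simp

lemma sat_cong: "(\<And>n. n \<in> fv \<phi> \<Longrightarrow> e n = e' n) \<Longrightarrow> sat M e \<phi> = sat M e' \<phi>"
proof (induction \<phi> arbitrary: e e')
  case (Eq t u)
  then show ?case using eval_cong[of t e e' M] eval_cong[of u e e' M] by simp
next
  case (Rl r ts)
  have "eval M e t = eval M e' t" if "t \<in> set ts" for t
    using that Rl.prems by (intro eval_cong) auto
  then have "map (eval M e) ts = map (eval M e') ts" by simp
  then show ?case by (simp only: sat.simps)
next
  case (Imp \<phi> \<psi>)
  from Imp.IH(1)[of e e'] Imp.IH(2)[of e e'] Imp.prems show ?case by simp
next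
  case (All \<phi>)
  have "sat M (case_nat a e) \<phi> = sat M (case_nat a e') \<phi>" for a
    using All.prems by (intro All.IH) (auto split: nat.split)
  then show ?case by simp
qed simp

lemma eval_subst: "eval M e (subst_tm s t) = eval M (\<lambda>n. eval M e (s n)) t"
proof (induction t)
  case (Fn f ts)
  then have "map (\<lambda>t. eval M e (subst_tm s t)) ts = map (eval M (\<lambda>n. eval M e (s n))) ts" by simp
  then show ?case by (simp only: eval.simps subst_tm.simps map_map comp_def)
qed simp

lemma eval_shift: "eval M (case_nat a e) (subst_tm shift t) = eval M e t"
  by (simp add: eval_subst shift_def)

lemma sat_subst: "sat M e (subst s \<phi>) = sat M (\<lambda>n. eval M e (s n)) \<phi>"
proof (induction \<phi> arbitrary: e s)
  case (All \<phi>)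
  have "(\<lambda>n. eval M (case_nat a e) (case_nat (Var 0) (\<lambda>n. subst_tm shift (s n)) n)) =
      case_nat a (\<lambda>n. eval M e (s n))" for a
    by (rule ext) (simp add: eval_shift split: nat.split)
  then show ?case by (simp add: All)
qed (simp_all add: eval_subst comp_def)

lemma sat_inst: "sat M e (inst t \<phi>) = sat M (case_nat (eval M e t) e) \<phi>"
proof -
  have "(\<lambda>n. eval M e (case_nat t Var n)) = case_nat (eval M e t) e"
    by (rule ext) (simp split: nat.split)
  then show ?thesis by (simp add: inst_def sat_subst)
qed

lemma eval_in_universe:
  assumes "is_struct L M"
  shows "wf_tm L t \<Longrightarrow> (\<And>n. n \<in> fv_tm t \<Longrightarrow> e n \<in> universe M) \<Longrightarrow> eval M e t \<in> universe M"
proof (induction t)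
  case (Fn f ts)
  then have "map (eval M e) ts \<in> tuples M (fun_ar L f)"
    by (auto simp: tuples_def list_all_iff)
  then show ?case using assms Fn.prems by (simp add: is_struct_def)
qed simp

text \<open>Needed for the consistency of the theory of a structure. All values of \<open>e\<close>
  have to lie in the universe, since rule \<open>AllE\<close> may instantiate with terms in any
  variables.\<close>

theorem soundness:
  assumes "proves L \<Gamma> \<phi>" "is_struct L M"
  shows "(\<And>n. e n \<in> universe M) \<Longrightarrow> (\<And>\<gamma>. \<gamma> \<in> \<Gamma> \<Longrightarrow> sat M e \<gamma>) \<Longrightarrow> sat M e \<phi>"
  using assms(1)
proof (induction arbitrary: e rule: proves.induct)
  case (AllI \<Gamma> \<phi>)
  have "sat M (case_nat a e) \<phi>" if "a \<in> universe M" for a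
  proof (rule AllI.IH)
    show "case_nat a e n \<in> universe M" for n using that AllI.prems by (simp split: nat.split)
    have "sat M (case_nat a e) (subst shift \<gamma>) = sat M e \<gamma>" for \<gamma>
      by (simp add: sat_subst shift_def)
    then show "sat M (case_nat a e) \<gamma>" if "\<gamma> \<in> subst shift ` \<Gamma>" for \<gamma>
      using that AllI.prems(2) by auto
  qed
  then show ?case by simp
next
  case (AllE \<Gamma> \<phi> t)
  then have "eval M e t \<in> universe M" using eval_in_universe[OF assms(2)] by blast
  moreover have "sat M e (All \<phi>)" using AllE by blast
  ultimately show ?case by (simp add: sat_inst)
next
  case (EqE \<phi> \<Gamma> t u)
  then have "sat M e (Eq t u)" "sat M e (inst t \<phi>)" by blast+
  then show ?case by (simp add: sat_inst)
next
  case (ImpI \<phi> \<Gamma> \<psi>)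
  have "sat M e \<psi>" if "sat M e \<phi>" using that ImpI.prems by (intro ImpI.IH) auto
  then show ?case by simp
next
  case (Class \<phi> \<Gamma>)
  have False if "\<not> sat M e \<phi>"
  proof -
    have "sat M e Bot" using that Class.prems by (intro Class.IH) auto
    then show False by simp
  qed
  then show ?case by blast
next
  case (ImpE \<Gamma> \<phi> \<psi>)
  then have "sat M e (Imp \<phi> \<psi>)" "sat M e \<phi>" by blast+
  then show ?case by simp
qed simp_all

section \<open>Renaming of variables\<close>

abbreviation rename :: "(nat \<Rightarrow> nat) \<Rightarrow> ('f, 'r) fm \<Rightarrow> ('f, 'r) fm" where
  "rename f \<equiv> subst (\<lambda>n. Var (f n))"

lemma sat_rename: "sat M e (rename f \<phi>) = sat M (\<lambda>n. e (f n)) \<phi>"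
  by (simp add: sat_subst)

lemma subst_tm_rename:
  "fv_tm (subst_tm (\<lambda>n. Var (f n)) t) = f ` fv_tm t" "wf_tm L (subst_tm (\<lambda>n. Var (f n)) t) = wf_tm L t"
  by (induction t) (auto simp: list_all_iff)

text \<open>A renaming pushed under a quantifier is again a renaming, so inductions on formulas can
  generalise over \<open>f\<close>.\<close>

lemma rename_All: "case_nat (Var 0) (\<lambda>n. subst_tm shift (Var (f n))) = (\<lambda>n. Var (case_nat 0 (\<lambda>k. Suc (f k)) n))"
  by (rule ext) (simp add: shift_def split: nat.split)

lemma fv_rename: "fv (rename f \<phi>) = f ` fv \<phi>"
proof (induction \<phi> arbitrary: f)
  case (All \<phi>)
  have "{n. Suc n \<in> case_nat 0 (\<lambda>k. Suc (f k)) ` fv \<phi>} = f ` {n. Suc n \<in> fv \<phi>}"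
    by (force split: nat.splits)
  then show ?case by (simp only: subst.simps rename_All fv.simps All)
qed (auto simp: subst_tm_rename)

lemma wf_rename: "wf_fm L (rename f \<phi>) = wf_fm L \<phi>"
proof (induction \<phi> arbitrary: f)
  case (All \<phi>)
  then show ?case by (simp only: subst.simps rename_All wf_fm.simps)
qed (auto simp: subst_tm_rename list_all_iff)

lemma finite_fv_tm: "finite (fv_tm t)"
  by (induction t) auto

lemma finite_fv: "finite (fv \<phi>)"
proof (induction \<phi>)
  case (All \<phi>)
  have "fv (All \<phi>) \<subseteq> (\<lambda>n. n - 1) ` fv \<phi>" by force
  then show ?case using All finite_surj by blast
qed (auto simp: finite_fv_tm)

section \<open>Embeddings and the formulas they preserve\<close>

definition embedding ::
  "('f, 'r) lang \<Rightarrow> ('f, 'r, 'a) struct \<Rightarrow> ('f, 'r, 'b) struct \<Rightarrow> ('a \<Rightarrow> 'b) \<Rightarrow> bool" where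
  "embedding L A B h \<longleftrightarrow> inj_on h (universe A) \<and> h ` universe A \<subseteq> universe B \<and>
     (\<forall>f\<in>Funs L. \<forall>xs\<in>tuples A (fun_ar L f). h (fn A f xs) = fn B f (map h xs)) \<and>
     (\<forall>r\<in>Rels L. \<forall>xs\<in>tuples A (rel_ar L r). rl A r xs \<longleftrightarrow> rl B r (map h xs))"

lemma is_iso_iff_embedding: "is_iso L A B h \<longleftrightarrow> embedding L A B h \<and> h ` universe A = universe B"
  unfolding is_iso_def embedding_def bij_betw_def by auto

lemma embeddingD:
  assumes "embedding L A B h"
  shows "inj_on h (universe A)" "h ` universe A \<subseteq> universe B"
    "f \<in> Funs L \<Longrightarrow> set xs \<subseteq> universe A \<Longrightarrow> length xs = fun_ar L f \<Longrightarrow> h (fn A f xs) = fn B f (map h xs)"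
    "r \<in> Rels L \<Longrightarrow> set xs \<subseteq> universe A \<Longrightarrow> length xs = rel_ar L r \<Longrightarrow> rl A r xs \<longleftrightarrow> rl B r (map h xs)"
  using assms unfolding embedding_def tuples_def by auto

lemma eval_embedding:
  assumes "embedding L A B h" "is_struct L A"
  shows "wf_tm L t \<Longrightarrow> (\<And>n. n \<in> fv_tm t \<Longrightarrow> e n \<in> universe A \<and> e' n = h (e n)) \<Longrightarrow>
    eval B e' t = h (eval A e t)"
proof (induction t)
  case (Fn f ts)
  have "eval A e t \<in> universe A" if "t \<in> set ts" for t
    using that Fn.prems by (intro eval_in_universe[OF assms(2)]) (auto simp: list_all_iff)
  then have "set (map (eval A e) ts) \<subseteq> universe A" "length (map (eval A e) ts) = fun_ar L f"
    using Fn.prems by auto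
  moreover have "eval B e' t = h (eval A e t)" if "t \<in> set ts" for t
    using that Fn.prems by (intro Fn.IH) (auto simp: list_all_iff)
  then have "map (eval B e') ts = map h (map (eval A e) ts)" by simp
  ultimately show ?case using embeddingD(3)[OF assms(1), of f "map (eval A e) ts"] Fn.prems
    by (simp only: eval.simps wf_tm.simps)
qed simp

text \<open>One induction serves embeddings with quantifier-free formulas and isomorphisms with all
  formulas: in the case of a quantifier the disjunction leaves only the surjective
  alternative.\<close>

lemma sat_embedding:
  assumes "embedding L A B h" "is_struct L A"
  shows "wf_fm L \<phi> \<Longrightarrow> qfree \<phi> \<or> h ` universe A = universe B \<Longrightarrow>
    (\<And>n. n \<in> fv \<phi> \<Longrightarrow> e n \<in> universe A \<and> e' n = h (e n)) \<Longrightarrow> sat B e' \<phi> = sat A e \<phi>"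
proof (induction \<phi> arbitrary: e e')
  case (Eq t u)
  then have "eval A e t \<in> universe A" "eval A e u \<in> universe A"
    by (auto intro!: eval_in_universe[OF assms(2)])
  moreover have "eval B e' t = h (eval A e t)" "eval B e' u = h (eval A e u)"
    using Eq by (auto intro!: eval_embedding[OF assms(1,2)])
  ultimately show ?case using inj_on_eq_iff[OF embeddingD(1)[OF assms(1)]] by simp
next
  case (Rl r ts)
  have "eval A e t \<in> universe A" if "t \<in> set ts" for t
    using that Rl by (intro eval_in_universe[OF assms(2)]) (auto simp: list_all_iff)
  then have "set (map (eval A e) ts) \<subseteq> universe A" by auto
  moreover have "eval B e' t = h (eval A e t)" if "t \<in> set ts" for t
    using that Rl by (intro eval_embedding[OF assms(1,2)]) (auto simp: list_all_iff)
  then have "map (eval B e') ts = map h (map (eval A e) ts)" by simp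
  ultimately show ?case using embeddingD(4)[OF assms(1), of r "map (eval A e) ts"] Rl(1)
    by (simp only: sat.simps wf_fm.simps length_map)
next
  case (Imp \<phi> \<psi>)
  have "sat B e' \<phi> = sat A e \<phi>" "sat B e' \<psi> = sat A e \<psi>" using Imp.prems by (intro Imp.IH; auto)+
  then show ?case by simp
next
  case (All \<phi>)
  then have img: "h ` universe A = universe B" by simp
  have "sat B (case_nat (h a) e') \<phi> = sat A (case_nat a e) \<phi>" if "a \<in> universe A" for a
    using All.prems img that by (intro All.IH) (auto split: nat.split)
  then show ?case by (simp add: img[symmetric])
qed simp

lemma holds_embedding:
  assumes "embedding L A B h" "is_struct L A" "set xs \<subseteq> universe A" "\<phi> \<in> formulas L (length xs)"
    "qfree \<phi> \<or> h ` universe A = universe B"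
  shows "holds B \<phi> (map h xs) = holds A \<phi> xs"
  unfolding holds_def
proof (rule sat_embedding[OF assms(1,2) _ assms(5)])
  show "wf_fm L \<phi>" using assms(4) by (simp add: formulas_def)
  show "xs ! n \<in> universe A \<and> map h xs ! n = h (xs ! n)" if "n \<in> fv \<phi>" for n
  proof -
    have "n < length xs" using assms(4) that by (auto simp: formulas_def)
    then show ?thesis using assms(3) by auto
  qed
qed

lemma qftp_embedding:
  assumes "embedding L A B h" "is_struct L A" "set xs \<subseteq> universe A"
  shows "qftp L B (map h xs) = qftp L A xs"
  using holds_embedding[OF assms] unfolding qftp_def qf_formulas_def by auto

section \<open>A homogeneous universal relation\<close>

text \<open>Maps are sets of pairs, so that back and forth are exchanged by the converse and chains
  have unions.\<close>

definition part_iso :: "'a set \<Rightarrow> ('a list \<Rightarrow> bool) \<Rightarrow> 'a rel \<Rightarrow> bool" where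
  "part_iso X R g \<longleftrightarrow> g \<subseteq> X \<times> X \<and> single_valued g \<and> single_valued (g\<inverse>) \<and>
     (\<forall>xs ys. list_all2 (\<lambda>x y. (x, y) \<in> g) xs ys \<longrightarrow> R xs = R ys)"

text \<open>\<open>R\<close> is false on all other lists; this makes it harmless that
  \<open>part_iso\<close> compares lists of every length.\<close>

definition nary :: "nat \<Rightarrow> 'a set \<Rightarrow> ('a list \<Rightarrow> bool) \<Rightarrow> bool" where
  "nary n X R \<longleftrightarrow> (\<forall>xs. R xs \<longrightarrow> length xs = n \<and> set xs \<subseteq> X)"

lemma part_isoD:
  assumes "part_iso X R g"
  shows "g \<subseteq> X \<times> X" "(x, y) \<in> g \<Longrightarrow> (x, y') \<in> g \<Longrightarrow> y = y'" "(x, y) \<in> g \<Longrightarrow> (x', y) \<in> g \<Longrightarrow> x = x'"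
    "list_all2 (\<lambda>x y. (x, y) \<in> g) xs ys \<Longrightarrow> R xs = R ys"
  using assms unfolding part_iso_def single_valued_def by blast+

lemma list_all2_converse: "list_all2 (\<lambda>x y. (x, y) \<in> g\<inverse>) xs ys \<longleftrightarrow> list_all2 (\<lambda>x y. (x, y) \<in> g) ys xs"
  using list_all2_conv_all_nth[of "\<lambda>x y. (x, y) \<in> g\<inverse>"] list_all2_conv_all_nth[of "\<lambda>x y. (x, y) \<in> g"]
  by auto

lemma part_iso_converse: "part_iso X R (g\<inverse>) \<longleftrightarrow> part_iso X R g"
  unfolding part_iso_def list_all2_converse by auto

lemma part_iso_empty: "part_iso X R {}"
proof -
  have "xs = [] \<and> ys = []" if "list_all2 (\<lambda>x y. (x, y) \<in> {}) xs ys" for xs ys :: "'a list"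
    using that by (cases xs; cases ys) auto
  then show ?thesis unfolding part_iso_def by (auto simp: single_valued_def)
qed

lemma part_iso_cong:
  assumes "X \<subseteq> Y" "\<And>xs. set xs \<subseteq> X \<Longrightarrow> S xs = R xs" "g \<subseteq> X \<times> X"
  shows "part_iso Y S g \<longleftrightarrow> part_iso X R g"
proof -
  have "set xs \<subseteq> X \<and> set ys \<subseteq> X" if "list_all2 (\<lambda>x y. (x, y) \<in> g) xs ys" for xs ys
    using that assms(3) by (induction rule: list_all2_induct) auto
  then have "(list_all2 (\<lambda>x y. (x, y) \<in> g) xs ys \<longrightarrow> S xs = S ys) \<longleftrightarrow>
      (list_all2 (\<lambda>x y. (x, y) \<in> g) xs ys \<longrightarrow> R xs = R ys)" for xs ys
    using assms(2) by blast
  moreover have "g \<subseteq> Y \<times> Y" using assms by blast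
  ultimately show ?thesis using assms(3) unfolding part_iso_def by simp
qed

lemma list_all2_Domain: "list_all2 (\<lambda>x y. (x, y) \<in> g) xs ys \<Longrightarrow> set xs \<subseteq> Domain g"
  by (induction rule: list_all2_induct) auto

lemma list_all2_Range: "list_all2 (\<lambda>x y. (x, y) \<in> g) xs ys \<Longrightarrow> set ys \<subseteq> Range g"
  by (induction rule: list_all2_induct) auto

text \<open>Every point \<open>a\<close> outside the domain of \<open>g l\<close> receives a new image \<open>\<nu> (l, a)\<close>, and \<open>R\<close> is transported
  along each extended map; distinct maps meet only inside \<open>X\<close>, so the transported relations agree.\<close>

lemma extend_forward:
  fixes g :: "'l \<Rightarrow> 'a rel"
  assumes R: "nary n X R" and g: "\<And>l. part_iso X R (g l)"
    and inj: "inj_on \<nu> (\<Lambda> \<times> X)" and new: "\<nu> ` (\<Lambda> \<times> X) \<inter> X = {}"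
  shows "\<exists>S h. nary n (X \<union> \<nu> ` (\<Lambda> \<times> X)) S \<and> (\<forall>xs. set xs \<subseteq> X \<longrightarrow> S xs = R xs) \<and>
    (\<forall>l. part_iso (X \<union> \<nu> ` (\<Lambda> \<times> X)) S (h l)) \<and> (\<forall>l. g l \<subseteq> h l) \<and>
    (\<forall>l\<in>\<Lambda>. X \<subseteq> Domain (h l)) \<and> (\<forall>l. l \<notin> \<Lambda> \<longrightarrow> h l = g l)"
proof -
  define h where "h l = (if l \<in> \<Lambda> then g l \<union> {(a, \<nu> (l, a)) | a. a \<in> X - Domain (g l)} else g l)" for l
  define S where "S zs \<longleftrightarrow> R zs \<or> (\<exists>l\<in>\<Lambda>. \<exists>ys. R ys \<and> list_all2 (\<lambda>x y. (x, y) \<in> h l) ys zs)" for zs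
  let ?Y = "X \<union> \<nu> ` (\<Lambda> \<times> X)"
  \<comment> \<open>New images lie outside \<open>X\<close>, so whatever \<open>h l\<close> sends
    into \<open>X\<close> was already sent there by \<open>g l\<close>.\<close>
  have old: "list_all2 (\<lambda>x y. (x, y) \<in> g l) xs ys"
    if "list_all2 (\<lambda>x y. (x, y) \<in> h l) xs ys" "set ys \<subseteq> X" for l xs ys
    using that
  proof (induction rule: list_all2_induct)
    case (Cons x xs y ys)
    then have "y \<in> X" by simp
    then have "(x, y) \<in> g l" using Cons(1) new by (auto simp: h_def split: if_splits)
    then show ?case using Cons by simp
  qed simp
  have hX: "h l \<subseteq> X \<times> ?Y" for l using part_isoD(1)[OF g] by (fastforce simp: h_def split: if_splits)
  have agree: "S xs = R xs" if "set xs \<subseteq> X" for xs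
    using old[OF _ that] part_isoD(4)[OF g] unfolding S_def by blast
  have sv: "single_valued (h l)" for l
    using g[of l] unfolding part_iso_def single_valued_def h_def by (auto split: if_splits)
  have sv': "x = x'" if "(x, y) \<in> h l" "(x', y) \<in> h l" for l x x' y
  proof -
    have G: "g l \<subseteq> X \<times> X" using g part_isoD(1) by blast
    have "\<nu> (l, a) \<notin> X" if "l \<in> \<Lambda>" "a \<in> X" for a using new that by blast
    then show ?thesis using that G part_isoD(3)[OF g] inj
      unfolding h_def by (auto split: if_splits dest: inj_onD)
  qed
  have cross: "y \<in> X" if "(x, y) \<in> h l" "(x', y) \<in> h l'" "l \<noteq> l'" "l \<in> \<Lambda>" "l' \<in> \<Lambda>" for x x' y l l'
  proof (rule ccontr)
    assume "y \<notin> X"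
    then have "(x, y) \<notin> g l" "(x', y) \<notin> g l'" using part_isoD(1)[OF g] by blast+
    with that have "y = \<nu> (l, x)" "y = \<nu> (l', x')" "x \<in> X" "x' \<in> X" by (auto simp: h_def)
    with inj that show False by (auto dest: inj_onD)
  qed
  have pi: "part_iso ?Y S (h l)" for l
  proof (cases "l \<in> \<Lambda>")
    case False
    then have "h l = g l" by (simp add: h_def)
    then show ?thesis using g[of l] part_iso_cong[of X ?Y S R "g l"] agree part_isoD(1)[OF g] by auto
  next
    case l: True
    have "S xs = S ys" if a2: "list_all2 (\<lambda>x y. (x, y) \<in> h l) xs ys" for xs ys
    proof
      have xs: "set xs \<subseteq> X" using list_all2_Domain[OF a2] hX by blast
      show "S xs \<Longrightarrow> S ys" using agree[OF xs] l a2 unfolding S_def by blast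
      \<comment> \<open>If \<open>ys\<close> got related as an image under the same map, injectivity
        identifies the preimages. If it came from another map, \<open>ys\<close> lies in the overlap
        of the two images, hence in \<open>X\<close>, where both old maps preserve
        \<open>R\<close>.\<close>
      assume "S ys"
      then consider "R ys" | l' ws where "l' \<in> \<Lambda>" "R ws" "list_all2 (\<lambda>x y. (x, y) \<in> h l') ws ys"
        unfolding S_def by blast
      then have "R xs"
      proof cases
        case 1
        then have "set ys \<subseteq> X" using R by (auto simp: nary_def)
        then show ?thesis using 1 old[OF a2] part_isoD(4)[OF g] by blast
      next
        case 2
        show ?thesis
        proof (cases "l' = l")
          case True
          have "ws = xs" using 2(3) a2 unfolding True list_all2_conv_all_nth
            by (intro nth_equalityI) (simp, metis sv')
          then show ?thesis using 2 by simp
        next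
          case False
          have "set ys \<subseteq> X"
          proof
            fix y assume "y \<in> set ys"
            then obtain i where i: "i < length ys" "y = ys ! i" by (auto simp: in_set_conv_nth)
            then show "y \<in> X" using a2 2 cross[of "xs ! i" y l "ws ! i" l'] l False
              by (auto simp: list_all2_conv_all_nth)
          qed
          then show ?thesis using old[OF a2] old[OF 2(3)] 2(2) part_isoD(4)[OF g] by blast
        qed
      qed
      then show "S xs" using agree[OF xs] by simp
    qed
    then show ?thesis using hX[of l] sv sv' unfolding part_iso_def
      by (auto simp: single_valued_def)
  qed
  have "nary n ?Y S" unfolding nary_def
  proof (intro allI impI)
    fix zs assume "S zs"
    then show "length zs = n \<and> set zs \<subseteq> ?Y" unfolding S_def
    proof
      assume "\<exists>l\<in>\<Lambda>. \<exists>ys. R ys \<and> list_all2 (\<lambda>x y. (x, y) \<in> h l) ys zs"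
      then obtain l ys where "R ys" and a2: "list_all2 (\<lambda>x y. (x, y) \<in> h l) ys zs" by blast
      then have "length zs = n" using R list_all2_lengthD[OF a2] by (auto simp: nary_def)
      moreover have "set zs \<subseteq> ?Y" using list_all2_Range[OF a2] hX[of l] by blast
      ultimately show ?thesis by simp
    qed (use R in \<open>auto simp: nary_def\<close>)
  qed
  moreover have "X \<subseteq> Domain (h l)" if "l \<in> \<Lambda>" for l using that by (auto simp: h_def)
  moreover have "g l \<subseteq> h l" "l \<notin> \<Lambda> \<Longrightarrow> h l = g l" for l by (auto simp: h_def)
  ultimately show ?thesis using agree pi by (intro exI[of _ S] exI[of _ h]) blast
qed

section \<open>Room for new points\<close>

lemma card_of_Un_ordLeq: "infinite W \<Longrightarrow> |A| \<le>o |W| \<Longrightarrow> |B| \<le>o |W| \<Longrightarrow> |A \<union> B| \<le>o |W|"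
  by (rule card_of_Un_ordLeq_infinite_Field[of "|W|", unfolded Field_card_of, OF _ _ _ card_of_card_order_on])

lemma card_of_Times_ordLeq: "infinite W \<Longrightarrow> |A| \<le>o |W| \<Longrightarrow> |B| \<le>o |W| \<Longrightarrow> |A \<times> B| \<le>o |W|"
  by (rule card_of_Times_ordLeq_infinite_Field[of "|W|", unfolded Field_card_of, OF _ _ _ card_of_card_order_on])

text \<open>Otherwise the complement of \<open>X\<close> would have size at most \<open>W\<close>,
  and so would the whole type. New points can thus be taken from \<open>'m\<close> itself.\<close>

lemma fresh_injection:
  fixes X :: "'m set"
  assumes "infinite W" "|X| \<le>o |W|" "|N| \<le>o |W|" "|W| <o |UNIV :: 'm set|"
  obtains \<nu> where "inj_on \<nu> N" "\<nu> ` N \<inter> X = {}"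
proof -
  have "|N| \<le>o |UNIV - X|"
  proof (rule ccontr)
    assume "\<not> |N| \<le>o |UNIV - X|"
    then have "|UNIV - X| \<le>o |W|"
      using assms(3) by (meson card_of_Well_order not_ordLeq_iff_ordLess ordLeq_transitive ordLess_imp_ordLeq)
    then have "|X \<union> (UNIV - X)| \<le>o |W|" using assms by (intro card_of_Un_ordLeq)
    then show False using assms(4) not_ordLess_ordLeq by auto
  qed
  then show thesis using that unfolding card_of_ordLeq[symmetric] by blast
qed

text \<open>Back and forth: \<open>extend_forward\<close> is applied to the maps and then, over the
  enlarged set, to their converses.\<close>

lemma extend_both:
  fixes g :: "'l \<Rightarrow> 'm rel" and X :: "'m set"
  assumes R: "nary n X R" and g: "\<And>l. part_iso X R (g l)"
    and W: "infinite W" "|X| \<le>o |W|" "|\<Lambda>| \<le>o |W|" "|W| <o |UNIV :: 'm set|"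
    and ne: "X \<noteq> {}" "\<Lambda> \<noteq> {}"
  shows "\<exists>Y S h. X \<subset> Y \<and> |Y| \<le>o |W| \<and> nary n Y S \<and> (\<forall>xs. set xs \<subseteq> X \<longrightarrow> S xs = R xs) \<and>
    (\<forall>l. part_iso Y S (h l)) \<and> (\<forall>l. g l \<subseteq> h l) \<and>
    (\<forall>l\<in>\<Lambda>. X \<subseteq> Domain (h l) \<and> X \<subseteq> Range (h l)) \<and> (\<forall>l. l \<notin> \<Lambda> \<longrightarrow> h l = g l)"
proof -
  have c1: "|\<Lambda> \<times> X| \<le>o |W|" using W by (intro card_of_Times_ordLeq)
  obtain \<nu> :: "'l \<times> 'm \<Rightarrow> 'm" where nu: "inj_on \<nu> (\<Lambda> \<times> X)" "\<nu> ` (\<Lambda> \<times> X) \<inter> X = {}"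
    using fresh_injection[OF W(1,2) c1 W(4)] .
  define Y where "Y = X \<union> \<nu> ` (\<Lambda> \<times> X)"
  have cY: "|Y| \<le>o |W|" unfolding Y_def
    by (rule card_of_Un_ordLeq[OF W(1) W(2) ordLeq_transitive[OF card_of_image c1]])
  obtain S h where S: "nary n Y S" "\<And>xs. set xs \<subseteq> X \<Longrightarrow> S xs = R xs"
    "\<And>l. part_iso Y S (h l)" "\<And>l. g l \<subseteq> h l"
    "\<And>l. l \<in> \<Lambda> \<Longrightarrow> X \<subseteq> Domain (h l)" "\<And>l. l \<notin> \<Lambda> \<Longrightarrow> h l = g l"
    using extend_forward[where g = g, OF R g nu, folded Y_def] by blast
  have c2: "|\<Lambda> \<times> Y| \<le>o |W|" using W cY by (intro card_of_Times_ordLeq)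
  obtain \<mu> :: "'l \<times> 'm \<Rightarrow> 'm" where mu: "inj_on \<mu> (\<Lambda> \<times> Y)" "\<mu> ` (\<Lambda> \<times> Y) \<inter> Y = {}"
    using fresh_injection[OF W(1) cY c2 W(4)] .
  define Z where "Z = Y \<union> \<mu> ` (\<Lambda> \<times> Y)"
  have cZ: "|Z| \<le>o |W|" unfolding Z_def
    by (rule card_of_Un_ordLeq[OF W(1) cY ordLeq_transitive[OF card_of_image c2]])
  have pc: "part_iso Y S ((h l)\<inverse>)" for l using S(3) part_iso_converse by blast
  obtain S' h' where S': "nary n Z S'" "\<And>xs. set xs \<subseteq> Y \<Longrightarrow> S' xs = S xs"
    "\<And>l. part_iso Z S' (h' l)" "\<And>l. (h l)\<inverse> \<subseteq> h' l"
    "\<And>l. l \<in> \<Lambda> \<Longrightarrow> Y \<subseteq> Domain (h' l)" "\<And>l. l \<notin> \<Lambda> \<Longrightarrow> h' l = (h l)\<inverse>"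
    using extend_forward[where g = "\<lambda>l. (h l)\<inverse>", OF S(1) pc mu, folded Z_def] by blast
  \<comment> \<open>A single new image already makes the extension strict, as
    \<open>stage_less\<close> demands.\<close>
  obtain l a where "l \<in> \<Lambda>" "a \<in> X" using ne by blast
  then have "\<nu> (l, a) \<in> Y - X" using nu(2) by (auto simp: Y_def)
  then have "X \<subset> Z" by (auto simp: Z_def Y_def)
  moreover have "S' xs = R xs" if "set xs \<subseteq> X" for xs
    using S'(2)[of xs] S(2)[OF that] that by (simp add: Y_def le_supI1)
  moreover have "part_iso Z S' ((h' l)\<inverse>)" for l using S'(3) part_iso_converse by blast
  moreover have "g l \<subseteq> (h' l)\<inverse>" for l
    using S(4)[of l] S'(4)[of l] converse_subset_swap[of "h l" "h' l"] by simp
  moreover have "X \<subseteq> Domain ((h' l)\<inverse>) \<and> X \<subseteq> Range ((h' l)\<inverse>)" if "l \<in> \<Lambda>" for l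
  proof -
    have "Domain (h l) \<subseteq> Range (h' l)" using S'(4)[of l] by blast
    moreover have "X \<subseteq> Y" by (auto simp: Y_def)
    ultimately show ?thesis using that S(5)[of l] S'(5)[of l] by auto
  qed
  moreover have "(h' l)\<inverse> = g l" if "l \<notin> \<Lambda>" for l using that S(6) S'(6) by simp
  ultimately show ?thesis using cZ S'(1) by (intro exI[of _ Z] exI[of _ S'] exI[of _ "\<lambda>l. (h' l)\<inverse>"]) blast
qed

text \<open>\<open>ext_map P p\<close> is the part constructed so far of an automorphism extending the small partial
  isomorphism \<open>p\<close>; it is empty if \<open>p\<close> has not been treated yet.\<close>

record 'a stage =
  points :: "'a set"
  related :: "'a list \<Rightarrow> bool"
  ext_map :: "'a rel \<Rightarrow> 'a rel"

definition small_isos :: "'k set \<Rightarrow> 'a set \<Rightarrow> ('a list \<Rightarrow> bool) \<Rightarrow> 'a rel set" where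
  "small_isos K X R = {p. part_iso X R p \<and> |p| \<le>o |K|}"

definition is_stage :: "'k set \<Rightarrow> nat \<Rightarrow> 'a stage \<Rightarrow> bool" where
  "is_stage K n P \<longleftrightarrow> nary n (points P) (related P) \<and>
     (\<forall>p. part_iso (points P) (related P) (ext_map P p) \<and>
        (ext_map P p \<noteq> {} \<longrightarrow> p \<in> small_isos K (points P) (related P) \<and> p \<subseteq> ext_map P p))"

definition stage_le :: "'a stage \<Rightarrow> 'a stage \<Rightarrow> bool" where
  "stage_le P Q \<longleftrightarrow> points P \<subseteq> points Q \<and>
     (\<forall>xs. set xs \<subseteq> points P \<longrightarrow> related Q xs = related P xs) \<and> (\<forall>p. ext_map P p \<subseteq> ext_map Q p)"

text \<open>Going up one step means that every small partial isomorphism of \<open>P\<close> becomes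
  defined and onto on \<open>P\<close>. In a chain without a last member all of them therefore
  become total in the union, with no bookkeeping of tasks.\<close>

definition stage_less :: "'k set \<Rightarrow> 'a stage \<Rightarrow> 'a stage \<Rightarrow> bool" where
  "stage_less K P Q \<longleftrightarrow> stage_le P Q \<and> points P \<noteq> points Q \<and>
     (\<forall>p\<in>small_isos K (points P) (related P).
        p \<subseteq> ext_map Q p \<and> points P \<subseteq> Domain (ext_map Q p) \<and> points P \<subseteq> Range (ext_map Q p))"

lemma stage_leD:
  assumes "stage_le P Q"
  shows "points P \<subseteq> points Q" "set xs \<subseteq> points P \<Longrightarrow> related Q xs = related P xs" "ext_map P p \<subseteq> ext_map Q p"
  using assms unfolding stage_le_def by blast+

lemma stage_le_refl: "stage_le P P"
  by (simp add: stage_le_def)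

lemma stage_le_trans: "stage_le P Q \<Longrightarrow> stage_le Q V \<Longrightarrow> stage_le P V"
  unfolding stage_le_def by (meson subset_trans)

lemma small_isos_mono: "stage_le P Q \<Longrightarrow>
    small_isos K (points P) (related P) \<subseteq> small_isos K (points Q) (related Q)"
proof
  fix p assume le: "stage_le P Q" and p: "p \<in> small_isos K (points P) (related P)"
  have "p \<subseteq> points P \<times> points P" using p part_isoD(1) unfolding small_isos_def by blast
  then have "part_iso (points Q) (related Q) p \<longleftrightarrow> part_iso (points P) (related P) p"
    by (intro part_iso_cong[OF stage_leD(1)[OF le]] stage_leD(2)[OF le])
  then show "p \<in> small_isos K (points Q) (related Q)" using p by (simp add: small_isos_def)
qed

lemma stage_le_less_trans:
  assumes "stage_le P Q" "stage_less K Q V"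
  shows "stage_less K P V"
proof -
  have le: "stage_le Q V" "points Q \<noteq> points V" using assms(2) by (auto simp: stage_less_def)
  then have "stage_le P V" using assms(1) stage_le_trans by blast
  moreover have PQ: "points P \<subseteq> points Q" "points Q \<subseteq> points V" using assms(1) le stage_leD(1) by blast+
  moreover have "points P \<noteq> points V" using PQ le(2) by blast
  moreover have "p \<subseteq> ext_map V p \<and> points P \<subseteq> Domain (ext_map V p) \<and> points P \<subseteq> Range (ext_map V p)"
    if "p \<in> small_isos K (points P) (related P)" for p
  proof -
    have "p \<in> small_isos K (points Q) (related Q)" using that small_isos_mono[OF assms(1)] by blast
    then have "p \<subseteq> ext_map V p \<and> points Q \<subseteq> Domain (ext_map V p) \<and> points Q \<subseteq> Range (ext_map V p)"
      using assms(2) by (simp add: stage_less_def)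
    then show ?thesis using PQ(1) by blast
  qed
  ultimately show ?thesis by (simp add: stage_less_def)
qed

section \<open>Counting small partial isomorphisms\<close>

lemma card_of_ordLeqE:
  assumes "|A| \<le>o |B|"
  obtains f where "inj_on f A" "f ` A \<subseteq> B"
  using assms unfolding card_of_ordLeq[symmetric] by blast

lemma card_of_Pow_mono:
  assumes "|A| \<le>o |B|"
  shows "|Pow A| \<le>o |Pow B|"
proof -
  obtain f where f: "inj_on f A" "f ` A \<subseteq> B" using assms by (rule card_of_ordLeqE)
  show ?thesis
  proof (rule card_of_ordLeqI)
    show "inj_on (image f) (Pow A)" using f(1) by (simp add: inj_on_image_Pow)
  qed (use f(2) in blast)
qed

lemma card_of_Pow_times: "infinite K \<Longrightarrow> |Pow (K \<times> K)| \<le>o |Pow K|"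
  by (intro card_of_Pow_mono card_of_Times_ordLeq card_of_mono1 subset_refl)

text \<open>This is (2^K)^K = 2^K. A nonempty \<open>p\<close> is the image of some \<open>e\<close>
  on \<open>K\<close>; each value \<open>e x\<close> is named by a subset of \<open>K\<close>
  through \<open>d\<close>, and these subsets are the rows of one relation \<open>G\<close> on
  \<open>K\<close>, from which \<open>F\<close> recovers \<open>p\<close>.\<close>

lemma card_small_subsets:
  assumes K: "infinite K" and Z: "|Z| \<le>o |Pow K|"
  shows "|{p. p \<subseteq> Z \<and> |p| \<le>o |K|}| \<le>o |Pow K|"
proof (cases "Z = {}")
  case True
  then have "{p. p \<subseteq> Z \<and> |p| \<le>o |K|} \<subseteq> {{}}" by blast
  then show ?thesis using K by (meson card_of_mono1 card_of_singl_ordLeq ordLeq_transitive Pow_not_empty)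
next
  case False
  then obtain d where d: "d ` Pow K = Z" using Z card_of_ordLeq2 by metis
  define F where "F G = d ` ((\<lambda>x. G `` {x}) ` K)" for G :: "'a rel"
  have "{p. p \<subseteq> Z \<and> |p| \<le>o |K|} \<subseteq> {{}} \<union> F ` Pow (K \<times> K)"
  proof
    fix p assume "p \<in> {p. p \<subseteq> Z \<and> |p| \<le>o |K|}"
    then have p: "p \<subseteq> Z" "|p| \<le>o |K|" by auto
    show "p \<in> {{}} \<union> F ` Pow (K \<times> K)"
    proof (cases "p = {}")
      case False
      then obtain e where e: "e ` K = p" using p(2) card_of_ordLeq2 by metis
      have "\<exists>S. S \<subseteq> K \<and> d S = e x" if "x \<in> K" for x
      proof -
        have "e x \<in> d ` Pow K" using that e p(1) unfolding d by blast
        then show ?thesis by auto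
      qed
      then obtain S where S: "\<And>x. x \<in> K \<Longrightarrow> S x \<subseteq> K \<and> d (S x) = e x" by metis
      define G where "G = (SIGMA x:K. S x)"
      have "d (G `` {x}) = e x" if "x \<in> K" for x using that S by (simp add: G_def Image_singleton)
      then have "(\<lambda>x. d (G `` {x})) ` K = e ` K" by (rule image_cong[OF refl])
      then have "F G = p" unfolding F_def image_image e .
      moreover have "G \<subseteq> K \<times> K" using S by (auto simp: G_def)
      ultimately show ?thesis by blast
    qed simp
  qed
  moreover have "|{{}} \<union> F ` Pow (K \<times> K)| \<le>o |Pow K|"
  proof (rule card_of_Un_ordLeq)
    show "|{{}}| \<le>o |Pow K|" by (rule card_of_singl_ordLeq) blast
    show "|F ` Pow (K \<times> K)| \<le>o |Pow K|" by (rule ordLeq_transitive[OF card_of_image card_of_Pow_times[OF K]])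
  qed (use K in simp)
  ultimately show ?thesis by (rule ordLeq_transitive[OF card_of_mono1])
qed

lemma stage_extends:
  fixes P :: "'m stage" and K :: "'k set"
  assumes K: "infinite K" "|Pow K| <o |UNIV :: 'm set|"
    and P: "is_stage K n P" "|points P| \<le>o |Pow K|" "points P \<noteq> {}"
  obtains Q where "is_stage K n Q" "|points Q| \<le>o |Pow K|" "stage_less K P Q"
proof -
  let ?X = "points P" and ?R = "related P"
  define \<Lambda> where "\<Lambda> = small_isos K ?X ?R"
  \<comment> \<open>A map treated before contains \<open>p\<close> already, so the union changes
    nothing; for an untreated one the work starts from \<open>p\<close> itself.\<close>
  define g where "g p = (if p \<in> \<Lambda> then ext_map P p \<union> p else {})" for p
  have g: "part_iso ?X ?R (g p)" for p
  proof (cases "p \<in> \<Lambda> \<and> ext_map P p \<noteq> {}")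
    case True
    then have "g p = ext_map P p" using P(1) by (auto simp: g_def is_stage_def)
    then show ?thesis using P(1) by (simp add: is_stage_def)
  next
    case False
    then show ?thesis using part_iso_empty by (auto simp: g_def \<Lambda>_def small_isos_def)
  qed
  have mg: "ext_map P p \<subseteq> g p" for p
    using P(1) by (auto simp: is_stage_def g_def \<Lambda>_def)
  have ip: "infinite (Pow K)" using K by simp
  have "|\<Lambda>| \<le>o |{p. p \<subseteq> ?X \<times> ?X \<and> |p| \<le>o |K|}|"
    by (rule card_of_mono1) (auto simp: \<Lambda>_def small_isos_def dest: part_isoD(1))
  then have c: "|\<Lambda>| \<le>o |Pow K|"
    by (rule ordLeq_transitive[OF _ card_small_subsets[OF K(1) card_of_Times_ordLeq[OF ip P(2) P(2)]]])
  \<comment> \<open>The empty map is always there to be extended, so the stage really grows.\<close>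
  have "{} \<in> \<Lambda>" by (simp add: \<Lambda>_def small_isos_def card_of_empty part_iso_empty)
  then have ne: "\<Lambda> \<noteq> {}" by blast
  have nary: "nary n ?X ?R" using P(1) by (simp add: is_stage_def)
  obtain Y S h where Y: "?X \<subset> Y" "|Y| \<le>o |Pow K|" "nary n Y S" "\<forall>xs. set xs \<subseteq> ?X \<longrightarrow> S xs = ?R xs"
    "\<forall>l. part_iso Y S (h l)" "\<forall>l. g l \<subseteq> h l"
    "\<forall>l\<in>\<Lambda>. ?X \<subseteq> Domain (h l) \<and> ?X \<subseteq> Range (h l)" "\<forall>l. l \<notin> \<Lambda> \<longrightarrow> h l = g l"
    using extend_both[where g = g, OF nary g ip P(2) c K(2) P(3) ne] by (elim exE conjE) (rule that)
  define Q where "Q = \<lparr>points = Y, related = S, ext_map = h\<rparr>"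
  have "ext_map P p \<subseteq> h p" for p using mg Y(6) by blast
  then have le: "stage_le P Q" using Y(1,4) by (auto simp: stage_le_def Q_def)
  have ph: "p \<subseteq> h p" if "p \<in> \<Lambda>" for p using that Y(6)[rule_format, of p] by (simp add: g_def)
  have "p \<in> \<Lambda>" if "h p \<noteq> {}" for p using that Y(8)[rule_format, of p] by (auto simp: g_def)
  moreover have "\<Lambda> \<subseteq> small_isos K Y S" using small_isos_mono[OF le, of K] by (simp add: Q_def \<Lambda>_def)
  ultimately have "\<forall>p. part_iso Y S (h p) \<and> (h p \<noteq> {} \<longrightarrow> p \<in> small_isos K Y S \<and> p \<subseteq> h p)"
    using Y(5) ph by blast
  then have "is_stage K n Q" using Y(3) by (simp add: is_stage_def Q_def)
  moreover have "\<forall>p\<in>\<Lambda>. p \<subseteq> h p \<and> ?X \<subseteq> Domain (h p) \<and> ?X \<subseteq> Range (h p)" using Y(7) ph by blast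
  then have "stage_less K P Q"
    using le Y(1) unfolding stage_less_def \<Lambda>_def by (simp add: Q_def psubset_eq)
  ultimately show thesis using that[of Q] Y(2) by (simp add: Q_def)
qed

section \<open>Unions of chains of stages\<close>

definition union_stage :: "'a stage set \<Rightarrow> 'a stage" where
  "union_stage C = \<lparr>points = \<Union> (points ` C), related = (\<lambda>xs. \<exists>P\<in>C. related P xs),
     ext_map = (\<lambda>p. \<Union>P\<in>C. ext_map P p)\<rparr>"

text \<open>Every clause to be checked concerns finitely many points or pairs at a time, and in a
  chain these occur together in one member.\<close>

lemma union_stage:
  assumes C: "\<And>P. P \<in> C \<Longrightarrow> is_stage K n P" "\<And>P Q. P \<in> C \<Longrightarrow> Q \<in> C \<Longrightarrow> stage_le P Q \<or> stage_le Q P"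
    and ne: "C \<noteq> {}"
  shows union_stage_upper: "P \<in> C \<Longrightarrow> stage_le P (union_stage C)"
    and is_stage_union: "is_stage K n (union_stage C)"
proof -
  let ?U = "union_stage C"
  show le: "stage_le P ?U" if P: "P \<in> C" for P
  proof -
    have "related P xs" if xs: "set xs \<subseteq> points P" and Q: "Q \<in> C" "related Q xs" for xs Q
    proof -
      have "set xs \<subseteq> points Q" using C(1)[OF Q(1)] Q(2) by (auto simp: is_stage_def nary_def)
      then show ?thesis using C(2)[OF P Q(1)] xs Q(2) by (auto simp: stage_le_def)
    qed
    then show ?thesis using P by (auto simp: stage_le_def union_stage_def)
  qed
  have dir: "\<exists>P\<in>C. list_all2 (\<lambda>x y. (x, y) \<in> ext_map P p) xs ys"
    if "list_all2 (\<lambda>x y. (x, y) \<in> ext_map ?U p) xs ys" for p xs ys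
    using that
  proof (induction rule: list_all2_induct)
    case Nil
    then show ?case using ne by auto
  next
    case (Cons x xs y ys)
    then obtain P Q where PQ: "P \<in> C" "(x, y) \<in> ext_map P p" "Q \<in> C" "list_all2 (\<lambda>x y. (x, y) \<in> ext_map Q p) xs ys"
      by (auto simp: union_stage_def)
    show ?case
    proof (cases "stage_le P Q")
      case True
      then have "(x, y) \<in> ext_map Q p" using PQ by (auto simp: stage_le_def)
      then show ?thesis using PQ by auto
    next
      case False
      then have "ext_map Q p \<subseteq> ext_map P p" using C(2)[OF PQ(1,3)] stage_leD(3) by blast
      then have "list_all2 (\<lambda>x y. (x, y) \<in> ext_map P p) xs ys"
        using PQ(4) by (auto elim: list_all2_mono)
      then show ?thesis using PQ by auto
    qed
  qed
  have piso: "part_iso (points ?U) (related ?U) (ext_map ?U p)" for p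
  proof -
    have pi: "part_iso (points ?U) (related ?U) (ext_map P p)" if "P \<in> C" for P
    proof -
      have "part_iso (points P) (related P) (ext_map P p)" using C(1)[OF that] by (simp add: is_stage_def)
      then show ?thesis using part_iso_cong[of "points P" "points ?U" "related ?U" "related P" "ext_map P p"]
          le[OF that] part_isoD(1) by (auto simp: stage_le_def)
    qed
    have two: "\<exists>P\<in>C. {a, b} \<subseteq> ext_map P p" if "a \<in> ext_map ?U p" "b \<in> ext_map ?U p" for a b
    proof -
      have "a \<in> (\<Union>P\<in>C. ext_map P p)" "b \<in> (\<Union>P\<in>C. ext_map P p)" using that by (simp_all add: union_stage_def)
      then obtain P Q where "P \<in> C" "a \<in> ext_map P p" "Q \<in> C" "b \<in> ext_map Q p" by (elim UN_E)
      moreover from this have "ext_map P p \<subseteq> ext_map Q p \<or> ext_map Q p \<subseteq> ext_map P p"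
        using C(2) stage_leD(3) by metis
      ultimately show ?thesis by blast
    qed
    have "y = y'" if xy: "(x, y) \<in> ext_map ?U p" "(x, y') \<in> ext_map ?U p" for x y y'
    proof -
      obtain P where "P \<in> C" "{(x, y), (x, y')} \<subseteq> ext_map P p" using two[OF xy] by blast
      then show ?thesis using part_isoD(2)[OF pi[of P], of x y y'] by simp
    qed
    then have "single_valued (ext_map ?U p)" by (auto simp: single_valued_def)
    moreover have "x = x'" if xy: "(x, y) \<in> ext_map ?U p" "(x', y) \<in> ext_map ?U p" for x x' y
    proof -
      obtain P where "P \<in> C" "{(x, y), (x', y)} \<subseteq> ext_map P p" using two[OF xy] by blast
      then show ?thesis using part_isoD(3)[OF pi[of P], of x y x'] by simp
    qed
    then have "single_valued ((ext_map ?U p)\<inverse>)" by (auto simp: single_valued_def)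
    moreover have "ext_map ?U p \<subseteq> points ?U \<times> points ?U"
      using part_isoD(1)[OF pi] by (auto simp: union_stage_def)
    moreover have "related ?U xs = related ?U ys"
      if xy: "list_all2 (\<lambda>x y. (x, y) \<in> ext_map ?U p) xs ys" for xs ys
    proof -
      obtain P where P: "P \<in> C" "list_all2 (\<lambda>x y. (x, y) \<in> ext_map P p) xs ys" using dir[OF xy] by blast
      then show ?thesis using part_isoD(4)[OF pi[OF P(1)]] by simp
    qed
    ultimately show ?thesis unfolding part_iso_def by blast
  qed
  have "nary n (points ?U) (related ?U)"
    using C(1) by (fastforce simp: union_stage_def is_stage_def nary_def)
  moreover have "p \<in> small_isos K (points ?U) (related ?U) \<and> p \<subseteq> ext_map ?U p" if nz: "ext_map ?U p \<noteq> {}" for p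
  proof -
    obtain P where P: "P \<in> C" "ext_map P p \<noteq> {}" using nz by (auto simp: union_stage_def)
    then have "p \<in> small_isos K (points P) (related P)" "p \<subseteq> ext_map P p"
      using C(1) by (auto simp: is_stage_def)
    then show ?thesis using small_isos_mono[OF le[OF P(1)], of K] stage_leD(3)[OF le[OF P(1)], of p]
      by blast
  qed
  ultimately show "is_stage K n ?U" using piso by (simp add: is_stage_def)
qed

text \<open>The union of a maximal chain of stages of size at most \<open>2\<^sup>K\<close> cannot itself have that size, so every
  subset of size at most \<open>K\<close> is contained in one stage of the chain. This replaces a transfinite
  construction and needs no regularity of \<open>K\<close>.\<close>

lemma homogeneous_extension:
  fixes P0 :: "'m stage" and K :: "'k set"
  assumes K: "infinite K" "|Pow K| <o |UNIV :: 'm set|"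
    and P0: "is_stage K n P0" "|points P0| \<le>o |Pow K|" "points P0 \<noteq> {}"
  obtains U where "is_stage K n U" "stage_le P0 U"
    "\<And>p. p \<in> small_isos K (points U) (related U) \<Longrightarrow>
       p \<subseteq> ext_map U p \<and> Domain (ext_map U p) = points U \<and> Range (ext_map U p) = points U"
proof -
  define \<P> where "\<P> = {P. is_stage K n P \<and> |points P| \<le>o |Pow K| \<and> stage_le P0 P}"
  interpret pred_on \<P> "stage_less K" .
  obtain C where C: "maxchain C" using Hausdorff by blast
  then have ch: "chain C" and CP: "C \<subseteq> \<P>" by (auto simp: maxchain_def chain_def)
  have "P0 \<in> \<P>" using P0 by (simp add: \<P>_def stage_le_refl)
  then have "chain {P0}" by (simp add: chain_def)
  then have ne: "C \<noteq> {}" using C by (auto simp: maxchain_def)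
  have st: "is_stage K n P" "|points P| \<le>o |Pow K|" "stage_le P0 P" if "P \<in> C" for P
    using that CP by (auto simp: \<P>_def)
  have tot: "P = Q \<or> stage_less K P Q \<or> stage_less K Q P" if "P \<in> C" "Q \<in> C" for P Q
    using ch that by (auto simp: chain_def)
  have tot': "stage_le P Q \<or> stage_le Q P" if "P \<in> C" "Q \<in> C" for P Q
    using tot[OF that] stage_le_refl by (auto simp: stage_less_def)
  define U where "U = union_stage C"
  have U: "is_stage K n U" and le: "P \<in> C \<Longrightarrow> stage_le P U" for P
    unfolding U_def using is_stage_union[OF st(1) tot' ne] union_stage_upper[OF st(1) tot' ne] by simp_all
  have PU: "points U = (\<Union>P\<in>C. points P)" by (simp add: U_def union_stage_def)
  have le0: "stage_le P0 U" using ne le st(3) stage_le_trans by blast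
  have ip: "infinite (Pow K)" using K by simp
  \<comment> \<open>Otherwise \<open>stage_extends\<close> would yield one more stage above the
    whole chain, against maximality.\<close>
  have big: "\<not> |points U| \<le>o |Pow K|"
  proof
    assume small: "|points U| \<le>o |Pow K|"
    have "points U \<noteq> {}" using P0(3) le0 by (auto simp: stage_le_def)
    then obtain V where V: "is_stage K n V" "|points V| \<le>o |Pow K|" "stage_less K U V"
      using stage_extends[OF K U small] by blast
    then have "stage_le P0 V" using le0 stage_le_trans by (auto simp: stage_less_def)
    then have "V \<in> \<P>" using V by (simp add: \<P>_def)
    moreover have "stage_less K P V" if "P \<in> C" for P using le[OF that] V(3) stage_le_less_trans by blast
    ultimately have "chain (insert V C)" using ch by (auto simp: chain_def)
    moreover have "V \<notin> C"
      using V(3) le[of V] by (auto simp: stage_less_def stage_le_def)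
    ultimately show False using C unfolding maxchain_def by blast
  qed
  have nomax: "\<exists>Q\<in>C. stage_less K P Q" if P: "P \<in> C" for P
  proof (rule ccontr)
    assume no: "\<not> ?thesis"
    have "points Q \<subseteq> points P" if Q: "Q \<in> C" for Q
    proof -
      have "Q = P \<or> stage_less K Q P" using tot[OF Q P] no Q by blast
      then have "stage_le Q P" using stage_le_refl by (auto simp: stage_less_def)
      then show ?thesis by (rule stage_leD(1))
    qed
    then have "points U \<subseteq> points P" by (auto simp: PU)
    then show False using big ordLeq_transitive[OF card_of_mono1 st(2)[OF P]] by blast
  qed
  \<comment> \<open>If no stage contained \<open>A\<close>, stages chosen for the elements of
    \<open>A\<close> would be cofinal in the chain. At most \<open>K\<close> sets of size at most
    2^K would then cover the union, against \<open>big\<close>.\<close>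
  have bounded: "\<exists>P\<in>C. A \<subseteq> points P" if A: "A \<subseteq> points U" "|A| \<le>o |K|" for A
  proof (rule ccontr)
    assume no: "\<not> ?thesis"
    obtain X where X: "\<And>a. a \<in> A \<Longrightarrow> X a \<in> C \<and> a \<in> points (X a)" using A(1) unfolding PU by (metis UN_E subsetD)
    have "points U \<subseteq> (\<Union>a\<in>A. points (X a))"
    proof
      fix x assume "x \<in> points U"
      then obtain P where P: "P \<in> C" "x \<in> points P" by (auto simp: PU)
      then obtain a where a: "a \<in> A" "a \<notin> points P" using no by blast
      then have "\<not> stage_le (X a) P" using X stage_leD(1) by blast
      then have "points P \<subseteq> points (X a)" using tot' P(1) X[OF a(1)] stage_leD(1) by blast
      then show "x \<in> (\<Union>a\<in>A. points (X a))" using a P by blast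
    qed
    moreover have "|\<Union>a\<in>A. points (X a)| \<le>o |Pow K|"
    proof (rule card_of_UNION_ordLeq_infinite[OF ip])
      show "|A| \<le>o |Pow K|"
        by (rule ordLeq_transitive[OF A(2) ordLess_imp_ordLeq[OF card_of_Pow]])
    qed (use X st(2) in blast)
    ultimately have "|points U| \<le>o |Pow K|" by (rule ordLeq_transitive[OF card_of_mono1])
    then show False using big by blast
  qed
  have "p \<subseteq> ext_map U p \<and> Domain (ext_map U p) = points U \<and> Range (ext_map U p) = points U"
    if p: "p \<in> small_isos K (points U) (related U)" for p
  proof -
    have pp: "part_iso (points U) (related U) p" "|p| \<le>o |K|" using p by (auto simp: small_isos_def)
    have "|Field p| \<le>o |K|" unfolding Field_def Domain_fst Range_snd
      by (rule card_of_Un_ordLeq[OF K(1) ordLeq_transitive[OF card_of_image pp(2)]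
        ordLeq_transitive[OF card_of_image pp(2)]])
    moreover have "Field p \<subseteq> points U" using part_isoD(1)[OF pp(1)] by (auto simp: Field_def)
    ultimately obtain P where P: "P \<in> C" "Field p \<subseteq> points P" using bounded by blast
    have pP: "p \<in> small_isos K (points P) (related P)"
    proof -
      have "p \<subseteq> points P \<times> points P" using P(2) by (auto intro: FieldI1 FieldI2)
      then have "part_iso (points P) (related P) p"
        using part_iso_cong[of "points P" "points U" "related U" "related P" p] pp(1) le[OF P(1)] P(2)
          stage_leD(1,2)[OF le[OF P(1)]] by simp
      then show ?thesis using pp(2) by (simp add: small_isos_def)
    qed
    have cover: "p \<subseteq> ext_map U p \<and> x \<in> Domain (ext_map U p) \<and> x \<in> Range (ext_map U p)" if x: "x \<in> points U" for x
    proof -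
      obtain Q where Q: "Q \<in> C" "x \<in> points Q" using x unfolding PU by blast
      \<comment> \<open>\<open>S\<close> is a stage containing both \<open>p\<close> and the point
        \<open>x\<close>; any stage beyond it has \<open>x\<close> in the domain and the range of
        the map extending \<open>p\<close>.\<close>
      obtain S where S: "S \<in> C" "stage_le P S" "x \<in> points S"
      proof (cases "stage_le P Q")
        case False
        then have "stage_le Q P" using tot'[OF P(1) Q(1)] by blast
        then show ?thesis using that[OF P(1) stage_le_refl] stage_leD(1) Q(2) by blast
      qed (use Q that in blast)
      then obtain V where V: "V \<in> C" "stage_less K S V" using nomax by blast
      have "p \<in> small_isos K (points S) (related S)" using small_isos_mono[OF S(2)] pP by blast
      then have "p \<subseteq> ext_map V p" "x \<in> Domain (ext_map V p)" "x \<in> Range (ext_map V p)"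
        using V(2) S(3) unfolding stage_less_def by blast+
      moreover have "ext_map V p \<subseteq> ext_map U p" using le[OF V(1)] by (rule stage_leD(3))
      ultimately show ?thesis by blast
    qed
    have "part_iso (points U) (related U) (ext_map U p)" using U by (simp add: is_stage_def)
    then have "ext_map U p \<subseteq> points U \<times> points U" by (rule part_isoD(1))
    then have D: "Domain (ext_map U p) \<subseteq> points U" "Range (ext_map U p) \<subseteq> points U" by auto
    have E: "points U \<subseteq> Domain (ext_map U p)" "points U \<subseteq> Range (ext_map U p)"
      using cover by blast+
    obtain x where "x \<in> points U" using P0(3) stage_leD(1)[OF le0] by blast
    then have "p \<subseteq> ext_map U p" using cover by blast
    then show ?thesis using D E by (intro conjI equalityI)
  qed
  from that[OF U le0 this] show thesis .
qed

section \<open>A universal starting point and the finished structure\<close>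

lemma card_of_tuples:
  assumes "infinite K"
  shows "|{xs. set xs \<subseteq> K \<and> length xs = n}| \<le>o |K|"
proof (induction n)
  case 0
  have "{xs. set xs \<subseteq> K \<and> length xs = 0} = {[]}" by auto
  then show ?case using assms card_of_singl_ordLeq by (metis finite.emptyI)
next
  case (Suc n)
  let ?T = "\<lambda>n. {xs. set xs \<subseteq> K \<and> length xs = n}"
  have s: "?T (Suc n) \<subseteq> (\<lambda>(x, xs). x # xs) ` (K \<times> ?T n)"
  proof
    fix ys assume "ys \<in> ?T (Suc n)"
    then show "ys \<in> (\<lambda>(x, xs). x # xs) ` (K \<times> ?T n)" by (cases ys) auto
  qed
  have c: "|K \<times> ?T n| \<le>o |K|"
    by (rule card_of_Times_ordLeq[OF assms card_of_mono1[OF subset_refl] Suc])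
  show ?case by (rule ordLeq_transitive[OF surj_imp_ordLeq[OF s] c])
qed

text \<open>The disjoint union of all \<open>n\<close>-ary relations on \<open>K\<close>.\<close>

lemma universal_stage:
  fixes K :: "'k set"
  assumes K: "infinite K" "|Pow K| <o |UNIV :: 'm set|" and n: "n > 0"
  obtains P :: "'m stage" where "is_stage K n P" "|points P| \<le>o |Pow K|" "points P \<noteq> {}"
    "\<And>S. \<exists>\<iota>. inj_on \<iota> K \<and> \<iota> ` K \<subseteq> points P \<and>
       (\<forall>xs. set xs \<subseteq> K \<and> length xs = n \<longrightarrow> (related P (map \<iota> xs) \<longleftrightarrow> xs \<in> S))"
proof -
  let ?L = "{xs. set xs \<subseteq> K \<and> length xs = n}"
  let ?D = "Pow ?L \<times> K"
  have ip: "infinite (Pow K)" using K by simp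
  have "|Pow ?L| \<le>o |Pow K|" by (rule card_of_Pow_mono[OF card_of_tuples[OF K(1)]])
  then have cD: "|?D| \<le>o |Pow K|"
    by (rule card_of_Times_ordLeq[OF ip _ ordLess_imp_ordLeq[OF card_of_Pow]])
  then have "|?D| \<le>o |UNIV :: 'm set|" by (rule ordLeq_transitive[OF _ ordLess_imp_ordLeq[OF K(2)]])
  then obtain j :: "'k list set \<times> 'k \<Rightarrow> 'm" where j: "inj_on j ?D" by (rule card_of_ordLeqE)
  \<comment> \<open>The point \<open>(S, x)\<close> is the element \<open>x\<close> of the summand
    carrying the relation \<open>S\<close>; no tuple across summands is related.\<close>
  define R where "R zs \<longleftrightarrow> (\<exists>S xs. S \<subseteq> ?L \<and> xs \<in> S \<and> zs = map (\<lambda>x. j (S, x)) xs)" for zs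
  define P where "P = \<lparr>points = j ` ?D, related = R, ext_map = (\<lambda>_. {})\<rparr>"
  have nary: "nary n (j ` ?D) R" unfolding nary_def
  proof (intro allI impI)
    fix zs assume "R zs"
    then obtain S xs where S: "S \<subseteq> ?L" "xs \<in> S" "zs = map (\<lambda>x. j (S, x)) xs" by (auto simp: R_def)
    then have "set xs \<subseteq> K" "length xs = n" by blast+
    then show "length zs = n \<and> set zs \<subseteq> j ` ?D" using S(1,3) by auto
  qed
  have "is_stage K n P" using nary part_iso_empty by (simp add: is_stage_def P_def)
  moreover have "|points P| \<le>o |Pow K|" unfolding P_def stage.simps
    by (rule ordLeq_transitive[OF card_of_image cD])
  moreover have "points P \<noteq> {}" using K(1) by (auto simp: P_def)
  moreover have "\<exists>\<iota>. inj_on \<iota> K \<and> \<iota> ` K \<subseteq> points P \<and>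
       (\<forall>xs. set xs \<subseteq> K \<and> length xs = n \<longrightarrow> (related P (map \<iota> xs) \<longleftrightarrow> xs \<in> S))" for S
  proof -
    let ?S = "S \<inter> ?L"
    let ?i = "\<lambda>x. j (?S, x)"
    have "R (map ?i xs) \<longleftrightarrow> xs \<in> S" if xs: "set xs \<subseteq> K" "length xs = n" for xs
    proof
      assume "R (map ?i xs)"
      then obtain T ys where T: "T \<subseteq> ?L" "ys \<in> T" "map ?i xs = map (\<lambda>x. j (T, x)) ys" by (auto simp: R_def)
      have len: "length ys = n" "set ys \<subseteq> K" using T(1,2) by blast+
      have eq: "?S = T \<and> xs ! i = ys ! i" if "i < n" for i
      proof -
        have "j (?S, xs ! i) = j (T, ys ! i)" using arg_cong[OF T(3), of "\<lambda>l. l ! i"] that xs(2) len(1) by simp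
        moreover have "(?S, xs ! i) \<in> ?D" "(T, ys ! i) \<in> ?D" using xs len that T(1) by auto
        ultimately have "(?S, xs ! i) = (T, ys ! i)" by (rule inj_onD[OF j])
        then show ?thesis by (simp only: prod.inject)
      qed
      have "xs = ys" using eq xs len by (intro nth_equalityI) auto
      \<comment> \<open>The arity is positive, so the first entry of the tuple reveals the summand;
        an empty tuple would be common to all of them.\<close>
      then show "xs \<in> S" using eq[OF n] T(2) by blast
    next
      assume "xs \<in> S"
      then have "xs \<in> ?S" "?S \<subseteq> ?L" using xs by auto
      then show "R (map ?i xs)" unfolding R_def by blast
    qed
    moreover have "inj_on ?i K"
    proof (rule inj_onI)
      fix x y assume "x \<in> K" "y \<in> K" "?i x = ?i y"
      then have "(?S, x) = (?S, y)" by (intro inj_onD[OF j]) auto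
      then show "x = y" by (simp only: prod.inject)
    qed
    moreover have "?i ` K \<subseteq> j ` ?D" by auto
    ultimately show ?thesis by (intro exI[of _ ?i]) (simp add: P_def)
  qed
  ultimately show thesis by (rule that)
qed

text \<open>Universality is stated for relations on the set \<open>K\<close> itself; any structure
  of size at most \<open>K\<close> is reached by injecting it into \<open>K\<close>.\<close>

locale homogeneous_universal =
  fixes K :: "'k set" and n :: nat and U :: "'m set" and R :: "'m list \<Rightarrow> bool"
  assumes infinite_K: "infinite K"
    and nary: "nary n U R"
    and homogeneous: "\<And>p. part_iso U R p \<Longrightarrow> |p| \<le>o |K| \<Longrightarrow>
       \<exists>\<sigma>. p \<subseteq> \<sigma> \<and> part_iso U R \<sigma> \<and> Domain \<sigma> = U \<and> Range \<sigma> = U"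
    and universal: "\<And>S. \<exists>\<iota>. inj_on \<iota> K \<and> \<iota> ` K \<subseteq> U \<and>
       (\<forall>xs. set xs \<subseteq> K \<and> length xs = n \<longrightarrow> (R (map \<iota> xs) \<longleftrightarrow> xs \<in> S))"

theorem homogeneous_universal_exists:
  fixes K :: "'k set"
  assumes K: "infinite K" "|Pow K| <o |UNIV :: 'm set|" and n: "n > 0"
  shows "\<exists>(U :: 'm set) R. homogeneous_universal K n U R"
proof -
  obtain P :: "'m stage" where P: "is_stage K n P" "|points P| \<le>o |Pow K|" "points P \<noteq> {}"
    and univ: "\<And>S. \<exists>\<iota>. inj_on \<iota> K \<and> \<iota> ` K \<subseteq> points P \<and>
       (\<forall>xs. set xs \<subseteq> K \<and> length xs = n \<longrightarrow> (related P (map \<iota> xs) \<longleftrightarrow> xs \<in> S))"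
    using universal_stage[OF K n] by metis
  obtain U where U: "is_stage K n U" "stage_le P U"
    and hom: "\<And>p. p \<in> small_isos K (points U) (related U) \<Longrightarrow>
       p \<subseteq> ext_map U p \<and> Domain (ext_map U p) = points U \<and> Range (ext_map U p) = points U"
    using homogeneous_extension[OF K P] by metis
  have "homogeneous_universal K n (points U) (related U)"
  proof (rule homogeneous_universal.intro[OF K(1)])
    show "nary n (points U) (related U)" using U(1) by (simp add: is_stage_def)
    show "\<exists>\<sigma>. p \<subseteq> \<sigma> \<and> part_iso (points U) (related U) \<sigma> \<and> Domain \<sigma> = points U \<and> Range \<sigma> = points U"
      if "part_iso (points U) (related U) p" "|p| \<le>o |K|" for p
    proof (intro exI[of _ "ext_map U p"] conjI)
      have "p \<in> small_isos K (points U) (related U)" using that by (simp add: small_isos_def)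
      then show "p \<subseteq> ext_map U p" "Domain (ext_map U p) = points U" "Range (ext_map U p) = points U"
        using hom by simp_all
      show "part_iso (points U) (related U) (ext_map U p)" using U(1) by (simp add: is_stage_def)
    qed
    show "\<exists>\<iota>. inj_on \<iota> K \<and> \<iota> ` K \<subseteq> points U \<and>
       (\<forall>xs. set xs \<subseteq> K \<and> length xs = n \<longrightarrow> (related U (map \<iota> xs) \<longleftrightarrow> xs \<in> S))" for S
    proof -
      obtain \<iota> where i: "inj_on \<iota> K" "\<iota> ` K \<subseteq> points P"
        "\<forall>xs. set xs \<subseteq> K \<and> length xs = n \<longrightarrow> (related P (map \<iota> xs) \<longleftrightarrow> xs \<in> S)"
        using univ[of S] by blast
      have "related U (map \<iota> xs) = related P (map \<iota> xs)" if "set xs \<subseteq> K" for xs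
        using i(2) that by (intro stage_leD(2)[OF U(2)]) auto
      moreover have "\<iota> ` K \<subseteq> points U" using i(2) stage_leD(1)[OF U(2)] by simp
      ultimately show ?thesis using i(1,3) by (intro exI[of _ \<iota>]) simp
    qed
  qed
  then show ?thesis by blast
qed

section \<open>Monster models from homogeneous universal relations\<close>

text \<open>A maximal family with the finite intersection property. If neither \<open>A\<close> nor
  its complement belonged to it, one finite subfamily would miss \<open>A\<close> and another the
  complement, and together they would have empty intersection.\<close>

lemma ultrafilter_extends:
  assumes "\<And>F. finite F \<Longrightarrow> F \<subseteq> \<G> \<Longrightarrow> \<Inter> F \<noteq> {}"
  obtains \<U> where "\<G> \<subseteq> \<U>" "\<And>F. finite F \<Longrightarrow> F \<subseteq> \<U> \<Longrightarrow> \<Inter> F \<noteq> {}"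
    "\<And>A. A \<in> \<U> \<or> - A \<in> \<U>"
proof -
  define fip where "fip H \<longleftrightarrow> (\<forall>F. finite F \<and> F \<subseteq> H \<longrightarrow> \<Inter> F \<noteq> {})" for H :: "'a set set"
  let ?A = "{H. \<G> \<subseteq> H \<and> fip H}"
  have "\<exists>M\<in>?A. \<forall>X\<in>?A. M \<subseteq> X \<longrightarrow> X = M"
  proof (rule subset_Zorn_nonempty)
    have "fip \<G>" using assms by (simp add: fip_def)
    then show "?A \<noteq> {}" by blast
    fix C assume C: "C \<noteq> {}" "subset.chain ?A C"
    then have CA: "C \<subseteq> ?A" by (simp add: subset_chain_def)
    have "\<Inter> F \<noteq> {}" if F: "finite F" "F \<subseteq> \<Union> C" for F
    proof -
      obtain H where "H \<in> C" "F \<subseteq> H" using finite_subset_Union_chain[OF F C] .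
      then show ?thesis using CA F(1) by (auto simp: fip_def)
    qed
    then have "fip (\<Union> C)" by (simp add: fip_def)
    moreover have "\<G> \<subseteq> \<Union> C" using C(1) CA by blast
    ultimately show "\<Union> C \<in> ?A" by simp
  qed
  then obtain M where "M \<in> ?A" and max': "\<forall>X\<in>?A. M \<subseteq> X \<longrightarrow> X = M" by (rule bexE)
  then have M: "\<G> \<subseteq> M" "fip M" by simp_all
  have max: "X = M" if "fip X" "M \<subseteq> X" for X using max' M(1) that by auto
  have cov: "\<exists>F. finite F \<and> F \<subseteq> M \<and> \<Inter> F \<inter> A = {}" if "A \<notin> M" for A
  proof -
    have "insert A M \<noteq> M" using that by blast
    then have "\<not> fip (insert A M)" using max[of "insert A M"] by blast
    then obtain F where F: "finite F" "F \<subseteq> insert A M" "\<Inter> F = {}" by (auto simp: fip_def)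
    have "finite (F - {A})" "F - {A} \<subseteq> M" "\<Inter> (F - {A}) \<inter> A = {}" using F by auto
    then show ?thesis by blast
  qed
  have "A \<in> M \<or> - A \<in> M" for A
  proof (rule ccontr)
    assume no: "\<not> ?thesis"
    obtain F where F: "finite F" "F \<subseteq> M" "\<Inter> F \<inter> A = {}" using no cov[of A] by blast
    obtain H where H: "finite H" "H \<subseteq> M" "\<Inter> H \<inter> - A = {}" using no cov[of "- A"] by blast
    have "\<Inter> (F \<union> H) = {}" using F(3) H(3) by blast
    moreover have "finite (F \<union> H)" "F \<union> H \<subseteq> M" using F H by auto
    ultimately show False using M(2) unfolding fip_def by blast
  qed
  moreover have "\<Inter> F \<noteq> {}" if "finite F" "F \<subseteq> M" for F using M(2) that by (simp add: fip_def)
  ultimately show thesis using that M(1) by metis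
qed

lemma complete_theory_of_structure:
  assumes "is_struct L M"
  shows "complete_theory L (tp L M [])" "is_model L (tp L M []) M"
proof -
  obtain a where a: "a \<in> universe M" using assms by (auto simp: is_struct_def)
  have sent: "sat M e \<phi> = holds M \<phi> []" if "\<phi> \<in> sentences L" for e \<phi>
    unfolding holds_def using that by (intro sat_cong) (auto simp: formulas_def)
  have "\<not> proves L (tp L M []) Bot"
  proof
    assume "proves L (tp L M []) Bot"
    then have "sat M (\<lambda>_. a) Bot"
      using soundness[OF _ assms, of _ Bot "\<lambda>_. a"] a sent by (auto simp: tp_def)
    then show False by simp
  qed
  moreover have "proves L (tp L M []) \<phi> \<or> proves L (tp L M []) (Neg \<phi>)" if "\<phi> \<in> sentences L" for \<phi>
  proof (cases "holds M \<phi> []")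
    case True
    then have "\<phi> \<in> tp L M []" "wf_fm L \<phi>" using that by (auto simp: tp_def formulas_def)
    then show ?thesis by (blast intro: proves.Assm)
  next
    case False
    then have "Neg \<phi> \<in> tp L M []" "wf_fm L (Neg \<phi>)" using that by (auto simp: tp_def formulas_def holds_def)
    then show ?thesis by (blast intro: proves.Assm)
  qed
  ultimately show "complete_theory L (tp L M [])" by (auto simp: complete_theory_def tp_def)
  show "is_model L (tp L M []) M" using assms by (auto simp: is_model_def tp_def)
qed

text \<open>One symbol must suffice, because \<open>'r\<close> may have no second element. There are
  no function symbols, so every nonempty set of points is a substructure.\<close>

definition rel_lang :: "'r \<Rightarrow> nat \<Rightarrow> ('f, 'r) lang" where
  "rel_lang r n = \<lparr>Funs = {}, Rels = {r}, fun_ar = (\<lambda>_. 0), rel_ar = (\<lambda>_. n)\<rparr>"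

definition rel_struct :: "'a set \<Rightarrow> ('a list \<Rightarrow> bool) \<Rightarrow> ('f, 'r, 'a) struct" where
  "rel_struct U R = \<lparr>universe = U, fn = undefined, rl = (\<lambda>_. R)\<rparr>"

lemma rel_simps [simp]:
  "Funs (rel_lang r n) = {}" "Rels (rel_lang r n) = {r}" "rel_ar (rel_lang r n) s = n"
  "universe (rel_struct U R) = U" "rl (rel_struct U R) r = R"
  by (simp_all add: rel_lang_def rel_struct_def)

lemma is_struct_rel: "U \<noteq> {} \<Longrightarrow> is_struct (rel_lang r n) (rel_struct U R)"
  by (simp add: is_struct_def)

text \<open>Pairs have the image first: in \<open>one_point_extension\<close> the automorphism has
  to lead back from the copy to \<open>A\<close>. Where the opposite direction is wanted, the
  converse is used.\<close>

lemma list_all2_graph: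
  "list_all2 (\<lambda>x y. (x, y) \<in> {(h z, z) | z. z \<in> A}) xs ys \<longleftrightarrow> set ys \<subseteq> A \<and> xs = map h ys"
proof
  show "list_all2 (\<lambda>x y. (x, y) \<in> {(h z, z) | z. z \<in> A}) xs ys \<Longrightarrow> set ys \<subseteq> A \<and> xs = map h ys"
    by (induction rule: list_all2_induct) auto
next
  assume "set ys \<subseteq> A \<and> xs = map h ys"
  then show "list_all2 (\<lambda>x y. (x, y) \<in> {(h z, z) | z. z \<in> A}) xs ys"
    by (auto simp: list_all2_conv_all_nth)
qed

lemma part_iso_graph:
  assumes "A \<subseteq> U" "h ` A \<subseteq> U" "inj_on h A"
    and "\<And>xs. set xs \<subseteq> A \<Longrightarrow> R (map h xs) = R xs"
  shows "part_iso U R {(h z, z) | z. z \<in> A}"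
  unfolding part_iso_def list_all2_graph single_valued_def
  using assms by (auto dest: inj_onD)

context homogeneous_universal
begin

lemma automorphism_extending:
  assumes "part_iso U R p" "|p| \<le>o |K|"
  obtains s where "bij_betw s U U" "\<And>xs. set xs \<subseteq> U \<Longrightarrow> R (map s xs) = R xs"
    "\<And>x y. (x, y) \<in> p \<Longrightarrow> s x = y"
proof -
  obtain \<sigma> where \<sigma>: "p \<subseteq> \<sigma>" "part_iso U R \<sigma>" "Domain \<sigma> = U" "Range \<sigma> = U"
    using homogeneous[OF assms] by blast
  have "\<exists>y. (x, y) \<in> \<sigma>" if "x \<in> U" for x using that \<sigma>(3) by blast
  then obtain s where s: "\<And>x. x \<in> U \<Longrightarrow> (x, s x) \<in> \<sigma>" by metis
  have sU: "s x \<in> U" if "x \<in> U" for x using s[OF that] \<sigma>(4) by blast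
  have eq: "s x = y" if "(x, y) \<in> \<sigma>" for x y
  proof -
    have "x \<in> U" using that \<sigma>(3) by blast
    then show ?thesis using part_isoD(2)[OF \<sigma>(2) s that] by simp
  qed
  have "bij_betw s U U" unfolding bij_betw_def
  proof
    show "inj_on s U"
    proof (rule inj_onI)
      fix x y assume "x \<in> U" "y \<in> U" "s x = s y"
      then show "x = y" using part_isoD(3)[OF \<sigma>(2) s, of x y] s[of y] by simp
    qed
    show "s ` U = U"
    proof
      show "U \<subseteq> s ` U"
      proof
        fix y assume "y \<in> U"
        then obtain x where x: "(x, y) \<in> \<sigma>" using \<sigma>(4) by blast
        then have "x \<in> U" using \<sigma>(3) by blast
        then show "y \<in> s ` U" using eq[OF x] by blast
      qed
    qed (use sU in blast)
  qed
  moreover have "R (map s xs) = R xs" if "set xs \<subseteq> U" for xs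
  proof -
    have "list_all2 (\<lambda>x y. (x, y) \<in> \<sigma>) xs (map s xs)"
      unfolding list_all2_map2 list_all2_same using that s by blast
    then show ?thesis using part_isoD(4)[OF \<sigma>(2)] by blast
  qed
  ultimately show thesis using that eq \<sigma>(1) by blast
qed

text \<open>\<open>None\<close> stands for the point to be added. A copy of the extended structure exists by universality;
  homogeneity moves its trace on \<open>A\<close> back to \<open>A\<close>.\<close>

lemma one_point_extension:
  assumes A: "A \<subseteq> U" "|A| \<le>o |K|"
  obtains c where "c \<in> U - A" "\<And>xs. set xs \<subseteq> insert None (Some ` A) \<Longrightarrow> None \<in> set xs \<Longrightarrow> length xs = n \<Longrightarrow>
    R (map (case_option c id) xs) = T xs"
proof -
  let ?B = "insert None (Some ` A)"
  \<comment> \<open>The prescribed relation decides only the tuples through the new point; on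
    \<open>A\<close> the relation stays \<open>R\<close>.\<close>
  define T' where "T' xs = (if None \<in> set xs then T xs else R (map the xs))" for xs
  have "|{None} \<union> Some ` A| \<le>o |K|"
  proof (rule card_of_Un_ordLeq[OF infinite_K])
    show "|{None :: 'm option}| \<le>o |K|" using infinite_K by (intro card_of_singl_ordLeq) auto
    show "|Some ` A| \<le>o |K|" by (rule ordLeq_transitive[OF card_of_image A(2)])
  qed
  then obtain q where q: "inj_on q ?B" "q ` ?B \<subseteq> K" by (auto elim: card_of_ordLeqE)
  define S where "S = {map q xs | xs. set xs \<subseteq> ?B \<and> T' xs}"
  obtain \<iota> where i: "inj_on \<iota> K" "\<iota> ` K \<subseteq> U"
    and iS: "\<And>xs. set xs \<subseteq> K \<Longrightarrow> length xs = n \<Longrightarrow> R (map \<iota> xs) \<longleftrightarrow> xs \<in> S"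
    using universal[of S] by blast
  define j where "j x = \<iota> (q x)" for x
  have j: "inj_on j ?B" "j ` ?B \<subseteq> U"
  proof -
    have "inj_on (\<iota> \<circ> q) ?B" by (rule comp_inj_on[OF q(1) inj_on_subset[OF i(1) q(2)]])
    then show "inj_on j ?B" by (simp add: j_def[abs_def] comp_def)
    show "j ` ?B \<subseteq> U" using q(2) i(2) by (auto simp: j_def)
  qed
  have RT: "R (map j xs) = T' xs" if xs: "set xs \<subseteq> ?B" "length xs = n" for xs
  proof -
    have "set (map q xs) \<subseteq> K" using xs(1) q(2) by auto
    then have "R (map \<iota> (map q xs)) \<longleftrightarrow> map q xs \<in> S" using xs(2) by (intro iS) auto
    moreover have "map j xs = map \<iota> (map q xs)" by (simp add: j_def)
    moreover have "map q xs \<in> S \<longleftrightarrow> T' xs"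
    proof
      assume "map q xs \<in> S"
      then obtain ys where ys: "map q xs = map q ys" "set ys \<subseteq> ?B" "T' ys" by (auto simp: S_def)
      have "inj_on q (set xs \<union> set ys)" by (rule inj_on_subset[OF q(1)]) (use xs(1) ys(2) in simp)
      then have "xs = ys" using map_inj_on[OF ys(1)] by blast
      then show "T' xs" using ys(3) by simp
    qed (use xs in \<open>auto simp: S_def\<close>)
    ultimately show ?thesis by (simp only:)
  qed
  define p where "p = {(j (Some a), a) | a. a \<in> A}"
  have pi: "part_iso U R p" unfolding p_def
  proof (rule part_iso_graph[OF A(1)])
    show "(\<lambda>a. j (Some a)) ` A \<subseteq> U" using j(2) by blast
    show "inj_on (\<lambda>a. j (Some a)) A" using j(1) by (auto simp: inj_on_def)
    fix xs assume xs: "set xs \<subseteq> A"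
    show "R (map (\<lambda>a. j (Some a)) xs) = R xs"
    proof (cases "length xs = n")
      case True
      have "set (map Some xs) \<subseteq> ?B" using xs by auto
      then have "R (map j (map Some xs)) = T' (map Some xs)" using True by (intro RT) auto
      also have "T' (map Some xs) = R xs" by (auto simp: T'_def comp_def)
      finally show ?thesis by (simp add: comp_def)
    next
      case False
      then show ?thesis using nary by (auto simp: nary_def)
    qed
  qed
  have "p = (\<lambda>a. (j (Some a), a)) ` A" by (auto simp: p_def)
  then have "|p| \<le>o |K|" by (simp add: ordLeq_transitive[OF card_of_image A(2)])
  then obtain s where s: "bij_betw s U U" "\<And>xs. set xs \<subseteq> U \<Longrightarrow> R (map s xs) = R xs"
    "\<And>x y. (x, y) \<in> p \<Longrightarrow> s x = y"
    using automorphism_extending[OF pi] by blast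
  have sa: "s (j (Some a)) = a" if "a \<in> A" for a using that s(3) by (auto simp: p_def)
  let ?c = "s (j None)"
  have jN: "j None \<in> U" using j(2) by blast
  then have "?c \<in> U" using s(1) by (auto simp: bij_betw_def)
  moreover have "?c \<notin> A"
  proof
    assume c: "?c \<in> A"
    then have "s (j (Some ?c)) = s (j None)" using sa by simp
    moreover have "j (Some ?c) \<in> U" using c j(2) by blast
    ultimately have "j (Some ?c) = j None" using s(1) jN by (auto simp: bij_betw_def dest: inj_onD)
    then have "Some ?c = None" using c by (intro inj_onD[OF j(1)]) auto
    then show False by simp
  qed
  moreover have "R (map (case_option ?c id) xs) = T xs"
    if xs: "set xs \<subseteq> ?B" "None \<in> set xs" "length xs = n" for xs
  proof -
    have "map (case_option ?c id) xs = map s (map j xs)"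
      using xs(1) sa by (auto split: option.split)
    then have "R (map (case_option ?c id) xs) = R (map s (map j xs))" by (simp only:)
    also have "\<dots> = R (map j xs)" using xs(1) j(2) by (intro s(2)) auto
    also have "\<dots> = T xs" using RT[OF xs(1,3)] xs(2) by (simp add: T'_def)
    finally show ?thesis .
  qed
  ultimately show thesis using that by blast
qed

abbreviation M :: "('f, 'r, 'm) struct" where "M \<equiv> rel_struct U R"

lemma automorphism_struct:
  assumes "bij_betw s U U" "\<And>xs. set xs \<subseteq> U \<Longrightarrow> R (map s xs) = R xs"
  shows "is_iso (rel_lang r n) M M s"
  using assms by (auto simp: is_iso_def tuples_def)

lemma U_nonempty: "U \<noteq> {}"
  using universal[of "{}"] infinite_K by auto

lemma elementary:
  fixes \<phi> :: "('f, 'r) fm"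
  assumes p: "part_iso U R p" "|p| \<le>o |K|" and xy: "list_all2 (\<lambda>x y. (x, y) \<in> p) xs ys"
    and \<phi>: "\<phi> \<in> formulas (rel_lang r n) (length xs)"
  shows "holds M \<phi> xs = holds M \<phi> ys"
proof -
  obtain s where s: "bij_betw s U U" "\<And>xs. set xs \<subseteq> U \<Longrightarrow> R (map s xs) = R xs"
    "\<And>x y. (x, y) \<in> p \<Longrightarrow> s x = y"
    using automorphism_extending[OF p] by blast
  let ?L = "rel_lang r n :: ('f, 'r) lang"
  have iso: "is_iso ?L M M s" by (rule automorphism_struct[OF s(1)]) (rule s(2))
  have "set xs \<subseteq> U" using list_all2_Domain[OF xy] part_isoD(1)[OF p(1)] by blast
  moreover have "ys = map s xs" using xy s(3)
    by (auto simp: list_all2_conv_all_nth intro!: nth_equalityI)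
  moreover have "is_struct ?L M" by (rule is_struct_rel[OF U_nonempty])
  ultimately show ?thesis using holds_embedding[of ?L M M s xs \<phi>] iso \<phi>
    by (simp add: is_iso_iff_embedding)
qed

lemma relation_formula:
  assumes "length xs = n"
  shows "Rl r (map Var [0..<n]) \<in> formulas (rel_lang r n) (length xs)"
    "holds M (Rl r (map Var [0..<n])) xs \<longleftrightarrow> R xs"
proof -
  show "Rl r (map Var [0..<n]) \<in> formulas (rel_lang r n) (length xs)"
    using assms by (auto simp: formulas_def list_all_iff)
  have "map (\<lambda>k. xs ! k) [0..<n] = xs" using map_nth[of xs] assms by simp
  then show "holds M (Rl r (map Var [0..<n])) xs \<longleftrightarrow> R xs" by (simp add: holds_def comp_def)
qed

lemma strongly_homogeneous:
  fixes r :: 'r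
  assumes \<kappa>: "\<And>A :: 'm set. |A| <o \<kappa> \<Longrightarrow> |A| \<le>o |K|"
  shows "strongly_homogeneous \<kappa> (rel_lang r n :: ('f, 'r) lang) M"
  unfolding strongly_homogeneous_def
proof (intro allI impI)
  let ?L = "rel_lang r n :: ('f, 'r) lang"
  fix A and f :: "'m \<Rightarrow> 'm" assume *: "|A| <o \<kappa> \<and> partial_elementary ?L M A f"
  then have A: "A \<subseteq> U" "f ` A \<subseteq> U" by (auto simp: partial_elementary_def)
  have tp: "holds M \<phi> (map f xs) = holds M \<phi> xs"
    if "set xs \<subseteq> A" "\<phi> \<in> formulas (rel_lang r n) (length xs)" for xs and \<phi> :: "('f, 'r) fm"
  proof -
    have "tp ?L M (map f xs) = tp ?L M xs"
      using * that(1) by (auto simp: partial_elementary_def)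
    then have "\<phi> \<in> tp ?L M (map f xs) \<longleftrightarrow> \<phi> \<in> tp ?L M xs" by (simp only:)
    then show ?thesis using that(2) by (simp add: tp_def)
  qed
  define p where "p = {(f z, z) | z. z \<in> A}"
  have "part_iso U R p" unfolding p_def
  proof (rule part_iso_graph[OF A])
    show "inj_on f A"
    proof (rule inj_onI)
      fix x y assume xy: "x \<in> A" "y \<in> A" "f x = f y"
      have "Eq (Var 0) (Var 1) \<in> formulas (rel_lang r n) (length [x, y])" by (auto simp: formulas_def)
      then show "x = y" using tp[of "[x, y]" "Eq (Var 0) (Var 1)"] xy by (simp add: holds_def)
    qed
    show "R (map f xs) = R xs" if xs: "set xs \<subseteq> A" for xs
    proof (cases "length xs = n")
      case True
      let ?\<phi> = "Rl r (map Var [0..<n]) :: ('f, 'r) fm"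
      have "holds M ?\<phi> xs \<longleftrightarrow> R xs" "holds M ?\<phi> (map f xs) \<longleftrightarrow> R (map f xs)"
        by (rule relation_formula(2)[OF True], rule relation_formula(2)) (simp add: True)
      then show ?thesis using tp[OF xs relation_formula(1)[OF True]] by simp
    next
      case False
      then show ?thesis using nary by (auto simp: nary_def)
    qed
  qed
  then have pi: "part_iso U R (p\<inverse>)" by (simp add: part_iso_converse)
  have "|A| \<le>o |K|" using * by (intro \<kappa>) blast
  moreover have "p\<inverse> = (\<lambda>a. (a, f a)) ` A" by (auto simp: p_def)
  ultimately have "|p\<inverse>| \<le>o |K|" by (simp add: ordLeq_transitive[OF card_of_image])
  then obtain s where s: "bij_betw s U U" "\<And>xs. set xs \<subseteq> U \<Longrightarrow> R (map s xs) = R xs"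
    "\<And>x y. (x, y) \<in> p\<inverse> \<Longrightarrow> s x = y"
    using automorphism_extending[OF pi] by blast
  have "is_automorphism ?L M s"
    unfolding is_automorphism_def by (rule automorphism_struct[OF s(1)]) (rule s(2))
  moreover have "\<forall>x\<in>A. s x = f x" using s(3) by (auto simp: p_def)
  ultimately show "\<exists>\<sigma>. is_automorphism ?L M \<sigma> \<and> (\<forall>x\<in>A. \<sigma> x = f x)" by blast
qed

text \<open>Matching \<open>c\<close> with \<open>c'\<close> and fixing \<open>as\<close> is a
  finite partial isomorphism: tuples avoiding the point do not change, and the others are covered by
  the assumption on \<open>R\<close>. Hence the relations to \<open>as\<close> decide all formulas
  over \<open>as\<close>.\<close>

lemma exchange_point:
  fixes \<phi> :: "('f, 'r) fm"
  assumes c: "c \<in> U" "c' \<in> U" "c \<notin> set as" "c' \<notin> set as" "set as \<subseteq> U"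
    and R: "\<And>xs. set xs \<subseteq> insert None (Some ` set as) \<Longrightarrow> None \<in> set xs \<Longrightarrow> length xs = n \<Longrightarrow>
      R (map (case_option c id) xs) = R (map (case_option c' id) xs)"
    and \<phi>: "\<phi> \<in> formulas (rel_lang r n) (Suc (length as))"
  shows "holds M \<phi> (c # as) = holds M \<phi> (c' # as)"
proof -
  define h where "h z = (if z = c' then c else z)" for z
  define p where "p = {(h z, z) | z. z \<in> insert c' (set as)}"
  have "part_iso U R p" unfolding p_def
  proof (rule part_iso_graph)
    show "inj_on h (insert c' (set as))" using c by (auto simp: h_def inj_on_def)
    show "h ` insert c' (set as) \<subseteq> U" "insert c' (set as) \<subseteq> U" using c by (auto simp: h_def)
    fix ys assume ys: "set ys \<subseteq> insert c' (set as)"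
    show "R (map h ys) = R ys"
    proof (cases "c' \<in> set ys \<and> length ys = n")
      case True
      let ?xs = "map (\<lambda>y. if y = c' then None else Some y) ys"
      have "map (case_option c id) ?xs = map h ys" "map (case_option c' id) ?xs = ys"
        by (auto simp: h_def intro!: map_idI)
      moreover have "R (map (case_option c id) ?xs) = R (map (case_option c' id) ?xs)"
        using True ys by (intro R) auto
      ultimately show ?thesis by (simp only:)
    next
      case False
      then consider "c' \<notin> set ys" | "length ys \<noteq> n" by blast
      then show ?thesis
      proof cases
        case 1
        then have "map h ys = ys" by (auto simp: h_def intro!: map_idI)
        then show ?thesis by simp
      qed (use nary in \<open>auto simp: nary_def\<close>)
    qed
  qed
  moreover have "|p| \<le>o |K|"
  proof -
    have "p = (\<lambda>z. (h z, z)) ` insert c' (set as)" by (auto simp: p_def)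
    then have "finite p" by simp
    then show ?thesis using infinite_K by (meson card_of_ordLeq_infinite card_of_Well_order ordLeq_total)
  qed
  moreover have "list_all2 (\<lambda>x y. (x, y) \<in> p) (c # as) (c' # as)"
    unfolding p_def list_all2_graph using c by (auto simp: h_def intro!: map_idI[symmetric])
  ultimately show ?thesis using elementary[of p "c # as" "c' # as" \<phi>] \<phi> by simp
qed

text \<open>Extend the type to an ultrafilter containing \<open>U\<close>. If it is concentrated at
  a point of \<open>U\<close>, that point realises the type. Otherwise it prescribes a relation
  \<open>T\<close> to the parameters, which a new point \<open>c\<close> realises; each formula of
  the type then passes to \<open>c\<close> from a point that looks like \<open>c\<close> over the
  finitely many parameters of the formula.\<close>

lemma saturated:
  fixes r :: 'r
  assumes \<kappa>: "\<And>A :: 'm set. |A| <o \<kappa> \<Longrightarrow> |A| \<le>o |K|"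
  shows "saturated \<kappa> (rel_lang r n :: ('f, 'r) lang) M"
  unfolding saturated_def
proof (intro allI impI)
  fix A and P :: "(('f, 'r) fm \<times> 'm list) set"
  assume "A \<subseteq> universe (M :: ('f, 'r, 'm) struct)" and small: "|A| <o \<kappa>"
    and P: "(\<forall>(\<phi>, as)\<in>P. set as \<subseteq> A \<and> \<phi> \<in> formulas (rel_lang r n) (Suc (length as))) \<and>
      (\<forall>p0\<subseteq>P. finite p0 \<longrightarrow> (\<exists>c\<in>universe (M :: ('f, 'r, 'm) struct). \<forall>(\<phi>, as)\<in>p0. holds M \<phi> (c # as)))"
  then have A: "A \<subseteq> U" by simp
  define D where "D = (\<lambda>(\<phi>, as). {c \<in> U. holds M (\<phi> :: ('f, 'r) fm) (c # as)})"
  have fip: "\<Inter> F \<noteq> {}" if F: "finite F" "F \<subseteq> insert U (D ` P)" for F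
  proof -
    have "finite (F - {U})" "F - {U} \<subseteq> D ` P" using F by auto
    then obtain p0 where p0: "p0 \<subseteq> P" "finite p0" "F - {U} = D ` p0" using finite_subset_image by metis
    then obtain c where c: "c \<in> U" "\<forall>(\<phi>, as)\<in>p0. holds M \<phi> (c # as)" using P by auto
    have "c \<in> X" if "X \<in> F" for X
    proof (cases "X = U")
      case False
      then have "X \<in> D ` p0" using that p0(3) by blast
      then show ?thesis using c by (auto simp: D_def)
    qed (use c in simp)
    then show ?thesis by blast
  qed
  obtain \<U> where \<U>: "insert U (D ` P) \<subseteq> \<U>" "\<And>F. finite F \<Longrightarrow> F \<subseteq> \<U> \<Longrightarrow> \<Inter> F \<noteq> {}"
    "\<And>X. X \<in> \<U> \<or> - X \<in> \<U>"
    using ultrafilter_extends[OF fip] by metis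
  show "\<exists>c\<in>universe (M :: ('f, 'r, 'm) struct). \<forall>(\<phi>, as)\<in>P. holds M \<phi> (c # as)"
  proof (cases "\<exists>a\<in>U. {a} \<in> \<U>")
    case True
    then obtain a where a: "a \<in> U" "{a} \<in> \<U>" by blast
    have "holds M \<phi> (a # as)" if "(\<phi>, as) \<in> P" for \<phi> as
    proof -
      have "D (\<phi>, as) \<in> \<U>" using that \<U>(1) by blast
      then have "\<Inter> {{a}, D (\<phi>, as)} \<noteq> {}" using a(2) by (intro \<U>(2)) auto
      then show ?thesis by (auto simp: D_def)
    qed
    then show ?thesis using a(1) by auto
  next
    case False
    define T where "T xs \<longleftrightarrow> {c. R (map (case_option c id) xs)} \<in> \<U>" for xs
    obtain c where c: "c \<in> U - A" "\<And>xs. set xs \<subseteq> insert None (Some ` A) \<Longrightarrow> None \<in> set xs \<Longrightarrow>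
        length xs = n \<Longrightarrow> R (map (case_option c id) xs) = T xs"
      using one_point_extension[OF A \<kappa>[OF small], of T] by metis
    have "holds M \<phi> (c # as)" if Pas: "(\<phi>, as) \<in> P" for \<phi> as
    proof -
      have as: "set as \<subseteq> A" "\<phi> \<in> formulas (rel_lang r n) (Suc (length as))" using P Pas by auto
      define X where "X = {xs. set xs \<subseteq> insert None (Some ` set as) \<and> length xs = n}"
      define E where "E xs = (if T xs then {c. R (map (case_option c id) xs)}
        else - {c. R (map (case_option c id) xs)})" for xs
      \<comment> \<open>Finitely many members of the ultrafilter: the formula itself, the decisions
        about all tuples over \<open>as\<close> and the new point, and avoidance of
        \<open>as\<close>. A common element is a point to exchange with \<open>c\<close>.\<close>
      let ?F = "{U, D (\<phi>, as)} \<union> E ` X \<union> (\<lambda>a. - {a}) ` set as"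
      have "finite X" unfolding X_def by (rule finite_lists_length_eq) simp
      then have "finite ?F" by simp
      moreover have "E xs \<in> \<U>" for xs using \<U>(3) by (auto simp: E_def T_def)
      moreover have "- {a} \<in> \<U>" if "a \<in> set as" for a
        using that as(1) A False \<U>(3) by blast
      ultimately have "\<Inter> ?F \<noteq> {}" using \<U>(1) Pas by (intro \<U>(2)) auto
      then obtain c' where c': "c' \<in> \<Inter> ?F" by blast
      then have 1: "c' \<in> U" "c' \<in> D (\<phi>, as)" "\<And>xs. xs \<in> X \<Longrightarrow> c' \<in> E xs" "c' \<notin> set as" by auto
      have "holds M \<phi> (c # as) = holds M \<phi> (c' # as)"
      proof (rule exchange_point[OF _ 1(1) _ 1(4) _ _ as(2)])
        show "R (map (case_option c id) xs) = R (map (case_option c' id) xs)"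
          if xs: "set xs \<subseteq> insert None (Some ` set as)" "None \<in> set xs" "length xs = n" for xs
        proof -
          have "R (map (case_option c id) xs) = T xs" using xs as(1) by (intro c(2)) auto
          moreover have "c' \<in> E xs" using xs by (intro 1(3)) (simp add: X_def)
          ultimately show ?thesis by (simp add: E_def split: if_splits)
        qed
      qed (use c(1) as(1) A in auto)
      then show ?thesis using 1(2) by (simp add: D_def)
    qed
    then show ?thesis using c(1) by auto
  qed
qed

lemma monster:
  fixes r :: 'r
  assumes "\<And>A :: 'm set. |A| <o \<kappa> \<Longrightarrow> |A| \<le>o |K|"
  shows "monster \<kappa> (rel_lang r n :: ('f, 'r) lang) (tp (rel_lang r n) M []) M"
  unfolding monster_def
  by (intro conjI saturated strongly_homogeneous assms
    complete_theory_of_structure(2)[OF is_struct_rel[OF U_nonempty]])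

end

section \<open>Generated substructures and copies\<close>

lemma restrict_simps [simp]:
  "universe (restrict M S) = S" "fn (restrict M S) = fn M" "rl (restrict M S) = rl M"
  "restrict (restrict M S) D = restrict M D" "restrict M (universe M) = M"
  by (simp_all add: restrict_def)

lemma substructureD:
  assumes "substructure L M S"
  shows "S \<subseteq> universe M" "is_struct L (restrict M S)" "S \<noteq> {}"
  using assms by (auto simp: substructure_def is_struct_def)

lemma substructure_restrict:
  assumes "S \<subseteq> universe M"
  shows "substructure L (restrict M S) D \<longleftrightarrow> D \<subseteq> S \<and> substructure L M D"
  using assms by (auto simp: substructure_def)

lemma gen_subset:
  assumes "is_struct L M" "X \<subseteq> universe M"
  shows "gen L M X \<subseteq> universe M"
proof
  fix x assume "x \<in> gen L M X"
  then show "x \<in> universe M"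
  proof induction
    case (step f xs)
    then have "xs \<in> tuples M (fun_ar L f)" by (auto simp: tuples_def)
    then show ?case using assms(1) step(1) by (auto simp: is_struct_def)
  qed (use assms(2) in blast)
qed

lemma gen_base: "X \<subseteq> gen L M X"
  by (blast intro: gen.base)

lemma substructure_gen:
  assumes "is_struct L M" "X \<subseteq> universe M" "gen L M X \<noteq> {}"
  shows "substructure L M (gen L M X)"
proof -
  have "fn M f xs \<in> gen L M X" if "f \<in> Funs L" "xs \<in> tuples (restrict M (gen L M X)) (fun_ar L f)" for f xs
    using that by (intro gen.step) (auto simp: tuples_def)
  then show ?thesis using assms gen_subset[OF assms(1,2)] by (simp add: substructure_def is_struct_def)
qed

lemma gen_least:
  assumes "substructure L M S" "X \<subseteq> S"
  shows "gen L M X \<subseteq> S"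
proof
  fix x assume "x \<in> gen L M X"
  then show "x \<in> S"
  proof induction
    case (step f xs)
    then have "xs \<in> tuples (restrict M S) (fun_ar L f)" by (auto simp: tuples_def)
    then show ?case using substructureD(2)[OF assms(1)] step(1) by (auto simp: is_struct_def)
  qed (use assms(2) in blast)
qed

lemma gen_self: "substructure L M S \<Longrightarrow> gen L M S = S"
  using gen_least[of L M S S] gen_base[of S L M] by blast

lemma fin_gen_substructure_iff:
  assumes "locally_finite L M"
  shows "fin_gen_substructure L M S \<longleftrightarrow> substructure L M S \<and> finite S"
proof
  assume "fin_gen_substructure L M S"
  then show "substructure L M S \<and> finite S"
    using assms by (simp add: locally_finite_def fin_gen_substructure_def)
next
  assume S: "substructure L M S \<and> finite S"
  then have "S = gen L M S" "S \<subseteq> universe M" by (simp_all add: gen_self substructure_def)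
  then show "fin_gen_substructure L M S" using S unfolding fin_gen_substructure_def
    by (intro conjI exI[of _ S]) simp_all
qed

lemma finite_gen:
  assumes "is_struct L M" "locally_finite L M" "X \<subseteq> universe M" "finite X"
  shows "finite (gen L M X)"
proof (cases "gen L M X = {}")
  case False
  then have "substructure L M (gen L M X)" using assms substructure_gen by blast
  then have "fin_gen_substructure L M (gen L M X)" using assms(3,4) by (auto simp: fin_gen_substructure_def)
  then show ?thesis using assms(2) by (simp add: locally_finite_def)
qed simp

definition terms :: "('f, 'r) lang \<Rightarrow> nat \<Rightarrow> 'f tm set" where
  "terms L n = {t. wf_tm L t \<and> fv_tm t \<subseteq> {..<n}}"

text \<open>The link between generated substructures and formulas: each generated element is named
  by a term in the given tuple.\<close>

lemma gen_eq_eval: "gen L M (set xs) = eval M (\<lambda>n. xs ! n) ` terms L (length xs)"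
proof
  show "gen L M (set xs) \<subseteq> eval M (\<lambda>n. xs ! n) ` terms L (length xs)"
  proof
    fix x assume "x \<in> gen L M (set xs)"
    then show "x \<in> eval M (\<lambda>n. xs ! n) ` terms L (length xs)"
    proof induction
      case (base x)
      then obtain i where "i < length xs" "x = xs ! i" by (auto simp: in_set_conv_nth)
      then show ?case by (intro image_eqI[of _ _ "Var i"]) (auto simp: terms_def)
    next
      case (step f ys)
      then have "\<forall>y\<in>set ys. \<exists>t\<in>terms L (length xs). y = eval M (\<lambda>n. xs ! n) t" by blast
      then obtain \<tau> where \<tau>: "\<forall>y\<in>set ys. \<tau> y \<in> terms L (length xs) \<and> y = eval M (\<lambda>n. xs ! n) (\<tau> y)"
        by metis
      then have "map (eval M (\<lambda>n. xs ! n)) (map \<tau> ys) = ys" by (auto intro!: map_idI)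
      then have "fn M f ys = eval M (\<lambda>n. xs ! n) (Fn f (map \<tau> ys))" by (simp only: eval.simps)
      moreover have "Fn f (map \<tau> ys) \<in> terms L (length xs)"
        using \<tau> step(1,2) by (auto simp: terms_def list_all_iff)
      ultimately show ?case by (rule image_eqI)
    qed
  qed
  have "eval M (\<lambda>n. xs ! n) t \<in> gen L M (set xs)" if "t \<in> terms L (length xs)" for t
    using that
  proof (induction t)
    case (Var i)
    then show ?case by (auto simp: terms_def intro: gen.base)
  next
    case (Fn f ts)
    then have "f \<in> Funs L" "length ts = fun_ar L f" by (auto simp: terms_def)
    moreover have "eval M (\<lambda>n. xs ! n) t \<in> gen L M (set xs)" if "t \<in> set ts" for t
      using that Fn.prems by (intro Fn.IH) (auto simp: terms_def list_all_iff)
    ultimately show ?case using gen.step[of f L "map (eval M (\<lambda>n. xs ! n)) ts" M "set xs"] by simp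
  qed
  then show "eval M (\<lambda>n. xs ! n) ` terms L (length xs) \<subseteq> gen L M (set xs)" by blast
qed

text \<open>Equality of quantifier-free types makes the correspondence between the values of terms at the
  two tuples a well-defined isomorphism.\<close>

lemma qftp_eq_iso:
  assumes len: "length xs = length ys" and tp: "qftp L A xs = qftp L B ys"
  shows "\<exists>h. is_iso L (restrict A (gen L A (set xs))) (restrict B (gen L B (set ys))) h \<and> map h xs = ys"
proof -
  let ?T = "terms L (length xs)" and ?a = "eval A (\<lambda>n. xs ! n)" and ?b = "eval B (\<lambda>n. ys ! n)"
  have gA: "gen L A (set xs) = ?a ` ?T" and gB: "gen L B (set ys) = ?b ` ?T"
    by (simp_all add: gen_eq_eval len)
  have qf: "holds A \<phi> xs = holds B \<phi> ys" if "\<phi> \<in> qf_formulas L (length xs)" for \<phi>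
  proof -
    have "\<phi> \<in> qftp L A xs \<longleftrightarrow> \<phi> \<in> qftp L B ys" by (simp only: tp)
    then show ?thesis using that len by (simp add: qftp_def)
  qed
  have eq: "?a s = ?a t \<longleftrightarrow> ?b s = ?b t" if "s \<in> ?T" "t \<in> ?T" for s t
    using qf[of "Eq s t"] that by (auto simp: holds_def qf_formulas_def formulas_def terms_def)
  have rel: "rl A r (map ?a ts) \<longleftrightarrow> rl B r (map ?b ts)"
    if "r \<in> Rels L" "length ts = rel_ar L r" "set ts \<subseteq> ?T" for r ts
  proof -
    have "Rl r ts \<in> qf_formulas L (length xs)"
      using that by (auto simp: qf_formulas_def formulas_def terms_def list_all_iff)
    then show ?thesis using qf[of "Rl r ts"] by (simp add: holds_def)
  qed
  define h where "h x = ?b (SOME t. t \<in> ?T \<and> ?a t = x)" for x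
  have h: "h (?a t) = ?b t" if "t \<in> ?T" for t
  proof -
    let ?s = "SOME s. s \<in> ?T \<and> ?a s = ?a t"
    have "?s \<in> ?T \<and> ?a ?s = ?a t" by (rule someI[of _ t]) (simp add: that)
    then show ?thesis using eq[of ?s t] that by (simp add: h_def)
  qed
  have img: "h ` gen L A (set xs) = gen L B (set ys)"
    unfolding gA gB image_image using h by (intro image_cong) auto
  have inj: "inj_on h (gen L A (set xs))"
    unfolding gA using h eq by (auto intro!: inj_onI)
  have ex: "\<exists>ts. zs = map ?a ts \<and> set ts \<subseteq> ?T" if "set zs \<subseteq> gen L A (set xs)" for zs
    using that
  proof (induction zs)
    case (Cons z zs)
    then obtain t ts where "z = ?a t" "t \<in> ?T" "zs = map ?a ts" "set ts \<subseteq> ?T" unfolding gA by auto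
    then show ?case by (intro exI[of _ "t # ts"]) simp
  qed simp
  have hm: "map h (map ?a ts) = map ?b ts" if "set ts \<subseteq> ?T" for ts
    using that h by auto
  have "h (fn A f zs) = fn B f (map h zs)"
    if f: "f \<in> Funs L" and zs: "set zs \<subseteq> gen L A (set xs)" "length zs = fun_ar L f" for f zs
  proof -
    obtain ts where ts: "zs = map ?a ts" "set ts \<subseteq> ?T" using ex[OF zs(1)] by blast
    then have "Fn f ts \<in> ?T" using f zs(2) by (auto simp: terms_def list_all_iff)
    then have "h (fn A f (map ?a ts)) = fn B f (map ?b ts)" using h[of "Fn f ts"] by simp
    then show ?thesis unfolding ts(1) hm[OF ts(2)] .
  qed
  moreover have "rl A r zs \<longleftrightarrow> rl B r (map h zs)"
    if r: "r \<in> Rels L" and zs: "set zs \<subseteq> gen L A (set xs)" "length zs = rel_ar L r" for r zs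
  proof -
    obtain ts where ts: "zs = map ?a ts" "set ts \<subseteq> ?T" using ex[OF zs(1)] by blast
    show ?thesis unfolding ts(1) hm[OF ts(2)] using rel[OF r _ ts(2)] ts(1) zs(2) by simp
  qed
  ultimately have "is_iso L (restrict A (gen L A (set xs))) (restrict B (gen L B (set ys))) h"
    unfolding is_iso_def bij_betw_def tuples_def using inj img by simp
  moreover have "map h xs = ys"
  proof (rule nth_equalityI)
    fix i assume "i < length (map h xs)"
    then show "map h xs ! i = ys ! i" using h[of "Var i"] by (simp add: terms_def)
  qed (simp add: len)
  ultimately show ?thesis by blast
qed

section \<open>Images, composition and inverses\<close>

lemma map_inv_into: "set ys \<subseteq> h ` A \<Longrightarrow> map h (map (inv_into A h) ys) = ys"
  by (induction ys) (auto simp: f_inv_into_f)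

lemma embedding_image:
  assumes "embedding L A B h" "is_struct L A"
  shows "is_iso L A (restrict B (h ` universe A)) h" "substructure L B (h ` universe A)"
proof -
  show "is_iso L A (restrict B (h ` universe A)) h"
    using assms by (auto simp: embedding_def is_iso_def bij_betw_def)
  have "fn B f ys \<in> h ` universe A" if f: "f \<in> Funs L" "ys \<in> tuples (restrict B (h ` universe A)) (fun_ar L f)" for f ys
  proof -
    have ys: "set ys \<subseteq> h ` universe A" "length ys = fun_ar L f" using f(2) by (auto simp: tuples_def)
    let ?xs = "map (inv_into (universe A) h) ys"
    have "map h ?xs = ys" using ys(1) by (rule map_inv_into)
    moreover have xs: "set ?xs \<subseteq> universe A" using ys(1) by (auto intro!: inv_into_into)
    ultimately have "h (fn A f ?xs) = fn B f ys"
      using embeddingD(3)[OF assms(1) f(1) xs] ys(2) by simp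
    moreover have "fn A f ?xs \<in> universe A"
      using assms(2) f(1) xs ys(2) by (auto simp: is_struct_def tuples_def)
    ultimately show ?thesis by (metis imageI)
  qed
  then show "substructure L B (h ` universe A)"
    using embeddingD(2)[OF assms(1)] assms(2) by (auto simp: substructure_def is_struct_def)
qed

lemma embedding_restrict:
  "embedding L A B h \<Longrightarrow> D \<subseteq> universe A \<Longrightarrow> embedding L (restrict A D) B h"
  by (auto simp: embedding_def tuples_def intro: inj_on_subset)

lemma embedding_inclusion:
  assumes "substructure L M S" "embedding L A (restrict M S) h"
  shows "embedding L A M h"
  using assms substructureD(1) by (fastforce simp: embedding_def)

lemma embedding_comp:
  assumes "embedding L A B g" "embedding L B C h"
  shows "embedding L A C (h \<circ> g)"
proof -
  have "inj_on (h \<circ> g) (universe A)"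
    by (rule comp_inj_on[OF embeddingD(1)[OF assms(1)] inj_on_subset[OF embeddingD(1)[OF assms(2)] embeddingD(2)[OF assms(1)]]])
  moreover have "(h \<circ> g) ` universe A \<subseteq> universe C"
    using embeddingD(2)[OF assms(1)] embeddingD(2)[OF assms(2)] by auto
  moreover have "map g xs \<in> tuples B k" if "xs \<in> tuples A k" for xs k
    using that embeddingD(2)[OF assms(1)] by (auto simp: tuples_def)
  ultimately show ?thesis using assms by (simp add: embedding_def)
qed

lemma iso_comp: "is_iso L A B g \<Longrightarrow> is_iso L B C h \<Longrightarrow> is_iso L A C (h \<circ> g)"
  using embedding_comp[of L A B g C h] by (simp add: is_iso_iff_embedding image_comp[symmetric] del: o_apply)

lemma iso_inverse:
  assumes "is_iso L A B h" "is_struct L A"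
  shows "is_iso L B A (inv_into (universe A) h)"
proof -
  let ?g = "inv_into (universe A) h"
  have e: "embedding L A B h" "h ` universe A = universe B" using assms(1) by (auto simp: is_iso_iff_embedding)
  have bij: "bij_betw h (universe A) (universe B)" using assms(1) by (simp add: is_iso_def)
  have gh: "?g (h x) = x" if "x \<in> universe A" for x using that bij by (simp add: bij_betw_inv_into_left)
  have xs: "set (map ?g ys) \<subseteq> universe A \<and> map h (map ?g ys) = ys" if "set ys \<subseteq> universe B" for ys
    using that map_inv_into[of ys h "universe A"] by (auto simp: e(2)[symmetric] intro!: inv_into_into)
  have "?g (fn B f ys) = fn A f (map ?g ys)"
    if "f \<in> Funs L" "set ys \<subseteq> universe B" "length ys = fun_ar L f" for f ys
  proof -
    have "h (fn A f (map ?g ys)) = fn B f ys"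
      using embeddingD(3)[OF e(1) that(1), of "map ?g ys"] xs[OF that(2)] that(3) by simp
    moreover have "fn A f (map ?g ys) \<in> universe A"
      using assms(2) that xs[OF that(2)] by (auto simp: is_struct_def tuples_def)
    ultimately show ?thesis using gh by metis
  qed
  moreover have "rl B r ys = rl A r (map ?g ys)"
    if "r \<in> Rels L" "set ys \<subseteq> universe B" "length ys = rel_ar L r" for r ys
    using embeddingD(4)[OF e(1) that(1), of "map ?g ys"] xs[OF that(2)] that(3) by simp
  ultimately show ?thesis
    unfolding is_iso_def using bij_betw_inv_into[OF bij] by (auto simp: tuples_def)
qed

lemma isomorphic_sym: "isomorphic L A B \<Longrightarrow> is_struct L A \<Longrightarrow> isomorphic L B A"
  unfolding isomorphic_def using iso_inverse by blast

lemma isomorphic_trans: "isomorphic L A B \<Longrightarrow> isomorphic L B C \<Longrightarrow> isomorphic L A C"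
  unfolding isomorphic_def using iso_comp by blast

section \<open>Copies, arrows and rigidity\<close>

lemma copies_restrict:
  assumes "S \<subseteq> universe C"
  shows "copies L (restrict C S) A = {D \<in> copies L C A. D \<subseteq> S}"
  using substructure_restrict[OF assms] by (auto simp: copies_def)

lemma copies_image:
  assumes "is_iso L C C' \<gamma>" "D \<in> copies L C A"
  shows "\<gamma> ` D \<in> copies L C' A"
proof -
  have D: "substructure L C D" "isomorphic L (restrict C D) A" using assms(2) by (auto simp: copies_def)
  have "embedding L (restrict C D) C' \<gamma>"
    using assms(1) substructureD(1)[OF D(1)] embedding_restrict by (auto simp: is_iso_iff_embedding)
  from embedding_image[OF this substructureD(2)[OF D(1)]]
  have *: "is_iso L (restrict C D) (restrict C' (\<gamma> ` D)) \<gamma>" "substructure L C' (\<gamma> ` D)" by simp_all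
  then have "isomorphic L (restrict C' (\<gamma> ` D)) (restrict C D)"
    using isomorphic_sym[OF _ substructureD(2)[OF D(1)]] by (auto simp: isomorphic_def)
  then show ?thesis using *(2) D(2) isomorphic_trans by (auto simp: copies_def)
qed

text \<open>Members of the age are only isomorphic to substructures of the index structure. This
  moves an arrow onto an actual substructure, where tuples of indices can be coloured.\<close>

lemma arrow_iso:
  assumes iso: "is_iso L C C' \<gamma>" "is_struct L C" and ar: "arrow L C B A k"
  shows "arrow L C' B A k"
  unfolding arrow_def
proof (intro allI impI)
  fix f assume f: "f ` copies L C' A \<subseteq> {..<k}"
  let ?\<delta> = "inv_into (universe C) \<gamma>"
  have inv: "is_iso L C' C ?\<delta>" using iso by (rule iso_inverse)
  have bij: "bij_betw \<gamma> (universe C) (universe C')" using iso by (simp add: is_iso_def)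
  have "(\<lambda>D. f (\<gamma> ` D)) ` copies L C A \<subseteq> {..<k}" using f copies_image[OF iso(1)] by blast
  then obtain B' c where B': "B' \<in> copies L C B" and c: "\<forall>D\<in>copies L (restrict C B') A. f (\<gamma> ` D) = c"
    using ar[unfolded arrow_def, rule_format, of "\<lambda>D. f (\<gamma> ` D)"] by blast
  have sub: "B' \<subseteq> universe C" "\<gamma> ` B' \<subseteq> universe C'"
    using B' bij by (auto simp: copies_def substructure_def bij_betw_def)
  have "f D = c" if "D \<in> copies L (restrict C' (\<gamma> ` B')) A" for D
  proof -
    have D: "D \<in> copies L C' A" "D \<subseteq> \<gamma> ` B'" using that by (simp_all add: copies_restrict[OF sub(2)])
    have "?\<delta> ` D \<subseteq> ?\<delta> ` \<gamma> ` B'" using D(2) by (rule image_mono)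
    also have "?\<delta> ` \<gamma> ` B' = B'" using sub(1) bij by (intro inv_into_image_cancel) (auto simp: bij_betw_def)
    finally have "?\<delta> ` D \<in> copies L (restrict C B') A"
      using copies_image[OF inv D(1)] by (simp add: copies_restrict[OF sub(1)])
    then have "f (\<gamma> ` ?\<delta> ` D) = c" using c by blast
    moreover have "D \<subseteq> universe C'" using D(2) sub(2) by blast
    then have "\<gamma> ` ?\<delta> ` D = D" using bij by (intro image_inv_into_cancel) (auto simp: bij_betw_def)
    ultimately show ?thesis by simp
  qed
  then show "\<exists>B'\<in>copies L C' B. \<exists>c. \<forall>A'\<in>copies L (restrict C' B') A. f A' = c"
    using copies_image[OF iso(1) B'] by blast
qed

lemma restrict_in_age:
  assumes "locally_finite L M" "substructure L M S" "finite S"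
  shows "restrict M S \<in> age L M"
proof -
  have "is_iso L (restrict M S) (restrict M S) (\<lambda>x. x)" by (auto simp: is_iso_def bij_betw_def)
  then show ?thesis
    using assms fin_gen_substructure_iff[OF assms(1)] substructureD(2)[OF assms(2)]
    by (auto simp: age_def isomorphic_def)
qed

lemma ageE:
  assumes "locally_finite L M" "A \<in> age L M"
  obtains S where "is_struct L A" "substructure L M S" "finite S" "isomorphic L A (restrict M S)"
  using assms fin_gen_substructure_iff[OF assms(1)] by (auto simp: age_def)

text \<open>Consider the least moved point \<open>z\<close>. If \<open>h z\<close> is below
  \<open>z\<close>, it is fixed, against injectivity; if it is above, the preimage of
  \<open>z\<close> lies below \<open>z\<close> and is fixed, so it equals \<open>z\<close>.\<close>

lemma finite_linear_order_rigid:
  assumes fin: "finite A" and r: "trans r" "irrefl r" "total_on A r"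
    and h: "bij_betw h A A" "\<And>x y. x \<in> A \<Longrightarrow> y \<in> A \<Longrightarrow> (x, y) \<in> r \<longleftrightarrow> (h x, h y) \<in> r" and x: "x \<in> A"
  shows "h x = x"
proof (rule ccontr)
  assume "h x \<noteq> x"
  let ?s = "r \<inter> A \<times> A"
  have "trans ?s" using r(1) by (auto simp: trans_def)
  then have "acyclic ?s" using r(2) by (auto simp: acyclic_def irrefl_def)
  moreover have "finite ?s" using fin by (intro finite_Int) simp
  ultimately have "wf ?s" by (rule finite_acyclic_wf[rotated])
  then have wf: "\<forall>Q x. x \<in> Q \<longrightarrow> (\<exists>z\<in>Q. \<forall>y. (y, z) \<in> ?s \<longrightarrow> y \<notin> Q)" by (simp only: wf_eq_minimal)
  have "x \<in> {x \<in> A. h x \<noteq> x}" using x \<open>h x \<noteq> x\<close> by simp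
  from wf[rule_format, OF this] obtain z where "z \<in> {x \<in> A. h x \<noteq> x}"
    "\<forall>y. (y, z) \<in> ?s \<longrightarrow> y \<notin> {x \<in> A. h x \<noteq> x}" ..
  then have z: "z \<in> A" "h z \<noteq> z" and min: "\<And>y. (y, z) \<in> ?s \<Longrightarrow> y \<in> A \<Longrightarrow> h y = y" by auto
  have hA: "h y \<in> A" if "y \<in> A" for y using that h(1) by (auto simp: bij_betw_def)
  consider "(h z, z) \<in> r" | "(z, h z) \<in> r" using r(3) z hA[OF z(1)] by (auto simp: total_on_def)
  then show False
  proof cases
    case 1
    then have "h (h z) = h z" using min[of "h z"] hA z(1) by blast
    then show False using h(1) z hA by (auto simp: bij_betw_def dest: inj_onD)
  next
    case 2
    have "z \<in> h ` A" using h(1) z(1) by (simp add: bij_betw_def)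
    then obtain y where y: "y \<in> A" "h y = z" by blast
    then have "(y, z) \<in> r" using 2 h(2)[OF y(1) z(1)] by simp
    then have "h y = y" using min[of y] y(1) z(1) by blast
    then show False using y z by simp
  qed
qed

section \<open>Realising types in many variables\<close>

definition ex_fm :: "('f, 'r) fm \<Rightarrow> ('f, 'r) fm" where
  "ex_fm \<phi> = Neg (All (Neg \<phi>))"

definition conj_fm :: "('f, 'r) fm list \<Rightarrow> ('f, 'r) fm" where
  "conj_fm = (\<lambda>\<phi>s. foldr (\<lambda>\<phi> \<psi>. Neg (Imp \<phi> (Neg \<psi>))) \<phi>s (Neg Bot))"

lemma sat_conj_fm: "sat M e (conj_fm \<phi>s) \<longleftrightarrow> (\<forall>\<phi>\<in>set \<phi>s. sat M e \<phi>)"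
  by (induction \<phi>s) (auto simp: conj_fm_def)

lemma conj_fm_syntax: "fv (conj_fm \<phi>s) = \<Union> (fv ` set \<phi>s)" "wf_fm L (conj_fm \<phi>s) \<longleftrightarrow> (\<forall>\<phi>\<in>set \<phi>s. wf_fm L \<phi>)"
  by (induction \<phi>s) (auto simp: conj_fm_def)

lemma sat_ex_fm_iterate: "sat M e ((ex_fm ^^ k) \<phi>) \<longleftrightarrow>
    (\<exists>xs\<in>tuples M k. sat M (\<lambda>n. if n < k then xs ! n else e (n - k)) \<phi>)"
proof (induction k arbitrary: e)
  case 0
  then show ?case by (simp add: tuples_def)
next
  case (Suc k)
  have "sat M e ((ex_fm ^^ Suc k) \<phi>) \<longleftrightarrow> (\<exists>a\<in>universe M. \<exists>xs\<in>tuples M k.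
      sat M (\<lambda>n. if n < k then xs ! n else case_nat a e (n - k)) \<phi>)"
    by (simp add: ex_fm_def Suc)
  \<comment> \<open>The outermost of the \<open>Suc k\<close> quantifiers binds the index
    \<open>k\<close> of the matrix, so its witness goes to the end of the list.\<close>
  also have "\<dots> \<longleftrightarrow> (\<exists>a\<in>universe M. \<exists>xs\<in>tuples M k.
      sat M (\<lambda>n. if n < Suc k then (xs @ [a]) ! n else e (n - Suc k)) \<phi>)"
  proof -
    have "(\<lambda>n. if n < k then xs ! n else case_nat a e (n - k)) =
        (\<lambda>n. if n < Suc k then (xs @ [a]) ! n else e (n - Suc k))" if "xs \<in> tuples M k" for a xs
    proof
      fix n
      consider "n < k" | "n = k" | j where "n = k + Suc j" using less_imp_Suc_add[of k n] by fastforce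
      then show "(if n < k then xs ! n else case_nat a e (n - k)) =
          (if n < Suc k then (xs @ [a]) ! n else e (n - Suc k))"
        using that by cases (simp_all add: tuples_def nth_append)
    qed
    then show ?thesis by (metis (no_types, lifting))
  qed
  also have "\<dots> \<longleftrightarrow> (\<exists>xs\<in>tuples M (Suc k). sat M (\<lambda>n. if n < Suc k then xs ! n else e (n - Suc k)) \<phi>)"
  proof safe
    fix a xs assume "a \<in> universe M" "xs \<in> tuples M k"
      "sat M (\<lambda>n. if n < Suc k then (xs @ [a]) ! n else e (n - Suc k)) \<phi>"
    then show "\<exists>xs\<in>tuples M (Suc k). sat M (\<lambda>n. if n < Suc k then xs ! n else e (n - Suc k)) \<phi>"
      by (intro bexI[of _ "xs @ [a]"]) (auto simp: tuples_def)
  next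
    fix xs assume xs: "xs \<in> tuples M (Suc k)" "sat M (\<lambda>n. if n < Suc k then xs ! n else e (n - Suc k)) \<phi>"
    then have "xs \<noteq> []" by (auto simp: tuples_def)
    then obtain ys a where "xs = ys @ [a]" by (metis rev_exhaust)
    then show "\<exists>a\<in>universe M. \<exists>xs\<in>tuples M k.
        sat M (\<lambda>n. if n < Suc k then (xs @ [a]) ! n else e (n - Suc k)) \<phi>"
      using xs by (intro bexI[of _ a] bexI[of _ ys]) (auto simp: tuples_def)
  qed
  finally show ?case .
qed

lemma ex_fm_iterate_syntax: "fv ((ex_fm ^^ k) \<phi>) = {n. n + k \<in> fv \<phi>}" "wf_fm L ((ex_fm ^^ k) \<phi>) = wf_fm L \<phi>"
proof -
  show "fv ((ex_fm ^^ k) \<phi>) = {n. n + k \<in> fv \<phi>}" by (induction k) (auto simp: ex_fm_def)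
  show "wf_fm L ((ex_fm ^^ k) \<phi>) = wf_fm L \<phi>" by (induction k) (auto simp: ex_fm_def)
qed

text \<open>A constraint \<open>(\<phi>, s)\<close> asks that \<open>\<phi>\<close> hold of the variables \<open>s 0, s 1, \<dots>\<close>; the index type of
  the variables is arbitrary. Finitely many constraints on the variable \<open>x\<close>, with the variables in \<open>J\<close>
  as parameters and all others quantified away, amount to one formula.\<close>

lemma conj_constraints_formula:
  fixes \<Sigma> :: "(('f, 'r) fm \<times> (nat \<Rightarrow> 'v)) set" and M :: "('f, 'r, 'm) struct"
  assumes fin: "finite \<Sigma>" and wf: "\<And>\<phi> s. (\<phi>, s) \<in> \<Sigma> \<Longrightarrow> wf_fm L \<phi>"
    and e: "\<And>v. e v \<in> universe M"
  shows "\<exists>\<chi> js. \<chi> \<in> formulas L (Suc (length js)) \<and> set js \<subseteq> J - {x} \<and>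
    (\<forall>c\<in>universe M. holds M \<chi> (c # map e js) \<longleftrightarrow>
       (\<exists>e'. (\<forall>v. e' v \<in> universe M) \<and> (\<forall>v\<in>J - {x}. e' v = e v) \<and> e' x = c \<and>
          (\<forall>(\<phi>, s)\<in>\<Sigma>. sat M (\<lambda>n. e' (s n)) \<phi>)))"
proof -
  define V where "V = (\<Union>(\<phi>, s)\<in>\<Sigma>. s ` fv \<phi>)"
  have V: "s ` fv \<phi> \<subseteq> V" if "(\<phi>, s) \<in> \<Sigma>" for \<phi> s using that by (auto simp: V_def)
  have finV: "finite V" unfolding V_def using fin finite_fv by auto
  obtain js where js: "set js = V \<inter> J - {x}" "distinct js"
    using finite_distinct_list[of "V \<inter> J - {x}"] finV by auto
  obtain ks where ks: "set ks = V - J - {x}" "distinct ks"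
    using finite_distinct_list[of "V - J - {x}"] finV by auto
  \<comment> \<open>The order of the de Bruijn indices: first the variables to be quantified away,
    then \<open>x\<close>, which becomes index 0 once they are bound, then the parameters.\<close>
  define W where "W = ks @ x # js"
  have W: "set W = insert x V" "distinct W" using js ks by (auto simp: W_def)
  have "\<forall>v\<in>set W. \<exists>n. n < length W \<and> W ! n = v" by (simp add: in_set_conv_nth)
  then obtain i where i: "\<And>v. v \<in> set W \<Longrightarrow> i v < length W \<and> W ! i v = v" by metis
  obtain \<Sigma>s where \<Sigma>s: "set \<Sigma>s = \<Sigma>" using finite_list[OF fin] by blast
  define \<chi> where "\<chi> = (ex_fm ^^ length ks) (conj_fm (map (\<lambda>(\<phi>, s). rename (\<lambda>n. i (s n)) \<phi>) \<Sigma>s))"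
  have iW: "i (s n) < length W \<and> W ! i (s n) = s n" if "(\<phi>, s) \<in> \<Sigma>" "n \<in> fv \<phi>" for \<phi> s n
    using i[of "s n"] V[OF that(1)] that(2) W(1) by auto
  have "\<chi> \<in> formulas L (Suc (length js))"
  proof -
    have "fv (rename (\<lambda>n. i (s n)) \<phi>) \<subseteq> {..<length W}" if "(\<phi>, s) \<in> \<Sigma>" for \<phi> s
      using iW[OF that] by (auto simp: fv_rename)
    then have "fv (conj_fm (map (\<lambda>(\<phi>, s). rename (\<lambda>n. i (s n)) \<phi>) \<Sigma>s)) \<subseteq> {..<length W}"
      by (auto simp: conj_fm_syntax \<Sigma>s)
    then have "fv \<chi> \<subseteq> {..<Suc (length js)}"
      by (auto simp: \<chi>_def ex_fm_iterate_syntax W_def)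
    moreover have "wf_fm L \<chi>"
      using wf by (auto simp: \<chi>_def ex_fm_iterate_syntax conj_fm_syntax \<Sigma>s wf_rename)
    ultimately show ?thesis by (simp add: formulas_def)
  qed
  moreover have "holds M \<chi> (c # map e js) \<longleftrightarrow>
       (\<exists>e'. (\<forall>v. e' v \<in> universe M) \<and> (\<forall>v\<in>J - {x}. e' v = e v) \<and> e' x = c \<and>
          (\<forall>(\<phi>, s)\<in>\<Sigma>. sat M (\<lambda>n. e' (s n)) \<phi>))" (is "_ \<longleftrightarrow> ?R") if c: "c \<in> universe M" for c
  proof -
    have 1: "holds M \<chi> (c # map e js) \<longleftrightarrow> (\<exists>xs\<in>tuples M (length ks).
        \<forall>(\<phi>, s)\<in>\<Sigma>. sat M (\<lambda>n. (xs @ c # map e js) ! i (s n)) \<phi>)"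
    proof -
      have "(\<lambda>n. if n < length ks then xs ! n else (c # map e js) ! (n - length ks)) =
          (\<lambda>n. (xs @ c # map e js) ! n)" if "xs \<in> tuples M (length ks)" for xs
        using that by (intro ext) (simp add: tuples_def nth_append)
      then show ?thesis
        unfolding holds_def \<chi>_def sat_ex_fm_iterate
        by (simp add: sat_conj_fm \<Sigma>s sat_rename split_beta cong: bex_cong)
    qed
    show ?thesis
    proof
      assume "holds M \<chi> (c # map e js)"
      then obtain xs where xs: "set xs \<subseteq> universe M" "length xs = length ks"
        and sat: "\<forall>(\<phi>, s)\<in>\<Sigma>. sat M (\<lambda>n. (xs @ c # map e js) ! i (s n)) \<phi>"
        unfolding 1 by (auto simp: tuples_def)
      define E where "E = xs @ c # map e js"
      have E: "length E = length W" "set E \<subseteq> universe M" using xs c e by (auto simp: E_def W_def)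
      \<comment> \<open>Keeping \<open>e\<close> outside \<open>W\<close> gives agreement with
        \<open>e\<close> also on those variables of \<open>J\<close> that no constraint
        mentions.\<close>
      define e' where "e' v = (if v \<in> set W then E ! i v else e v)" for v
      have eW: "e' (W ! n) = E ! n" if "n < length W" for n
      proof -
        have "i (W ! n) = n" using i[of "W ! n"] that W(2) nth_eq_iff_index_eq by auto
        then show ?thesis using that by (simp add: e'_def)
      qed
      have "e' v \<in> universe M" for v
        using i[of v] E e by (auto simp: e'_def)
      moreover have "e' x = c"
        using eW[of "length ks"] xs(2) by (simp add: W_def E_def nth_append)
      moreover have "e' v = e v" if "v \<in> J - {x}" for v
      proof (cases "v \<in> V")
        case True
        then have "v \<in> set js" using that js(1) by blast
        then obtain n where n: "n < length js" "v = js ! n" by (auto simp: in_set_conv_nth)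
        then show ?thesis using eW[of "Suc (length ks + n)"] xs(2) by (simp add: W_def E_def nth_append)
      next
        case False
        then show ?thesis using that W(1) by (simp add: e'_def)
      qed
      moreover have "sat M (\<lambda>n. e' (s n)) \<phi>" if "(\<phi>, s) \<in> \<Sigma>" for \<phi> s
      proof -
        have "sat M (\<lambda>n. E ! i (s n)) \<phi>" using sat that by (auto simp: E_def)
        moreover have "e' (s n) = E ! i (s n)" if "n \<in> fv \<phi>" for n
          using V[OF \<open>(\<phi>, s) \<in> \<Sigma>\<close>] that W(1) by (auto simp: e'_def)
        ultimately show ?thesis using sat_cong[of \<phi> "\<lambda>n. e' (s n)" "\<lambda>n. E ! i (s n)" M] by simp
      qed
      ultimately show ?R by (intro exI[of _ e']) auto
    next
      assume ?R
      then obtain e' where e': "\<forall>v. e' v \<in> universe M" "\<forall>v\<in>J - {x}. e' v = e v" "e' x = c"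
        and sat: "\<forall>(\<phi>, s)\<in>\<Sigma>. sat M (\<lambda>n. e' (s n)) \<phi>" by blast
      have "map e js = map e' js" using e'(2) js(1) by auto
      then have W': "map e' ks @ c # map e js = map e' W" using e'(3) by (simp add: W_def)
      have "sat M (\<lambda>n. map e' W ! i (s n)) \<phi>" if "(\<phi>, s) \<in> \<Sigma>" for \<phi> s
      proof -
        have "map e' W ! i (s n) = e' (s n)" if "n \<in> fv \<phi>" for n
          using iW[OF \<open>(\<phi>, s) \<in> \<Sigma>\<close> that] by simp
        then have "sat M (\<lambda>n. map e' W ! i (s n)) \<phi> = sat M (\<lambda>n. e' (s n)) \<phi>" by (rule sat_cong)
        then show ?thesis using sat that by auto
      qed
      moreover have "map e' ks \<in> tuples M (length ks)" using e'(1) by (auto simp: tuples_def)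
      ultimately show "holds M \<chi> (c # map e js)" unfolding 1 using W'
        by (intro bexI[of _ "map e' ks"]) auto
    qed
  qed
  moreover have "set js \<subseteq> J - {x}" using js(1) by blast
  ultimately show ?thesis by blast
qed

text \<open>By Zorn, take a maximal partial assignment \<open>p\<close> that for each finite set of
  constraints extends to a solution. If \<open>x\<close> had no value, the conditions on
  \<open>x\<close>, one formula over the values of \<open>p\<close> for each finite set, would form
  a finitely satisfiable type over fewer than \<open>\<kappa>\<close> parameters; a realisation
  would extend \<open>p\<close>.\<close>

theorem saturated_realizes:
  fixes \<Sigma> :: "(('f, 'r) fm \<times> (nat \<Rightarrow> 'v)) set" and M :: "('f, 'r, 'm) struct"
  assumes sat: "saturated \<kappa> L M" and V: "|V :: 'v set| <o \<kappa>" and M: "is_struct L M"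
    and wf: "\<And>\<phi> s. (\<phi>, s) \<in> \<Sigma> \<Longrightarrow> wf_fm L \<phi> \<and> s ` fv \<phi> \<subseteq> V"
    and fs: "\<And>\<Sigma>0. finite \<Sigma>0 \<Longrightarrow> \<Sigma>0 \<subseteq> \<Sigma> \<Longrightarrow>
      \<exists>e. (\<forall>v. e v \<in> universe M) \<and> (\<forall>(\<phi>, s)\<in>\<Sigma>0. sat M (\<lambda>n. e (s n)) \<phi>)"
  obtains e where "\<And>v. e v \<in> universe M" "\<And>\<phi> s. (\<phi>, s) \<in> \<Sigma> \<Longrightarrow> sat M (\<lambda>n. e (s n)) \<phi>"
proof -
  define sol where "sol p \<Sigma>0 e \<longleftrightarrow> (\<forall>v. e v \<in> universe M) \<and> (\<forall>(v, a)\<in>p. e v = a) \<and>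
    (\<forall>(\<phi>, s)\<in>\<Sigma>0. sat M (\<lambda>n. e (s n)) \<phi>)" for p and \<Sigma>0 :: "(('f, 'r) fm \<times> (nat \<Rightarrow> 'v)) set" and e
  define ok where "ok p \<longleftrightarrow> (\<forall>\<Sigma>0. finite \<Sigma>0 \<and> \<Sigma>0 \<subseteq> \<Sigma> \<longrightarrow> (\<exists>e. sol p \<Sigma>0 e))" for p
  have sv: "a = b" if "ok p" "(v, a) \<in> p" "(v, b) \<in> p" for p v a b
  proof -
    obtain e where "sol p {} e" using \<open>ok p\<close> by (auto simp: ok_def)
    then have "e v = a" "e v = b" using that(2,3) by (auto simp: sol_def)
    then show ?thesis by simp
  qed
  let ?A = "{p. p \<subseteq> V \<times> UNIV \<and> ok p}"
  have "\<exists>p\<in>?A. \<forall>q\<in>?A. p \<subseteq> q \<longrightarrow> q = p"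
  proof (rule subset_Zorn_nonempty)
    have "ok {}" using fs by (auto simp: ok_def sol_def)
    then show "?A \<noteq> {}" by blast
    fix C assume C: "C \<noteq> {}" "subset.chain ?A C"
    then have CA: "C \<subseteq> ?A" by (simp add: subset_chain_def)
    have svC: "a = b" if ab: "(v, a) \<in> \<Union> C" "(v, b) \<in> \<Union> C" for v a b
    proof -
      have "finite {(v, a), (v, b)}" "{(v, a), (v, b)} \<subseteq> \<Union> C" using ab by auto
      then obtain p where p: "p \<in> C" "{(v, a), (v, b)} \<subseteq> p" using finite_subset_Union_chain[OF _ _ C] by metis
      then have "ok p" using CA by blast
      then show ?thesis using sv[of p v a b] p(2) by simp
    qed
    have "\<exists>e. sol (\<Union> C) \<Sigma>0 e" if \<Sigma>0: "finite \<Sigma>0" "\<Sigma>0 \<subseteq> \<Sigma>" for \<Sigma>0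
    proof -
      \<comment> \<open>The constraints see finitely many variables, so the relevant part
        \<open>F\<close> of the union lies in one member of the chain. Its solution is kept on the
        variables seen and overwritten by the union elsewhere.\<close>
      define X where "X = (\<Union>(\<phi>, s)\<in>\<Sigma>0. s ` fv \<phi>)"
      have "finite X" unfolding X_def using \<Sigma>0(1) finite_fv by auto
      define F where "F = {va \<in> \<Union> C. fst va \<in> X}"
      have "inj_on fst F" using svC by (auto simp: F_def inj_on_def)
      moreover have "fst ` F \<subseteq> X" by (auto simp: F_def)
      ultimately have "finite F" using \<open>finite X\<close> by (meson finite_imageD finite_subset)
      moreover have "F \<subseteq> \<Union> C" by (auto simp: F_def)
      ultimately obtain p where p: "p \<in> C" "F \<subseteq> p" using finite_subset_Union_chain[OF _ _ C] by metis
      then have "ok p" using CA by blast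
      then obtain e where e: "sol p \<Sigma>0 e" using \<Sigma>0 by (auto simp: ok_def)
      define e' where "e' v = (if \<exists>a. (v, a) \<in> \<Union> C then SOME a. (v, a) \<in> \<Union> C else e v)" for v
      have e'C: "e' v = a" if "(v, a) \<in> \<Union> C" for v a
      proof -
        have "(v, SOME a. (v, a) \<in> \<Union> C) \<in> \<Union> C" using that by (rule someI)
        then show ?thesis using svC that by (auto simp: e'_def)
      qed
      have "e' v \<in> universe M" for v
      proof (cases "\<exists>a. (v, a) \<in> \<Union> C")
        case True
        then obtain a q where a: "(v, a) \<in> q" "q \<in> C" by blast
        then have "ok q" using CA by blast
        then obtain e1 where "sol q {} e1" by (auto simp: ok_def)
        then have "a \<in> universe M" using a(1) by (auto simp: sol_def)
        then show ?thesis using e'C[of v a] a by blast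
      next
        case False
        then show ?thesis using e by (simp add: e'_def sol_def)
      qed
      moreover have "sat M (\<lambda>n. e' (s n)) \<phi>" if s: "(\<phi>, s) \<in> \<Sigma>0" for \<phi> s
      proof -
        have "e' (s n) = e (s n)" if n: "n \<in> fv \<phi>" for n
        proof (cases "\<exists>a. (s n, a) \<in> \<Union> C")
          case True
          then obtain a where a: "(s n, a) \<in> \<Union> C" by blast
          moreover have "s n \<in> X" using s n by (auto simp: X_def)
          ultimately have "(s n, a) \<in> p" using p(2) by (auto simp: F_def)
          then have "e (s n) = a" using e by (auto simp: sol_def)
          then show ?thesis using e'C[OF a] by simp
        qed (simp add: e'_def)
        then have "sat M (\<lambda>n. e' (s n)) \<phi> = sat M (\<lambda>n. e (s n)) \<phi>" by (rule sat_cong)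
        then show ?thesis using e s by (auto simp: sol_def)
      qed
      moreover have "\<forall>(v, a)\<in>\<Union> C. e' v = a" using e'C by blast
      ultimately show ?thesis unfolding sol_def by (intro exI[of _ e']) blast
    qed
    then have "ok (\<Union> C)" by (simp add: ok_def)
    moreover have "\<Union> C \<subseteq> V \<times> UNIV" using CA by blast
    ultimately show "\<Union> C \<in> ?A" by simp
  qed
  then obtain p where "p \<in> ?A" and max': "\<forall>q\<in>?A. p \<subseteq> q \<longrightarrow> q = p" by (rule bexE)
  then have p: "p \<subseteq> V \<times> UNIV" "ok p" by simp_all
  obtain e0 where e0: "sol p {} e0" using p(2) by (auto simp: ok_def)
  then have e0U: "e0 v \<in> universe M" and e0p: "(v, a) \<in> p \<Longrightarrow> e0 v = a" for v a by (auto simp: sol_def)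
  have dom: "x \<in> Domain p" if x: "x \<in> V" for x
  proof (rule ccontr)
    assume nx: "x \<notin> Domain p"
    define G where "G \<Sigma>0 c \<longleftrightarrow> (\<exists>e. sol p \<Sigma>0 e \<and> e x = c)" for \<Sigma>0 c
    \<comment> \<open>The type of \<open>x\<close>: all formulas over the values of \<open>p\<close>
      saying that some finite set of constraints has a solution that extends \<open>p\<close> and
      takes the given value at \<open>x\<close>.\<close>
    define P where "P = {(\<chi>, as). \<chi> \<in> formulas L (Suc (length as)) \<and> set as \<subseteq> Range p \<and>
      (\<exists>\<Sigma>0. finite \<Sigma>0 \<and> \<Sigma>0 \<subseteq> \<Sigma> \<and> (\<forall>c\<in>universe M. holds M \<chi> (c # as) \<longleftrightarrow> G \<Sigma>0 c))}"
    have formula: "\<exists>\<chi> as. (\<chi>, as) \<in> P \<and> (\<forall>c\<in>universe M. holds M \<chi> (c # as) \<longleftrightarrow> G \<Sigma>0 c)"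
      if \<Sigma>0: "finite \<Sigma>0" "\<Sigma>0 \<subseteq> \<Sigma>" for \<Sigma>0
    proof -
      obtain \<chi> js where \<chi>: "\<chi> \<in> formulas L (Suc (length js))" "set js \<subseteq> Domain p - {x}"
        and h: "\<forall>c\<in>universe M. holds M \<chi> (c # map e0 js) \<longleftrightarrow>
          (\<exists>e'. (\<forall>v. e' v \<in> universe M) \<and> (\<forall>v\<in>Domain p - {x}. e' v = e0 v) \<and> e' x = c \<and>
          (\<forall>(\<phi>, s)\<in>\<Sigma>0. sat M (\<lambda>n. e' (s n)) \<phi>))"
        using conj_constraints_formula[OF \<Sigma>0(1), of L e0 M "Domain p" x] wf \<Sigma>0(2) e0U by blast
      have "(\<forall>v\<in>Domain p - {x}. e' v = e0 v) \<longleftrightarrow> (\<forall>(v, a)\<in>p. e' v = a)" for e'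
      proof -
        have "Domain p - {x} = Domain p" using nx by blast
        moreover have "e0 v = a" if "(v, a) \<in> p" for v a using that by (rule e0p)
        ultimately show ?thesis by (auto simp: Ball_def Domain_iff split_beta)
      qed
      then have h': "\<forall>c\<in>universe M. holds M \<chi> (c # map e0 js) \<longleftrightarrow> G \<Sigma>0 c"
        using h unfolding G_def sol_def by (simp add: conj_ac)
      have "e0 v \<in> Range p" if "v \<in> Domain p" for v using that e0p by blast
      then have "e0 ` Domain p \<subseteq> Range p" by blast
      moreover have "set (map e0 js) \<subseteq> e0 ` Domain p" using \<chi>(2) by auto
      ultimately have "set (map e0 js) \<subseteq> Range p" by (rule subset_trans[rotated])
      then show ?thesis using \<chi>(1) h' \<Sigma>0 by (intro exI[of _ \<chi>] exI[of _ "map e0 js"]) (auto simp: P_def)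
    qed
    have fin: "\<exists>c\<in>universe M. \<forall>(\<chi>, as)\<in>P0. holds M \<chi> (c # as)" if P0: "P0 \<subseteq> P" "finite P0" for P0
    proof -
      have "\<forall>pr\<in>P0. \<exists>\<Sigma>0. finite \<Sigma>0 \<and> \<Sigma>0 \<subseteq> \<Sigma> \<and>
          (\<forall>c\<in>universe M. holds M (fst pr) (c # snd pr) \<longleftrightarrow> G \<Sigma>0 c)"
        using P0(1) by (auto simp: P_def split_beta)
      then obtain S where S: "\<And>pr. pr \<in> P0 \<Longrightarrow> finite (S pr) \<and> S pr \<subseteq> \<Sigma> \<and>
          (\<forall>c\<in>universe M. holds M (fst pr) (c # snd pr) \<longleftrightarrow> G (S pr) c)" by metis
      have "finite (\<Union> (S ` P0))" "\<Union> (S ` P0) \<subseteq> \<Sigma>" using S P0(2) by auto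
      \<comment> \<open>A solution for the union of the finite sets involved gives one value of
        \<open>x\<close> that serves all formulas in \<open>P0\<close>.\<close>
      then obtain e where e: "sol p (\<Union> (S ` P0)) e" using p(2) unfolding ok_def by blast
      then have "sol p (S pr) e" if "pr \<in> P0" for pr using that by (auto simp: sol_def)
      then have "G (S pr) (e x)" if "pr \<in> P0" for pr unfolding G_def using that by blast
      then have "holds M (fst pr) (e x # snd pr)" if "pr \<in> P0" for pr
        using S[OF that] e that by (auto simp: sol_def)
      then show ?thesis using e by (intro bexI[of _ "e x"]) (auto simp: sol_def split_beta)
    qed
    have "|Range p| <o \<kappa>"
    proof -
      have "Range p \<subseteq> e0 ` V" using e0p p(1) by force
      then have "|Range p| \<le>o |V|" by (rule surj_imp_ordLeq)
      then show ?thesis using V by (rule ordLeq_ordLess_trans)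
    qed
    moreover have "Range p \<subseteq> universe M" using e0p e0U by force
    moreover have "\<forall>(\<chi>, as)\<in>P. set as \<subseteq> Range p \<and> \<chi> \<in> formulas L (Suc (length as))" by (auto simp: P_def)
    ultimately have "\<exists>c\<in>universe M. \<forall>(\<chi>, as)\<in>P. holds M \<chi> (c # as)"
      using sat[unfolded saturated_def, rule_format, of "Range p" P] fin by blast
    then obtain c where c: "c \<in> universe M" "\<forall>(\<chi>, as)\<in>P. holds M \<chi> (c # as)" by (rule bexE)
    have "ok (insert (x, c) p)" unfolding ok_def
    proof (intro allI impI)
      fix \<Sigma>0 assume "finite \<Sigma>0 \<and> \<Sigma>0 \<subseteq> \<Sigma>"
      then obtain \<chi> as where "(\<chi>, as) \<in> P" "\<forall>c\<in>universe M. holds M \<chi> (c # as) \<longleftrightarrow> G \<Sigma>0 c"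
        using formula by blast
      then have "G \<Sigma>0 c" using c by blast
      then obtain e where "sol p \<Sigma>0 e" "e x = c" by (auto simp: G_def)
      then show "\<exists>e. sol (insert (x, c) p) \<Sigma>0 e" by (intro exI[of _ e]) (auto simp: sol_def)
    qed
    then have "insert (x, c) p \<in> ?A" using p(1) x by auto
    then have "insert (x, c) p = p" using max' by blast
    then show False using nx by blast
  qed
  have "sat M (\<lambda>n. e0 (s n)) \<phi>" if s: "(\<phi>, s) \<in> \<Sigma>" for \<phi> s
  proof -
    have "finite {(\<phi>, s)}" "{(\<phi>, s)} \<subseteq> \<Sigma>" using s by auto
    then obtain e where e: "sol p {(\<phi>, s)} e" using p(2) unfolding ok_def by blast
    have "e0 (s n) = e (s n)" if "n \<in> fv \<phi>" for n
    proof -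
      have "s n \<in> V" using wf[OF s] that by blast
      then obtain a where a: "(s n, a) \<in> p" using dom by blast
      then have "e (s n) = a" using e by (auto simp: sol_def)
      then show ?thesis using e0p[OF a] by simp
    qed
    then have "sat M (\<lambda>n. e0 (s n)) \<phi> = sat M (\<lambda>n. e (s n)) \<phi>" by (rule sat_cong)
    then show ?thesis using e by (simp add: sol_def)
  qed
  then show thesis using that e0U by blast
qed

section \<open>Ramsey classes have the modeling property\<close>

lemma embedding_substructure: "substructure L M S \<Longrightarrow> embedding L (restrict M S) M (\<lambda>x. x)"
  by (auto simp: embedding_def substructure_def)

lemma qftp_embedding_substructure:
  assumes "substructure L M S" "embedding L (restrict M S) N g" "set us \<subseteq> S"
  shows "qftp L N (map g us) = qftp L M us"
proof -
  have "qftp L N (map g us) = qftp L (restrict M S) us"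
    using assms substructureD(2) by (intro qftp_embedding) auto
  moreover have "qftp L M (map (\<lambda>x. x) us) = qftp L (restrict M S) us"
    using assms substructureD(2) embedding_substructure by (intro qftp_embedding) auto
  ultimately show ?thesis by simp
qed

text \<open>Equality of the types gives an automorphism of the common generated substructure
  carrying \<open>us\<close> to \<open>vs\<close>. That substructure is finite and linearly ordered,
  hence rigid.\<close>

lemma ordered_tuple_determined:
  assumes M: "is_struct L M" "locally_finite L M" "strict_linear_order_rel L M lt"
    and us: "set us \<subseteq> universe M" and len: "length us = length vs" and tp: "qftp L M us = qftp L M vs"
    and gen: "gen L M (set us) = gen L M (set vs)"
  shows "us = vs"
proof -
  let ?G = "gen L M (set us)" and ?r = "{(x, y). x \<in> universe M \<and> y \<in> universe M \<and> rl M lt [x, y]}"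
  obtain h where h: "is_iso L (restrict M ?G) (restrict M ?G) h" "map h us = vs"
    using qftp_eq_iso[OF len tp] gen by auto
  have G: "finite ?G" "?G \<subseteq> universe M" using finite_gen[OF M(1,2) us] gen_subset[OF M(1) us] by auto
  have lt: "lt \<in> Rels L" "rel_ar L lt = 2" "trans ?r" "irrefl ?r" "total_on (universe M) ?r"
    using M(3) by (auto simp: strict_linear_order_rel_def strict_linear_order_on_def)
  have hG: "bij_betw h ?G ?G" using h(1) by (simp add: is_iso_def)
  have "h x = x" if "x \<in> ?G" for x
  proof (rule finite_linear_order_rigid[OF G(1) lt(3,4) _ hG _ that])
    show "total_on ?G ?r" by (rule total_on_subset[OF lt(5) G(2)])
    fix x y assume xy: "x \<in> ?G" "y \<in> ?G"
    then have "rl M lt [x, y] \<longleftrightarrow> rl M lt (map h [x, y])"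
      using h(1) lt(1,2) by (auto simp: is_iso_def tuples_def)
    moreover have "h x \<in> ?G" "h y \<in> ?G" using xy hG by (auto simp: bij_betw_def)
    ultimately show "(x, y) \<in> ?r \<longleftrightarrow> (h x, h y) \<in> ?r" using xy G(2) by auto
  qed
  then have "map h us = us" using gen_base[of "set us" L M] by (intro map_idI) blast
  then show ?thesis using h(2) by simp
qed

text \<open>The colouring pulled back along \<open>h\<close> is constant on the tuples in
  \<open>S\<close> of the type of \<open>ws\<close>. The map is kept separate from \<open>Q\<close>
  so that colourings can be treated one after another.\<close>

definition homogenizes ::
  "('f, 'r) lang \<Rightarrow> ('f, 'r, 'a) struct \<Rightarrow> 'a set \<Rightarrow> ('a \<Rightarrow> 'a) \<Rightarrow> 'a list \<Rightarrow> ('a list \<Rightarrow> bool) \<Rightarrow> bool" where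
  "homogenizes L M S h ws Q \<longleftrightarrow> (\<forall>us vs. set us \<subseteq> S \<and> set vs \<subseteq> S \<and> length us = length ws \<and>
     length vs = length ws \<and> qftp L M us = qftp L M ws \<and> qftp L M vs = qftp L M ws \<longrightarrow>
     Q (map h us) = Q (map h vs))"

text \<open>One application of the Ramsey property: by \<open>ordered_tuple_determined\<close> a colouring of tuples of
  a fixed quantifier-free type is a colouring of copies of the structure they generate.\<close>

lemma ramsey_homogenizes:
  assumes M: "is_struct L M" "locally_finite L M" "strict_linear_order_rel L M lt"
    and ram: "ramsey_class L (age L M)"
    and S: "substructure L M S" "finite S" and ws: "set ws \<subseteq> universe M" "ws \<noteq> []"
  shows "\<exists>T. substructure L M T \<and> finite T \<and> (\<forall>h. \<exists>g. embedding L (restrict M S) (restrict M T) g \<and>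
    homogenizes L M S (h \<circ> g) ws Q)"
proof -
  let ?A = "restrict M (gen L M (set ws))"
  have subA: "substructure L M (gen L M (set ws))"
    using ws gen_base[of "set ws" L M] by (intro substructure_gen[OF M(1)]) auto
  moreover have "finite (gen L M (set ws))" using finite_gen[OF M(1,2) ws(1)] by simp
  ultimately have "?A \<in> age L M" by (rule restrict_in_age[OF M(2)])
  moreover have "restrict M S \<in> age L M" using restrict_in_age[OF M(2) S] .
  ultimately have "\<exists>C\<in>age L M. arrow L C (restrict M S) ?A 2"
    using ram unfolding ramsey_class_def by (meson one_le_numeral)
  then obtain C where C: "C \<in> age L M" "arrow L C (restrict M S) ?A 2" by blast
  obtain T where T: "is_struct L C" "substructure L M T" "finite T" "isomorphic L C (restrict M T)"
    using ageE[OF M(2) C(1)] .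
  then have ar: "arrow L (restrict M T) (restrict M S) ?A 2"
    using arrow_iso[OF _ T(1) C(2)] by (auto simp: isomorphic_def)
  have "\<exists>g. embedding L (restrict M S) (restrict M T) g \<and> homogenizes L M S (h \<circ> g) ws Q" for h
  proof -
    define tup where "tup us D \<longleftrightarrow> set us \<subseteq> universe M \<and> length us = length ws \<and>
      qftp L M us = qftp L M ws \<and> gen L M (set us) = D" for us D
    \<comment> \<open>A copy is coloured like the tuple of the type of \<open>ws\<close> generating
      it; there is at most one such tuple, so the choice does no harm.\<close>
    define f where "f D = (if Q (map h (SOME us. tup us D)) then 1 else 0 :: nat)" for D
    have f: "f D = (if Q (map h us) then 1 else 0)" if us: "tup us D" for us D
    proof -
      have "tup (SOME us. tup us D) D" using us by (rule someI)
      then have "(SOME us. tup us D) = us"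
        using us by (intro ordered_tuple_determined[OF M]) (auto simp: tup_def)
      then show ?thesis by (simp add: f_def)
    qed
    have "f ` copies L (restrict M T) ?A \<subseteq> {..<2}" by (auto simp: f_def)
    then obtain B' c where B': "B' \<in> copies L (restrict M T) (restrict M S)"
      and c: "\<forall>D\<in>copies L (restrict (restrict M T) B') ?A. f D = c"
      using ar unfolding arrow_def by blast
    have subB: "B' \<subseteq> T" "substructure L M B'"
      using B' substructure_restrict[OF substructureD(1)[OF T(2)]] by (auto simp: copies_def)
    have "isomorphic L (restrict M S) (restrict M B')"
      using B' isomorphic_sym substructureD(2)[OF subB(2)] by (auto simp: copies_def)
    then obtain g where g: "is_iso L (restrict M S) (restrict M B') g" by (auto simp: isomorphic_def)
    then have e: "embedding L (restrict M S) (restrict M B') g" by (simp add: is_iso_iff_embedding)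
    then have eM: "embedding L (restrict M S) M g" using embedding_inclusion[OF subB(2)] by blast
    have eT: "embedding L (restrict M S) (restrict M T) g" using e subB(1) by (auto simp: embedding_def)
    have col: "c = (if Q (map h (map g us)) then 1 else 0)"
      if us: "set us \<subseteq> S" "length us = length ws" "qftp L M us = qftp L M ws" for us
    proof -
      let ?D = "gen L M (set (map g us))"
      have gus: "set (map g us) \<subseteq> B'" using us(1) embeddingD(2)[OF e] by auto
      have q: "qftp L M (map g us) = qftp L M ws"
        using qftp_embedding_substructure[OF S(1) eM us(1)] us(3) by simp
      have "set (map g us) \<subseteq> universe M" using gus subB(2) by (auto dest: substructureD(1))
      then have t: "tup (map g us) ?D" unfolding tup_def using us(2) q by simp
      have "isomorphic L (restrict M ?D) ?A"
        using qftp_eq_iso[of "map g us" ws L M M] q us(2) by (auto simp: isomorphic_def)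
      moreover have "substructure L M ?D"
        using \<open>set (map g us) \<subseteq> universe M\<close> us(2) ws(2) gen_base[of "set (map g us)" L M]
        by (intro substructure_gen[OF M(1)]) auto
      moreover have "?D \<subseteq> B'" by (rule gen_least[OF subB(2) gus])
      ultimately have "?D \<in> copies L (restrict (restrict M T) B') ?A"
        using copies_restrict[OF substructureD(1)[OF subB(2)]] by (auto simp: copies_def)
      then have "f ?D = c" using c by blast
      then show ?thesis using f[OF t] by simp
    qed
    have "homogenizes L M S (h \<circ> g) ws Q"
      unfolding homogenizes_def
    proof (intro allI impI, elim conjE)
      fix us vs assume a: "set us \<subseteq> S" "length us = length ws" "qftp L M us = qftp L M ws"
        and b: "set vs \<subseteq> S" "length vs = length ws" "qftp L M vs = qftp L M ws"
      show "Q (map (h \<circ> g) us) = Q (map (h \<circ> g) vs)"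
      proof -
        have "Q (map h (map g us)) = Q (map h (map g vs))"
          using trans[OF col[OF a, symmetric] col[OF b]]
          by (cases "Q (map h (map g us))"; cases "Q (map h (map g vs))") (simp_all only: if_True if_False zero_neq_one one_neq_zero)
        then show ?thesis by simp
      qed
    qed
    then show ?thesis using eT by blast
  qed
  then show ?thesis using T(2,3) by blast
qed

text \<open>The host \<open>T\<close> for one colouring does not depend on the map \<open>h\<close>
  out of it. So the remaining colourings are first homogenised on \<open>T\<close>, and a copy of
  \<open>S\<close> inside \<open>T\<close> is chosen last; embeddings preserve quantifier-free
  types, so the earlier success survives composition.\<close>

lemma ramsey_homogenizes_finite:
  assumes M: "is_struct L M" "locally_finite L M" "strict_linear_order_rel L M lt"
    and ram: "ramsey_class L (age L M)"
    and D: "finite D" "\<And>ws Q. (ws, Q) \<in> D \<Longrightarrow> set ws \<subseteq> universe M"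
    and S: "substructure L M S" "finite S"
  shows "\<exists>h. embedding L (restrict M S) M h \<and> (\<forall>(ws, Q)\<in>D. homogenizes L M S h ws Q)"
  using D S
proof (induction D arbitrary: S rule: finite_induct)
  case empty
  then show ?case using embedding_substructure by blast
next
  case (insert d D)
  obtain ws Q where d: "d = (ws, Q)" by (cases d)
  show ?case
  \<comment> \<open>The empty tuple may generate nothing, hence no member of the age; but there is
    only one tuple of length 0.\<close>
  proof (cases "ws = []")
    case True
    obtain h where h: "embedding L (restrict M S) M h" "\<forall>(ws, Q)\<in>D. homogenizes L M S h ws Q"
      using insert.IH[of S] insert.prems by blast
    have "homogenizes L M S h [] Q" by (auto simp: homogenizes_def)
    then show ?thesis using h d True by (intro exI[of _ h]) auto
  next
    case False
    obtain T where T: "substructure L M T" "finite T" and TQ: "\<And>h. \<exists>g.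
        embedding L (restrict M S) (restrict M T) g \<and> homogenizes L M S (h \<circ> g) ws Q"
      using ramsey_homogenizes[OF M ram insert.prems(2,3) _ False, of Q] insert.prems(1) d by blast
    obtain h where h: "embedding L (restrict M T) M h" "\<forall>(ws, Q)\<in>D. homogenizes L M T h ws Q"
      using insert.IH[OF _ T] insert.prems(1) by blast
    obtain g where g: "embedding L (restrict M S) (restrict M T) g" "homogenizes L M S (h \<circ> g) ws Q"
      using TQ by blast
    define k where "k = h \<circ> g"
    have gT: "g ` S \<subseteq> T" using embeddingD(2)[OF g(1)] by simp
    have gM: "embedding L (restrict M S) M g" using embedding_inclusion[OF T(1) g(1)] .
    have "homogenizes L M S k ws' Q'" if "(ws', Q') \<in> D" for ws' Q'
      unfolding homogenizes_def
    proof (intro allI impI)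
      fix us vs assume a: "set us \<subseteq> S \<and> set vs \<subseteq> S \<and> length us = length ws' \<and>
        length vs = length ws' \<and> qftp L M us = qftp L M ws' \<and> qftp L M vs = qftp L M ws'"
      have "qftp L M (map g us) = qftp L M us" "qftp L M (map g vs) = qftp L M vs"
        using a qftp_embedding_substructure[OF insert.prems(2) gM, of us]
          qftp_embedding_substructure[OF insert.prems(2) gM, of vs] by blast+
      moreover have "set (map g us) \<subseteq> T" "set (map g vs) \<subseteq> T" using a gT by auto
      moreover have "homogenizes L M T h ws' Q'" using h(2) that by auto
      ultimately have "Q' (map h (map g us)) = Q' (map h (map g vs))"
        using a unfolding homogenizes_def by (metis length_map)
      then show "Q' (map k us) = Q' (map k vs)" by (simp add: k_def)
    qed
    then show ?thesis using embedding_comp[OF g(1) h(1), folded k_def] g(2)[folded k_def] d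
      by (intro exI[of _ k]) auto
  qed
qed

lemma concat_uniform:
  assumes "\<And>x. x \<in> set xs \<Longrightarrow> length (f x) = m"
  shows "length (concat (map f xs)) = length xs * m"
    "n < length xs * m \<Longrightarrow> concat (map f xs) ! n = f (xs ! (n div m)) ! (n mod m)"
proof -
  show "length (concat (map f xs)) = length xs * m" using assms by (induction xs) auto
  show "n < length xs * m \<Longrightarrow> concat (map f xs) ! n = f (xs ! (n div m)) ! (n mod m)"
    using assms
  proof (induction xs arbitrary: n)
    case (Cons x xs)
    then have m: "m > 0" by (cases m) auto
    show ?case
    proof (cases "n < m")
      case True
      then show ?thesis using Cons.prems by (simp add: nth_append)
    next
      case False
      then obtain j where j: "n = m + j" using le_Suc_ex by (metis not_less)
      then have "concat (map f xs) ! j = f (xs ! (j div m)) ! (j mod m)"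
        using Cons.prems by (intro Cons.IH) auto
      then show ?thesis using Cons.prems(2) j m by (simp add: nth_append div_add_self1)
    qed
  qed simp
qed

lemma div_mod_index:
  assumes "n < k * (m :: nat)"
  shows "n div m < k" "n mod m < m"
proof -
  have "m > 0" using assms by (cases m) auto
  then show "n div m < k" "n mod m < m" using assms by (simp_all add: less_mult_imp_div_less)
qed

lemma holds_concat:
  assumes "\<And>x. x \<in> set xs \<Longrightarrow> length (f x) = m" "\<phi> \<in> formulas L (length xs * m)"
  shows "holds M \<phi> (concat (map f xs)) = sat M (\<lambda>n. f (xs ! (n div m)) ! (n mod m)) \<phi>"
  unfolding holds_def
proof (rule sat_cong)
  fix n assume "n \<in> fv \<phi>"
  then have "n < length xs * m" using assms(2) by (auto simp: formulas_def)
  then show "concat (map f xs) ! n = f (xs ! (n div m)) ! (n mod m)"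
    using assms(1) by (intro concat_uniform(2))
qed

text \<open>The variable \<open>(i, l)\<close> stands for coordinate \<open>l\<close> of the tuple
  at index \<open>i\<close>; position \<open>n\<close> of a concatenation of \<open>m\<close>-tuples
  falls into block \<open>n div m\<close>.\<close>

definition tuple_var :: "nat \<Rightarrow> 'i list \<Rightarrow> nat \<Rightarrow> 'i \<times> nat" where
  "tuple_var m is n = (is ! (n div m), n mod m)"

text \<open>The Ehrenfeucht-Mostowski type of \<open>a\<close>: realising it makes a family locally based on \<open>a\<close>.\<close>

definition em_constraints where
  "em_constraints L' I L M m a = {(\<phi>, tuple_var m ts) | \<phi> ts. set ts \<subseteq> universe I \<and>
     \<phi> \<in> formulas L (length ts * m) \<and>
     (\<forall>ss. set ss \<subseteq> universe I \<and> length ss = length ts \<and> qftp L' I ss = qftp L' I ts \<longrightarrow>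
        holds M \<phi> (concat (map a ss)))}"

text \<open>A constraint has only one sequence of variables, so two tuples are interleaved.\<close>

definition shuffled_imp :: "('f, 'r) fm \<Rightarrow> ('f, 'r) fm" where
  "shuffled_imp \<phi> = Imp (rename (\<lambda>n. 2 * n) \<phi>) (rename (\<lambda>n. 2 * n + 1) \<phi>)"

definition shuffled_var :: "nat \<Rightarrow> 'i list \<Rightarrow> 'i list \<Rightarrow> nat \<Rightarrow> 'i \<times> nat" where
  "shuffled_var m is js n = (if even n then tuple_var m is (n div 2) else tuple_var m js (n div 2))"

text \<open>Even variables carry the tuple \<open>is\<close> and odd ones the tuple \<open>js\<close>; one implication suffices, as \<open>is\<close>
  and \<open>js\<close> may be exchanged.\<close>

definition indiscernibility_constraints where
  "indiscernibility_constraints L' I L m = {(shuffled_imp \<phi>, shuffled_var m is js) | \<phi> is js.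
     set is \<subseteq> universe I \<and> set js \<subseteq> universe I \<and> length is = length js \<and> qftp L' I is = qftp L' I js \<and>
     \<phi> \<in> formulas L (length is * m)}"

lemma sat_tuple_var:
  assumes "\<And>i. i \<in> set ts \<Longrightarrow> length (b i) = m \<and> (\<forall>l<m. e (i, l) = b i ! l)" "\<phi> \<in> formulas L (length ts * m)"
  shows "sat M (\<lambda>n. e (tuple_var m ts n)) \<phi> = holds M \<phi> (concat (map b ts))"
proof -
  have "sat M (\<lambda>n. e (tuple_var m ts n)) \<phi> = sat M (\<lambda>n. b (ts ! (n div m)) ! (n mod m)) \<phi>"
  proof (rule sat_cong)
    fix n assume "n \<in> fv \<phi>"
    then have "n < length ts * m" using assms(2) by (auto simp: formulas_def)
    from div_mod_index[OF this] show "e (tuple_var m ts n) = b (ts ! (n div m)) ! (n mod m)"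
      using assms(1) by (simp add: tuple_var_def)
  qed
  then show ?thesis using holds_concat[of ts b m \<phi> L M] assms by simp
qed

lemma sat_indiscernibility:
  "sat M (\<lambda>n. e (shuffled_var m is js n)) (shuffled_imp \<phi>) \<longleftrightarrow>
   (sat M (\<lambda>n. e (tuple_var m is n)) \<phi> \<longrightarrow> sat M (\<lambda>n. e (tuple_var m js n)) \<phi>)"
  by (simp add: shuffled_imp_def shuffled_var_def sat_rename)

lemma tuple_var_range:
  assumes "set ts \<subseteq> X" "n < length ts * m"
  shows "tuple_var m ts n \<in> X \<times> {..<m}"
  using div_mod_index[OF assms(2)] assms(1) by (auto simp: tuple_var_def)

lemma constraints_wf:
  assumes "(\<phi>, s) \<in> em_constraints L' I L M m a \<union> indiscernibility_constraints L' I L m"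
  shows "wf_fm L \<phi>" "s ` fv \<phi> \<subseteq> universe I \<times> {..<m}"
proof -
  have "wf_fm L \<phi> \<and> s ` fv \<phi> \<subseteq> universe I \<times> {..<m}"
    using assms
  proof
    assume "(\<phi>, s) \<in> em_constraints L' I L M m a"
    then obtain ts where "s = tuple_var m ts" "set ts \<subseteq> universe I" "\<phi> \<in> formulas L (length ts * m)"
      unfolding em_constraints_def by blast
    moreover from this have "tuple_var m ts n \<in> universe I \<times> {..<m}" if "n \<in> fv \<phi>" for n
      using that by (intro tuple_var_range) (auto simp: formulas_def)
    ultimately show ?thesis by (simp add: formulas_def image_subset_iff)
  next
    assume "(\<phi>, s) \<in> indiscernibility_constraints L' I L m"
    then obtain \<psi> "is" js where eq: "\<phi> = shuffled_imp \<psi>" "s = shuffled_var m is js"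
      and ij: "set is \<subseteq> universe I" "set js \<subseteq> universe I" "length is = length js"
      and \<psi>: "\<psi> \<in> formulas L (length is * m)"
      unfolding indiscernibility_constraints_def by blast
    have "n < length is * m" if "n \<in> fv \<psi>" for n using that \<psi> by (auto simp: formulas_def)
    then have "tuple_var m is n \<in> universe I \<times> {..<m}" "tuple_var m js n \<in> universe I \<times> {..<m}"
      if "n \<in> fv \<psi>" for n
      using that ij tuple_var_range by metis+
    then have "s n \<in> universe I \<times> {..<m}" if "n \<in> fv \<phi>" for n
      using that by (auto simp: eq shuffled_imp_def shuffled_var_def fv_rename simp del: mem_Sigma_iff)
    moreover have "wf_fm L \<phi>" using \<psi> by (simp add: eq shuffled_imp_def wf_rename formulas_def)
    ultimately show ?thesis by (simp add: image_subset_iff)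
  qed
  then show "wf_fm L \<phi>" "s ` fv \<phi> \<subseteq> universe I \<times> {..<m}" by simp_all
qed

text \<open>What one constraint asks of an embedding: its domain contains the indices in
  \<open>X\<close>, and it homogenises one colouring. Finitely many such demands can be met
  together.\<close>

definition settled_by where
  "settled_by L' I M m a \<phi> s ws Q X \<longleftrightarrow> set ws \<subseteq> universe I \<and> finite X \<and> X \<subseteq> universe I \<and>
    (\<forall>S h e. X \<subseteq> S \<longrightarrow> substructure L' I S \<longrightarrow> embedding L' (restrict I S) I h \<longrightarrow>
      homogenizes L' I S h ws Q \<longrightarrow> (\<forall>i\<in>S. \<forall>l<m. e (i, l) = a (h i) ! l) \<longrightarrow>
      sat M (\<lambda>n. e (s n)) \<phi>)"

lemma constraint_homogenized:
  assumes a: "\<forall>i\<in>universe I. length (a i) = m"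
    and c: "(\<phi>, s) \<in> em_constraints L' I L M m a \<union> indiscernibility_constraints L' I L m"
  shows "\<exists>ws Q X. settled_by L' I M m a \<phi> s ws Q X"
  using c
proof
  assume "(\<phi>, s) \<in> em_constraints L' I L M m a"
  then obtain ts where s: "s = tuple_var m ts" and ts: "set ts \<subseteq> universe I"
    and \<phi>: "\<phi> \<in> formulas L (length ts * m)"
    and all: "\<And>ss. set ss \<subseteq> universe I \<Longrightarrow> length ss = length ts \<Longrightarrow> qftp L' I ss = qftp L' I ts \<Longrightarrow>
        holds M \<phi> (concat (map a ss))"
    unfolding em_constraints_def by blast
  have "sat M (\<lambda>n. e (s n)) \<phi>" if S: "set ts \<subseteq> S" "substructure L' I S" "embedding L' (restrict I S) I h"
    and e: "\<forall>i\<in>S. \<forall>l<m. e (i, l) = a (h i) ! l" for S h e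
  proof -
    have hS: "h i \<in> universe I" if "i \<in> S" for i using that embeddingD(2)[OF S(3)] by auto
    then have "set (map h ts) \<subseteq> universe I" using S(1) by auto
    then have "holds M \<phi> (concat (map a (map h ts)))"
      using qftp_embedding_substructure[OF S(2,3,1)] by (intro all) simp_all
    moreover have "sat M (\<lambda>n. e (s n)) \<phi> = holds M \<phi> (concat (map (\<lambda>i. a (h i)) ts))"
      unfolding s using S(1) e hS a by (intro sat_tuple_var[OF _ \<phi>]) auto
    ultimately show ?thesis by (simp add: comp_def)
  qed
  \<comment> \<open>Embeddings preserve types, so nothing has to be homogenised here; the empty
    tuple makes that demand void.\<close>
  then show ?thesis unfolding settled_by_def using ts
    by (intro exI[of _ "[]"] exI[of _ undefined] exI[of _ "set ts"]) auto
next
  assume "(\<phi>, s) \<in> indiscernibility_constraints L' I L m"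
  then obtain \<psi> "is" js where eq: "\<phi> = shuffled_imp \<psi>" "s = shuffled_var m is js"
    and ij: "set is \<subseteq> universe I" "set js \<subseteq> universe I" "length is = length js" "qftp L' I is = qftp L' I js"
    and \<psi>: "\<psi> \<in> formulas L (length is * m)"
    unfolding indiscernibility_constraints_def by blast
  define Q where "Q us \<longleftrightarrow> holds M \<psi> (concat (map a us))" for us
  have "sat M (\<lambda>n. e (s n)) \<phi>" if S: "set is \<union> set js \<subseteq> S" "embedding L' (restrict I S) I h"
    and hom: "homogenizes L' I S h is Q"
    and e: "\<forall>i\<in>S. \<forall>l<m. e (i, l) = a (h i) ! l" for S h e
  proof -
    have hS: "h i \<in> universe I" if "i \<in> S" for i using that embeddingD(2)[OF S(2)] by auto
    have "sat M (\<lambda>n. e (tuple_var m ts n)) \<psi> = Q (map h ts)"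
      if ts: "set ts \<subseteq> S" "length ts = length is" for ts
    proof -
      have "sat M (\<lambda>n. e (tuple_var m ts n)) \<psi> = holds M \<psi> (concat (map (\<lambda>i. a (h i)) ts))"
        using ts e hS a \<psi> by (intro sat_tuple_var[of _ _ _ _ _ L]) auto
      then show ?thesis by (simp add: Q_def comp_def)
    qed
    then have "sat M (\<lambda>n. e (tuple_var m is n)) \<psi> = Q (map h is)"
      "sat M (\<lambda>n. e (tuple_var m js n)) \<psi> = Q (map h js)" using S(1) ij(3) by auto
    moreover have "Q (map h is) = Q (map h js)"
      using hom S(1) ij(3,4) unfolding homogenizes_def by (metis le_sup_iff)
    ultimately show ?thesis unfolding eq sat_indiscernibility by blast
  qed
  then show ?thesis unfolding settled_by_def using ij(1,2)
    by (intro exI[of _ "is"] exI[of _ Q] exI[of _ "set is \<union> set js"]) auto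
qed

lemma constraints_finitely_satisfiable:
  assumes I: "is_struct L' I" "locally_finite L' I" "strict_linear_order_rel L' I lt"
    and ram: "ramsey_class L' (age L' I)" and M: "universe M \<noteq> {}"
    and a: "\<And>i. i \<in> universe I \<Longrightarrow> a i \<in> tuples M m"
    and \<Sigma>0: "finite \<Sigma>0" "\<Sigma>0 \<subseteq> em_constraints L' I L M m a \<union> indiscernibility_constraints L' I L m"
  shows "\<exists>e. (\<forall>v. e v \<in> universe M) \<and> (\<forall>(\<phi>, s)\<in>\<Sigma>0. sat M (\<lambda>n. e (s n)) \<phi>)"
proof -
  have len: "\<forall>i\<in>universe I. length (a i) = m" using a by (simp add: tuples_def)
  have "\<forall>\<sigma>\<in>\<Sigma>0. \<exists>wQX. settled_by L' I M m a (fst \<sigma>) (snd \<sigma>) (fst wQX) (fst (snd wQX)) (snd (snd wQX))"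
  proof
    fix \<sigma> assume "\<sigma> \<in> \<Sigma>0"
    then have "(fst \<sigma>, snd \<sigma>) \<in> em_constraints L' I L M m a \<union> indiscernibility_constraints L' I L m"
      using \<Sigma>0(2) by auto
    from constraint_homogenized[OF len this] obtain ws Q X
      where "settled_by L' I M m a (fst \<sigma>) (snd \<sigma>) ws Q X" by (elim exE)
    then show "\<exists>wQX. settled_by L' I M m a (fst \<sigma>) (snd \<sigma>) (fst wQX) (fst (snd wQX)) (snd (snd wQX))"
      by (intro exI[of _ "(ws, Q, X)"]) simp
  qed
  from bchoice[OF this] obtain d where d': "\<forall>\<sigma>\<in>\<Sigma>0. settled_by L' I M m a (fst \<sigma>) (snd \<sigma>)
    (fst (d \<sigma>)) (fst (snd (d \<sigma>))) (snd (snd (d \<sigma>)))" ..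
  note d = d'[unfolded settled_by_def]
  obtain i0 where i0: "i0 \<in> universe I" using I(1) by (auto simp: is_struct_def)
  \<comment> \<open>The point \<open>i0\<close> keeps the generated substructure nonempty when the
    constraints mention no index.\<close>
  define X where "X = insert i0 (\<Union>\<sigma>\<in>\<Sigma>0. snd (snd (d \<sigma>)))"
  define S where "S = gen L' I X"
  have X: "X \<subseteq> universe I" "finite X" using d \<Sigma>0(1) i0 by (auto simp: X_def)
  have XS: "X \<subseteq> S" unfolding S_def by (rule gen_base)
  then have S: "substructure L' I S" "finite S"
    unfolding S_def using finite_gen[OF I(1,2) X] substructure_gen[OF I(1) X(1)] by (auto simp: X_def)
  let ?D = "(\<lambda>\<sigma>. (fst (d \<sigma>), fst (snd (d \<sigma>)))) ` \<Sigma>0"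
  have "\<exists>h. embedding L' (restrict I S) I h \<and> (\<forall>(ws, Q)\<in>?D. homogenizes L' I S h ws Q)"
    using d \<Sigma>0(1) by (intro ramsey_homogenizes_finite[OF I ram _ _ S]) auto
  then obtain h where h: "embedding L' (restrict I S) I h" "\<forall>(ws, Q)\<in>?D. homogenizes L' I S h ws Q" by blast
  obtain u where u: "u \<in> universe M" using M by blast
  define e where "e = (\<lambda>(i, l). if i \<in> S \<and> l < m then a (h i) ! l else u)"
  have hS: "h i \<in> universe I" if "i \<in> S" for i using that embeddingD(2)[OF h(1)] by auto
  have "e v \<in> universe M" for v
  proof -
    obtain i l where v: "v = (i, l)" by (cases v)
    show ?thesis
    proof (cases "i \<in> S \<and> l < m")
      case True
      then have "a (h i) \<in> tuples M m" using hS a by blast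
      then show ?thesis using True by (auto simp: v e_def tuples_def)
    next
      case False
      then show ?thesis using u by (auto simp: v e_def)
    qed
  qed
  moreover have "sat M (\<lambda>n. e (snd \<sigma> n)) (fst \<sigma>)" if \<sigma>: "\<sigma> \<in> \<Sigma>0" for \<sigma>
  proof -
    have "snd (snd (d \<sigma>)) \<subseteq> S" using XS \<sigma> by (auto simp: X_def)
    moreover have "homogenizes L' I S h (fst (d \<sigma>)) (fst (snd (d \<sigma>)))" using h(2) \<sigma> by auto
    moreover have "\<forall>i\<in>S. \<forall>l<m. e (i, l) = a (h i) ! l" by (simp add: e_def)
    ultimately show ?thesis using d[rule_format, OF \<sigma>] S(1) h(1) by blast
  qed
  ultimately show ?thesis by (intro exI[of _ e]) (simp add: split_beta)
qed

lemma finite_ordLess: "natLeq <o \<kappa> \<Longrightarrow> finite X \<Longrightarrow> |X| <o \<kappa>"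
  using ordLess_transitive[of "|X|" natLeq \<kappa>] by (simp only: finite_iff_ordLess_natLeq)

lemma finite_ordLeq_infinite: "finite X \<Longrightarrow> infinite Y \<Longrightarrow> |X| \<le>o |Y|"
  using ordLess_ordLeq_trans[of "|X|" natLeq "|Y|"] infinite_iff_natLeq_ordLeq[of Y]
  by (simp add: finite_iff_ordLess_natLeq ordLess_imp_ordLeq)

theorem ramsey_imp_modeling:
  assumes I: "is_struct L' I" "locally_finite L' I" "strict_linear_order_rel L' I lt"
    and \<kappa>: "natLeq <o \<kappa>" "|universe I| <o \<kappa>"
    and ram: "ramsey_class L' (age L' I)"
  shows "modeling_property \<kappa> TYPE(('f, 'r, 'm) struct) L' I"
  unfolding modeling_property_def
proof (intro allI impI, elim conjE)
  fix L :: "('f, 'r) lang" and T and M :: "('f, 'r, 'm) struct" and m a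
  assume mon: "monster \<kappa> L T M" and a: "\<forall>i\<in>universe I. a i \<in> tuples M m"
  have M: "is_struct L M" "saturated \<kappa> L M" using mon by (auto simp: monster_def is_model_def)
  then have Mne: "universe M \<noteq> {}" by (simp add: is_struct_def)
  have len: "length (a i) = m" if "i \<in> universe I" for i using a that by (auto simp: tuples_def)
  let ?V = "universe I \<times> {..<m}"
  \<comment> \<open>There are fewer than \<open>\<kappa>\<close> variables: a finite index structure
    is covered by \<open>natLeq <o \<kappa>\<close>, an infinite one absorbs the factor
    \<open>m\<close>.\<close>
  have V: "|?V| <o \<kappa>"
  proof (cases "finite (universe I)")
    case True
    then have "finite ?V" by simp
    then show ?thesis by (rule finite_ordLess[OF \<kappa>(1)])
  next
    case False
    have "|{..<m}| \<le>o |universe I|" by (rule finite_ordLeq_infinite[OF _ False]) simp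
    then have "|?V| \<le>o |universe I|"
      by (intro card_of_Times_ordLeq[OF False card_of_mono1[OF subset_refl]])
    then show ?thesis using \<kappa>(2) by (rule ordLeq_ordLess_trans)
  qed
  define \<Sigma> where "\<Sigma> = em_constraints L' I L M m a \<union> indiscernibility_constraints L' I L m"
  have wf: "wf_fm L \<phi> \<and> s ` fv \<phi> \<subseteq> ?V" if "(\<phi>, s) \<in> \<Sigma>" for \<phi> s
    using constraints_wf that unfolding \<Sigma>_def by blast
  have "\<exists>e. (\<forall>v. e v \<in> universe M) \<and> (\<forall>(\<phi>, s)\<in>\<Sigma>0. sat M (\<lambda>n. e (s n)) \<phi>)"
    if "finite \<Sigma>0" "\<Sigma>0 \<subseteq> \<Sigma>" for \<Sigma>0
    using that a unfolding \<Sigma>_def by (intro constraints_finitely_satisfiable[OF I ram Mne]) auto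
  then obtain e where e: "\<And>v. e v \<in> universe M" "\<And>\<phi> s. (\<phi>, s) \<in> \<Sigma> \<Longrightarrow> sat M (\<lambda>n. e (s n)) \<phi>"
    using saturated_realizes[OF M(2) V M(1) wf] by metis
  define b where "b i = map (\<lambda>l. e (i, l)) [0..<m]" for i
  have bM: "b i \<in> tuples M m" for i using e(1) by (auto simp: b_def tuples_def)
  have sat_b: "sat M (\<lambda>n. e (tuple_var m ts n)) \<phi> = holds M \<phi> (concat (map b ts))"
    if "\<phi> \<in> formulas L (length ts * m)" for ts \<phi>
    by (rule sat_tuple_var[OF _ that]) (simp add: b_def)
  have lenb: "length (concat (map b ts)) = length ts * m" for ts
    by (rule concat_uniform(1)) (simp add: b_def)
  have lena: "length (concat (map a ts)) = length ts * m" if "set ts \<subseteq> universe I" for ts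
    using that len by (intro concat_uniform(1)) auto
  have em: "holds M \<phi> (concat (map b ts))"
    if "set ts \<subseteq> universe I" "\<phi> \<in> formulas L (length ts * m)"
      "\<And>ss. set ss \<subseteq> universe I \<Longrightarrow> length ss = length ts \<Longrightarrow> qftp L' I ss = qftp L' I ts \<Longrightarrow>
        holds M \<phi> (concat (map a ss))" for ts \<phi>
  proof -
    have "(\<phi>, tuple_var m ts) \<in> \<Sigma>" unfolding \<Sigma>_def em_constraints_def using that by blast
    then show ?thesis using e(2) sat_b[OF that(2)] by blast
  qed
  have ind: "holds M \<phi> (concat (map b is)) \<longrightarrow> holds M \<phi> (concat (map b js))"
    if "set is \<subseteq> universe I" "set js \<subseteq> universe I" "length is = length js" "qftp L' I is = qftp L' I js"
      "\<phi> \<in> formulas L (length is * m)" for "is" js \<phi>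
  proof -
    have "(shuffled_imp \<phi>, shuffled_var m is js) \<in> \<Sigma>"
      unfolding \<Sigma>_def indiscernibility_constraints_def using that by blast
    from e(2)[OF this] show ?thesis unfolding sat_indiscernibility
      using sat_b[of \<phi> "is"] sat_b[of \<phi> js] that(3,5) by simp
  qed
  have "indiscernible L' I L M b"
    unfolding indiscernible_def
  proof (intro allI impI, elim conjE)
    fix "is" js assume ij: "set is \<subseteq> universe I" "set js \<subseteq> universe I" "length is = length js"
      "qftp L' I is = qftp L' I js"
    have "holds M \<phi> (concat (map b is)) \<longleftrightarrow> holds M \<phi> (concat (map b js))"
      if "\<phi> \<in> formulas L (length is * m)" for \<phi>
      using ind[OF ij that] ind[OF ij(2,1) ij(3)[symmetric] ij(4)[symmetric]] that ij(3) by auto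
    then show "tp L M (concat (map b is)) = tp L M (concat (map b js))"
      unfolding tp_def lenb using ij(3) by auto
  qed
  moreover have lb: "locally_based L' I L M b a"
    unfolding locally_based_def
  proof (intro allI impI, elim conjE)
    fix ts and \<Delta> :: "('f, 'r) fm set"
    assume ts: "set ts \<subseteq> universe I" and \<Delta>: "finite \<Delta>" "\<Delta> \<subseteq> formulas L (length (concat (map b ts)))"
    show "\<exists>ss. set ss \<subseteq> universe I \<and> length ss = length ts \<and> qftp L' I ss = qftp L' I ts \<and>
      (\<forall>\<phi>\<in>\<Delta>. holds M \<phi> (concat (map b ts)) \<longleftrightarrow> holds M \<phi> (concat (map a ss)))"
    proof (rule ccontr)
      assume no: "\<not> ?thesis"
      obtain \<Delta>s where \<Delta>s: "set \<Delta>s = \<Delta>" using finite_list[OF \<Delta>(1)] by blast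
      \<comment> \<open>Let \<open>\<psi>\<close> describe the behaviour of \<open>b\<close> at
        \<open>ts\<close> with respect to \<open>\<Delta>\<close>. If no \<open>ss\<close> of the
        same type matched it, \<open>Neg \<psi>\<close> would hold of \<open>a\<close> at all of
        them, so it would belong to the type realised by \<open>b\<close>.\<close>
      define lit where "lit \<phi> = (if holds M \<phi> (concat (map b ts)) then \<phi> else Neg \<phi>)" for \<phi>
      define \<psi> where "\<psi> = conj_fm (map lit \<Delta>s)"
      have "holds M (lit \<phi>) xs \<longleftrightarrow> (holds M \<phi> (concat (map b ts)) \<longleftrightarrow> holds M \<phi> xs)" for \<phi> xs
        by (simp add: lit_def holds_def)
      moreover have "holds M \<psi> xs \<longleftrightarrow> (\<forall>\<phi>\<in>\<Delta>. holds M (lit \<phi>) xs)" for xs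
        by (simp add: \<psi>_def holds_def sat_conj_fm \<Delta>s)
      ultimately have \<psi>: "holds M \<psi> xs \<longleftrightarrow> (\<forall>\<phi>\<in>\<Delta>. holds M \<phi> (concat (map b ts)) \<longleftrightarrow> holds M \<phi> xs)" for xs
        by (simp only:)
      have "lit \<phi> \<in> formulas L (length ts * m)" if "\<phi> \<in> \<Delta>" for \<phi>
        using that \<Delta>(2) lenb by (auto simp: lit_def formulas_def)
      then have "Neg \<psi> \<in> formulas L (length ts * m)"
        by (auto simp: \<psi>_def formulas_def conj_fm_syntax \<Delta>s)
      moreover have "holds M (Neg \<psi>) (concat (map a ss))"
        if "set ss \<subseteq> universe I" "length ss = length ts" "qftp L' I ss = qftp L' I ts" for ss
      proof -
        have "\<not> holds M \<psi> (concat (map a ss))" unfolding \<psi> using no that by blast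
        then show ?thesis by (simp add: holds_def)
      qed
      ultimately have "holds M (Neg \<psi>) (concat (map b ts))" using em[OF ts] by blast
      then have "\<not> holds M \<psi> (concat (map b ts))" by (simp add: holds_def)
      then show False unfolding \<psi> by simp
    qed
  qed
  moreover have "nontrivial I b" if nt: "nontrivial I a"
    unfolding nontrivial_def
  proof (rule inj_onI)
    fix i j assume ij: "i \<in> universe I" "j \<in> universe I" "b i = b j"
    \<comment> \<open>Coordinatewise equality of two tuples. It passes from \<open>b\<close> at
      \<open>i, j\<close> to \<open>a\<close> at some \<open>i', j'\<close> of the same type; then
      \<open>i' = j'\<close>, and equality is part of the quantifier-free type.\<close>
    define \<Delta> :: "('f, 'r) fm set" where "\<Delta> = (\<lambda>l. Eq (Var l) (Var (m + l))) ` {..<m}"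
    have "set [i, j] \<subseteq> universe I" "finite \<Delta>" "\<Delta> \<subseteq> formulas L (length (concat (map b [i, j])))"
      unfolding lenb using ij by (auto simp: \<Delta>_def formulas_def)
    then obtain ss where ss: "set ss \<subseteq> universe I" "length ss = length [i, j]" "qftp L' I ss = qftp L' I [i, j]"
      and eqv: "\<forall>\<phi>\<in>\<Delta>. holds M \<phi> (concat (map b [i, j])) \<longleftrightarrow> holds M \<phi> (concat (map a ss))"
      using lb[unfolded locally_based_def, rule_format, of "[i, j]" \<Delta>] by blast
    obtain i' j' where s: "ss = [i', j']" using ss(2) by (auto simp: length_Suc_conv)
    have lb2: "length (b i) = m" by (simp add: b_def)
    have la: "length (a i') = m" "length (a j') = m" using ss(1) len by (auto simp: s)
    have "a i' = a j'"
    proof (rule nth_equalityI)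
      fix l assume "l < length (a i')"
      then have l: "l < m" using la by simp
      then have "Eq (Var l) (Var (m + l)) \<in> \<Delta>" by (simp add: \<Delta>_def)
      moreover have "holds M (Eq (Var l) (Var (m + l))) (concat (map b [i, j]))"
        using l lb2 ij(3) by (simp add: holds_def nth_append)
      ultimately have "holds M (Eq (Var l) (Var (m + l))) (concat (map a ss))" using eqv by blast
      then show "a i' ! l = a j' ! l" using l la by (simp add: holds_def s nth_append)
    qed (simp add: la)
    then have "i' = j'" using nt ss(1) by (auto simp: nontrivial_def s dest: inj_onD)
    then have "Eq (Var 0) (Var 1) \<in> qftp L' I ss"
      by (auto simp: qftp_def qf_formulas_def formulas_def holds_def s)
    then have "Eq (Var 0) (Var 1) \<in> qftp L' I [i, j]" by (simp only: ss(3))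
    then show "i = j" by (simp add: qftp_def holds_def)
  qed
  ultimately show "\<exists>b. (\<forall>i\<in>universe I. b i \<in> tuples M m) \<and> indiscernible L' I L M b \<and>
      locally_based L' I L M b a \<and> (nontrivial I a \<longrightarrow> nontrivial I b)"
    using bM by blast
qed

section \<open>The modeling property implies the Ramsey property\<close>

lemma finite_copy:
  assumes "D \<in> copies L C A" "finite (universe A)"
  shows "finite D"
  using assms by (auto simp: copies_def isomorphic_def is_iso_def dest: bij_betw_finite)

text \<open>Take an ultrafilter on the finite substructures containing all cones
  \<open>up D\<close>, and give \<open>D\<close> the colour that it receives from \<open>f S\<close>
  for most \<open>S\<close>. A copy of \<open>B\<close> contains finitely many copies of
  \<open>A\<close>, so if it were monochromatic for the limit, it would be so for a single
  \<open>f S\<close>.\<close>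

lemma locally_finite_limit_colouring:
  assumes I: "is_struct L I" "locally_finite L I" and B: "finite (universe B)"
    and A: "finite (universe A)"
    and no: "\<And>S. substructure L I S \<Longrightarrow> finite S \<Longrightarrow> \<not> arrow L (restrict I S) B A k"
  obtains F where "F ` copies L I A \<subseteq> {..<k}"
    "\<And>B' c. B' \<in> copies L I B \<Longrightarrow> \<exists>D\<in>copies L (restrict I B') A. F D \<noteq> c"
proof -
  have "\<exists>f. f ` copies L (restrict I S) A \<subseteq> {..<k} \<and>
      \<not> (\<exists>B'\<in>copies L (restrict I S) B. \<exists>c. \<forall>D\<in>copies L (restrict I B') A. f D = c)"
    if "substructure L I S" "finite S" for S
    using no[OF that] unfolding arrow_def restrict_simps by (simp only: not_all not_imp)
  then obtain f where f: "\<And>S. substructure L I S \<Longrightarrow> finite S \<Longrightarrow> f S ` copies L (restrict I S) A \<subseteq> {..<k} \<and>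
      \<not> (\<exists>B'\<in>copies L (restrict I S) B. \<exists>c. \<forall>D\<in>copies L (restrict I B') A. f S D = c)"
    by metis
  define \<S> where "\<S> = {S. substructure L I S \<and> finite S}"
  define up where "up D = {S \<in> \<S>. D \<subseteq> S}" for D
  have fip: "\<Inter> F \<noteq> {}" if F: "finite F" "F \<subseteq> up ` \<S>" for F
  proof -
    obtain T where T: "T \<subseteq> \<S>" "finite T" "F = up ` T" using finite_subset_image[OF F] by blast
    obtain i where i: "i \<in> universe I" using I(1) by (auto simp: is_struct_def)
    let ?X = "insert i (\<Union> T)"
    have X: "?X \<subseteq> universe I" "finite ?X" using T i by (auto simp: \<S>_def substructure_def)
    have "?X \<subseteq> gen L I ?X" by (rule gen_base)
    then have "gen L I ?X \<in> \<S>" "\<Union> T \<subseteq> gen L I ?X"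
      using substructure_gen[OF I(1) X(1)] finite_gen[OF I X] by (auto simp: \<S>_def)
    then have "gen L I ?X \<in> \<Inter> F" unfolding T(3) up_def by blast
    then show ?thesis by blast
  qed
  obtain \<U> where \<U>: "up ` \<S> \<subseteq> \<U>" "\<And>F. finite F \<Longrightarrow> F \<subseteq> \<U> \<Longrightarrow> \<Inter> F \<noteq> {}"
    "\<And>X. X \<in> \<U> \<or> - X \<in> \<U>"
    using ultrafilter_extends[OF fip] by metis
  \<comment> \<open>If all of the finitely many colours were rejected, some \<open>S\<close> above
    \<open>D\<close> would give \<open>D\<close> no colour at all.\<close>
  have ex: "\<exists>c<k. {S. f S D = c} \<in> \<U>" if D: "D \<in> copies L I A" for D
  proof (rule ccontr)
    assume no: "\<not> ?thesis"
    have neg: "- {S. f S D = c} \<in> \<U>" if "c < k" for c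
    proof -
      have "{S. f S D = c} \<notin> \<U>" using no that by simp
      then show ?thesis using \<U>(3)[of "{S. f S D = c}"] by (elim disjE) simp_all
    qed
    have "(\<lambda>c. - {S. f S D = c}) ` {..<k} \<subseteq> \<U>"
      by (rule image_subsetI) (rule neg, simp)
    moreover have "up D \<in> \<U>" using finite_copy[OF D A] D \<U>(1) by (auto simp: \<S>_def copies_def)
    ultimately have "\<Inter> (insert (up D) ((\<lambda>c. - {S. f S D = c}) ` {..<k})) \<noteq> {}" by (intro \<U>(2)) auto
    then obtain S where S: "S \<in> up D" "\<forall>c<k. f S D \<noteq> c" by auto
    then have T: "substructure L I S" "finite S" "D \<subseteq> S" by (auto simp: up_def \<S>_def)
    then have "D \<in> copies L (restrict I S) A"
      using D by (simp add: copies_restrict[OF substructureD(1)[OF T(1)]])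
    moreover have "f S ` copies L (restrict I S) A \<subseteq> {..<k}" using f[OF T(1,2)] by (rule conjunct1)
    ultimately have "f S D < k" by (simp add: image_subset_iff)
    then show False using S(2)[rule_format, of "f S D"] by simp
  qed
  define F where "F D = (SOME c. c < k \<and> {S. f S D = c} \<in> \<U>)" for D
  have F: "F D < k \<and> {S. f S D = F D} \<in> \<U>" if "D \<in> copies L I A" for D
    unfolding F_def by (rule someI_ex) (use ex[OF that] in blast)
  have "\<exists>D\<in>copies L (restrict I B') A. F D \<noteq> c" if B': "B' \<in> copies L I B" for B' c
  proof (rule ccontr)
    assume "\<not> ?thesis"
    then have c: "F D = c" if "D \<in> copies L (restrict I B') A" for D using that by blast
    have sub: "B' \<subseteq> universe I" using B' by (auto simp: copies_def substructure_def)
    let ?C = "copies L (restrict I B') A"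
    have C: "?C = {D \<in> copies L I A. D \<subseteq> B'}" by (rule copies_restrict[OF sub])
    have "finite B'" using finite_copy[OF B' B] .
    then have "finite (Pow B')" by simp
    moreover have "?C \<subseteq> Pow B'" unfolding C by (rule subsetI) simp
    ultimately have "finite ?C" by (rule finite_subset[rotated])
    moreover have fc: "{S. f S D = c} \<in> \<U>" if D: "D \<in> ?C" for D
    proof -
      have "D \<in> copies L I A" using D unfolding C by simp
      then have "{S. f S D = F D} \<in> \<U>" using F by simp
      then show ?thesis using c[OF D] by simp
    qed
    have "(\<lambda>D. {S. f S D = c}) ` ?C \<subseteq> \<U>" by (rule image_subsetI) (rule fc)
    moreover have "up B' \<in> \<U>" using \<open>finite B'\<close> B' \<U>(1) by (auto simp: \<S>_def copies_def)
    ultimately have "\<Inter> (insert (up B') ((\<lambda>D. {S. f S D = c}) ` ?C)) \<noteq> {}" by (intro \<U>(2)) auto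
    then obtain S where S: "S \<in> up B'" "\<forall>D\<in>?C. f S D = c" by auto
    then have T: "substructure L I S" "finite S" "B' \<subseteq> S" by (auto simp: up_def \<S>_def)
    then have "B' \<in> copies L (restrict I S) B"
      using B' by (simp add: copies_restrict[OF substructureD(1)[OF T(1)]])
    then show False using f[OF T(1,2), THEN conjunct2] S(2) by blast
  qed
  moreover have "F ` copies L I A \<subseteq> {..<k}" using F by blast
  ultimately show thesis using that by blast
qed

section \<open>Coding a colouring into a monster model\<close>

lemma holds_atomic_concat:
  assumes "\<And>x. x \<in> set xs \<Longrightarrow> length (b x) = k" "c < k" "set js \<subseteq> {..<length xs}"
  shows "holds M (Rl r (map (\<lambda>j. Var (j * k + c)) js)) (concat (map b xs)) \<longleftrightarrow>
    rl M r (map (\<lambda>j. b (xs ! j) ! c) js)"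
proof -
  have "concat (map b xs) ! (j * k + c) = b (xs ! j) ! c" if "j \<in> set js" for j
  proof -
    have "j < length xs" using that assms(3) by auto
    then have "Suc j * k \<le> length xs * k" by (intro mult_le_mono1) simp
    then have "j * k + c < length xs * k" using assms(2) by simp
    then have "concat (map b xs) ! (j * k + c) = b (xs ! ((j * k + c) div k)) ! ((j * k + c) mod k)"
      using assms(1) by (intro concat_uniform(2))
    then show ?thesis using assms(2) by simp
  qed
  then have "map (\<lambda>j. concat (map b xs) ! (j * k + c)) js = map (\<lambda>j. b (xs ! j) ! c) js" by simp
  then show ?thesis by (simp only: holds_def sat.simps eval.simps map_map comp_def)
qed

lemma atomic_formula:
  assumes "c < k" "set js \<subseteq> {..<N}" "length js = n"
  shows "Rl r (map (\<lambda>j. Var (j * k + c)) js) \<in> formulas (rel_lang r n) (N * k)"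
proof -
  have "j * k + c < N * k" if "j \<in> set js" for j
  proof -
    have "j < N" using that assms(2) by auto
    then have "Suc j * k \<le> N * k" by (intro mult_le_mono1) simp
    then show ?thesis using assms(1) by simp
  qed
  then show ?thesis using assms(3) by (auto simp: formulas_def list_all_iff)
qed

text \<open>Cantor's theorem spends one of the two powersets on the strict bound for
  \<open>|Pow (Field \<kappa>)|\<close>.\<close>

lemma monster_setting_bounds:
  fixes \<kappa> :: "'k rel"
  assumes "monster_setting \<kappa> TYPE('m) I"
  shows "infinite (Field \<kappa>)" "|Pow (Field \<kappa>)| <o |UNIV :: 'm set|" "|A| <o \<kappa> \<Longrightarrow> |A| \<le>o |Field \<kappa>|"
    "natLeq <o \<kappa>" "|universe I| <o \<kappa>"
proof -
  have s: "Card_order \<kappa>" "natLeq <o \<kappa>" "|universe I| <o \<kappa>" "|Pow (Pow (Field \<kappa>))| \<le>o |UNIV :: 'm set|"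
    using assms by (auto simp: monster_setting_def)
  have iso: "\<kappa> =o |Field \<kappa>|" using card_of_Field_ordIso[OF s(1)] by (rule ordIso_symmetric)
  have "natLeq \<le>o |Field \<kappa>|" using s(2) iso by (blast intro: ordLess_ordIso_trans ordLess_imp_ordLeq)
  then show "infinite (Field \<kappa>)" using infinite_iff_natLeq_ordLeq by blast
  show "|Pow (Field \<kappa>)| <o |UNIV :: 'm set|" by (rule ordLess_ordLeq_trans[OF card_of_Pow s(4)])
  show "|A| <o \<kappa> \<Longrightarrow> |A| \<le>o |Field \<kappa>|" using iso by (blast intro: ordLess_ordIso_trans ordLess_imp_ordLeq)
  show "natLeq <o \<kappa>" "|universe I| <o \<kappa>" using s by simp_all
qed

text \<open>One \<open>n\<close>-ary relation codes all \<open>k\<close> colours: the point \<open>i\<close> is replaced by \<open>k\<close> copies \<open>pt i c\<close>.\<close>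

lemma (in homogeneous_universal) coded_colouring:
  fixes P :: "nat \<Rightarrow> 'i list \<Rightarrow> bool"
  assumes X: "|X :: 'i set| \<le>o |K|" and n: "n > 0"
  obtains pt where "\<And>i c. i \<in> X \<Longrightarrow> c < k \<Longrightarrow> pt i c \<in> U"
    "\<And>c us. c < k \<Longrightarrow> set us \<subseteq> X \<Longrightarrow> length us = n \<Longrightarrow> R (map (\<lambda>i. pt i c) us) \<longleftrightarrow> P c us"
proof -
  have "|{..<k}| \<le>o |K|" by (rule finite_ordLeq_infinite[OF _ infinite_K]) simp
  then have "|X \<times> {..<k}| \<le>o |K|" by (rule card_of_Times_ordLeq[OF infinite_K X])
  then obtain q where q: "inj_on q (X \<times> {..<k})" "q ` (X \<times> {..<k}) \<subseteq> K" by (rule card_of_ordLeqE)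
  define S where "S = {map (\<lambda>i. q (i, c)) us | us c. c < k \<and> set us \<subseteq> X \<and> length us = n \<and> P c us}"
  obtain \<iota> where \<iota>: "inj_on \<iota> K" "\<iota> ` K \<subseteq> U"
    "\<And>xs. set xs \<subseteq> K \<Longrightarrow> length xs = n \<Longrightarrow> R (map \<iota> xs) \<longleftrightarrow> xs \<in> S"
    using universal[of S] by blast
  show thesis
  proof (rule that[of "\<lambda>i c. \<iota> (q (i, c))"])
    show "\<iota> (q (i, c)) \<in> U" if "i \<in> X" "c < k" for i c using that q(2) \<iota>(2) by blast
    fix c us assume us: "c < k" "set us \<subseteq> X" "length us = n"
    have "map (\<lambda>i. q (i, c)) us \<in> S \<longleftrightarrow> P c us"
    proof
      assume "map (\<lambda>i. q (i, c)) us \<in> S"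
      then obtain vs d where vs: "map (\<lambda>i. q (i, c)) us = map (\<lambda>i. q (i, d)) vs" "d < k" "set vs \<subseteq> X"
        "length vs = n" "P d vs" unfolding S_def by blast
      have "(us ! j, c) = (vs ! j, d)" if "j < n" for j
      proof (rule inj_onD[OF q(1)])
        show "q (us ! j, c) = q (vs ! j, d)"
          using arg_cong[OF vs(1), of "\<lambda>l. l ! j"] that us(3) vs(4) by simp
        show "(us ! j, c) \<in> X \<times> {..<k}" "(vs ! j, d) \<in> X \<times> {..<k}" using that us vs by auto
      qed
      then have "us ! j = vs ! j \<and> c = d" if "j < n" for j using that by simp
      \<comment> \<open>The arity is positive, so there is an entry from which the colour can be
        read off.\<close>
      then have "us = vs" "c = d" using us(3) vs(4) n by (auto intro: nth_equalityI)
      then show "P c us" using vs(5) by simp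
    next
      assume "P c us"
      then show "map (\<lambda>i. q (i, c)) us \<in> S" unfolding S_def using us by blast
    qed
    moreover have "set (map (\<lambda>i. q (i, c)) us) \<subseteq> K" using us q(2) by auto
    then have "R (map \<iota> (map (\<lambda>i. q (i, c)) us)) \<longleftrightarrow> map (\<lambda>i. q (i, c)) us \<in> S" using us(3) by (intro \<iota>(3)) auto
    ultimately show "R (map (\<lambda>i. \<iota> (q (i, c))) us) \<longleftrightarrow> P c us" by (simp add: comp_def)
  qed
qed

theorem modeling_imp_ramsey:
  fixes I :: "('g, 'q, 'i) struct" and \<kappa> :: "'k rel"
  assumes I: "is_struct L' I" "locally_finite L' I" and \<kappa>: "monster_setting \<kappa> TYPE('m) I"
    and mp: "modeling_property \<kappa> TYPE(('f, 'r, 'm) struct) L' I"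
  shows "ramsey_class L' (age L' I)"
  unfolding ramsey_class_def
proof (intro conjI ballI allI impI)
  fix A assume "A \<in> age L' I"
  then obtain S where "is_struct L' A" "finite S" "isomorphic L' A (restrict I S)" using ageE[OF I(2)] by metis
  then show "is_struct L' A" "finite (universe A)"
    by (auto simp: isomorphic_def is_iso_def dest: bij_betw_finite)
next
  fix A B and k :: nat assume A: "A \<in> age L' I" and B: "B \<in> age L' I" and "1 \<le> k"
  obtain SA where SA: "is_struct L' A" "substructure L' I SA" "finite SA" "isomorphic L' A (restrict I SA)"
    using ageE[OF I(2) A] .
  obtain SB where SB: "is_struct L' B" "substructure L' I SB" "finite SB" "isomorphic L' B (restrict I SB)"
    using ageE[OF I(2) B] .
  have finAB: "finite (universe A)" "finite (universe B)"
    using SA(3,4) SB(3,4) by (auto simp: isomorphic_def is_iso_def dest: bij_betw_finite)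
  show "\<exists>C\<in>age L' I. arrow L' C B A k"
  proof (rule ccontr)
    assume no: "\<not> ?thesis"
    have "\<not> arrow L' (restrict I S) B A k" if "substructure L' I S" "finite S" for S
      using no restrict_in_age[OF I(2) that] by blast
    then obtain F where Fk: "F ` copies L' I A \<subseteq> {..<k}"
      and F: "\<And>B' c. B' \<in> copies L' I B \<Longrightarrow> \<exists>D\<in>copies L' (restrict I B') A. F D \<noteq> c"
      using locally_finite_limit_colouring[OF I finAB(2,1)] by metis
    obtain \<alpha> where \<alpha>: "set \<alpha> = SA" using finite_list[OF SA(3)] by blast
    obtain \<beta> where \<beta>: "set \<beta> = SB" using finite_list[OF SB(3)] by blast
    define n where "n = length \<alpha>"
    have n: "n > 0" using \<alpha> substructureD(3)[OF SA(2)] by (auto simp: n_def)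
    note K = monster_setting_bounds[OF \<kappa>]
    obtain U :: "'m set" and R where "homogeneous_universal (Field \<kappa>) n U R"
      using homogeneous_universal_exists[OF K(1,2) n] by blast
    then interpret homogeneous_universal "Field \<kappa>" n U R .
    define r where "r = (undefined :: 'r)"
    define N where "N = (M :: ('f, 'r, 'm) struct)"
    define L where "L = (rel_lang r n :: ('f, 'r) lang)"
    have N: "universe N = U" "rl N r = R" by (simp_all add: N_def)
    \<comment> \<open>The relation records that \<open>us\<close> is a copy of the fixed enumeration
      \<open>\<alpha>\<close> and that the set it enumerates has colour \<open>c\<close>.\<close>
    define P where "P c us \<longleftrightarrow> qftp L' I us = qftp L' I \<alpha> \<and> F (set us) = c" for c us
    obtain pt where pt: "\<And>i c. i \<in> universe I \<Longrightarrow> c < k \<Longrightarrow> pt i c \<in> U"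
      and ptR: "\<And>c us. c < k \<Longrightarrow> set us \<subseteq> universe I \<Longrightarrow> length us = n \<Longrightarrow> R (map (\<lambda>i. pt i c) us) \<longleftrightarrow> P c us"
      using coded_colouring[OF K(3)[OF K(5)] n, of k P] by metis
    define a where "a i = map (pt i) [0..<k]" for i
    have aN: "\<forall>i\<in>universe I. a i \<in> tuples N k" using pt by (auto simp: a_def tuples_def N)
    have mon: "monster \<kappa> L (tp L N []) N"
      unfolding L_def N_def by (rule monster) (rule K(3))
    have comp: "complete_theory L (tp L N [])"
      unfolding L_def N_def by (rule complete_theory_of_structure(1)[OF is_struct_rel[OF U_nonempty]])
    have small: "|Funs L| <o \<kappa>" "|Rels L| <o \<kappa>"
      by (simp_all add: L_def finite_ordLess[OF K(4)])
    obtain b where b: "\<forall>i\<in>universe I. b i \<in> tuples N k" "indiscernible L' I L N b" "locally_based L' I L N b a"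
      using mp[unfolded modeling_property_def, rule_format, of L "tp L N []" N a k] small comp mon aN by blast
    have lenb: "length (b i) = k" if "i \<in> universe I" for i using that b(1) by (simp add: tuples_def)
    have \<beta>I: "set \<beta> \<subseteq> universe I" using \<beta> substructureD(1)[OF SB(2)] by simp
    \<comment> \<open>All atomic statements about coordinate \<open>c\<close> of the tuples at
      \<open>n\<close> positions of \<open>\<beta>\<close>; agreement on them transfers the colours
      of all copies of \<open>A\<close> inside \<open>ss\<close> to \<open>b\<close>.\<close>
    define \<Delta> :: "('f, 'r) fm set" where "\<Delta> = (\<lambda>(js, c). Rl r (map (\<lambda>j. Var (j * k + c)) js)) `
      ({js. set js \<subseteq> {..<length \<beta>} \<and> length js = n} \<times> {..<k})"
    have "length (concat (map b \<beta>)) = length \<beta> * k" using \<beta>I lenb by (intro concat_uniform(1)) auto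
    then have "\<Delta> \<subseteq> formulas L (length (concat (map b \<beta>)))"
      unfolding \<Delta>_def L_def by (auto intro: atomic_formula)
    moreover have "finite \<Delta>" unfolding \<Delta>_def by (intro finite_imageI finite_cartesian_product finite_lists_length_eq) auto
    ultimately obtain ss where ss: "set ss \<subseteq> universe I" "length ss = length \<beta>" "qftp L' I ss = qftp L' I \<beta>"
      and \<Delta>: "\<forall>\<phi>\<in>\<Delta>. holds N \<phi> (concat (map b \<beta>)) \<longleftrightarrow> holds N \<phi> (concat (map a ss))"
      using b(3)[unfolded locally_based_def, rule_format, of \<beta> \<Delta>] \<beta>I by blast
    have genB: "gen L' I (set \<beta>) = SB" using gen_self[OF SB(2)] by (simp add: \<beta>)
    obtain h where h: "is_iso L' (restrict I SB) (restrict I (gen L' I (set ss))) h" "map h \<beta> = ss"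
      using qftp_eq_iso[OF ss(2)[symmetric] ss(3)[symmetric]] genB by auto
    have gens: "gen L' I (set ss) = set ss"
    proof -
      have "gen L' I (set ss) = h ` SB" using h(1) by (simp add: is_iso_def bij_betw_def)
      also have "\<dots> = set ss" using h(2) \<beta> by auto
      finally show ?thesis .
    qed
    have hI: "embedding L' (restrict I SB) I h"
      using h(1) ss(1) by (auto simp: gens is_iso_iff_embedding embedding_def)
    from embedding_image[OF hI substructureD(2)[OF SB(2)]]
    have sub: "substructure L' I (set ss)" using h(2) \<beta> by auto
    have "isomorphic L' (restrict I SB) (restrict I (set ss))" using h(1) by (auto simp: isomorphic_def gens)
    then have "isomorphic L' B (restrict I (set ss))" using SB(4) isomorphic_trans by blast
    then have "isomorphic L' (restrict I (set ss)) B" using SB(1) by (rule isomorphic_sym)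
    then have B': "set ss \<in> copies L' I B" using sub by (simp add: copies_def)
    \<comment> \<open>Copies are addressed by positions, which make sense both in
      \<open>\<beta>\<close>, where \<open>b\<close> is read, and in \<open>ss\<close>, where
      \<open>a\<close> is read.\<close>
    define enumerates where "enumerates js D \<longleftrightarrow> set js \<subseteq> {..<length \<beta>} \<and> length js = n \<and>
      set (map ((!) ss) js) = D \<and> qftp L' I (map ((!) ss) js) = qftp L' I \<alpha>" for js D
    have enum: "\<exists>js. enumerates js D" if D: "D \<in> copies L' (restrict I (set ss)) A" for D
    proof -
      have D': "D \<in> copies L' I A" "D \<subseteq> set ss" using D by (simp_all add: copies_restrict[OF ss(1)])
      have subD: "substructure L' I D" "isomorphic L' (restrict I D) A" using D'(1) by (auto simp: copies_def)
      have "isomorphic L' (restrict I SA) (restrict I D)"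
        using isomorphic_sym[OF isomorphic_trans[OF subD(2) SA(4)] substructureD(2)[OF subD(1)]] .
      then obtain g where g: "is_iso L' (restrict I SA) (restrict I D) g" by (auto simp: isomorphic_def)
      have gI: "embedding L' (restrict I SA) I g"
        using g embedding_inclusion[OF subD(1)] by (auto simp: is_iso_iff_embedding)
      have gD: "set (map g \<alpha>) = D" using g \<alpha> by (simp add: is_iso_def bij_betw_def)
      have "\<forall>x\<in>set (map g \<alpha>). \<exists>j<length ss. ss ! j = x" using gD D'(2) by (auto simp: in_set_conv_nth subset_iff)
      then obtain j where j: "\<forall>x\<in>set (map g \<alpha>). j x < length ss \<and> ss ! j x = x" by metis
      define js where "js = map j (map g \<alpha>)"
      have js: "map ((!) ss) js = map g \<alpha>" using j by (simp add: js_def)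
      have "set js \<subseteq> {..<length \<beta>}" using j ss(2) by (auto simp: js_def)
      moreover have "qftp L' I (map g \<alpha>) = qftp L' I \<alpha>"
        using qftp_embedding_substructure[OF SA(2) gI] \<alpha> by simp
      ultimately show ?thesis using gD unfolding js[symmetric] enumerates_def
        by (intro exI[of _ js]) (simp add: js_def n_def)
    qed
    have same: "F D1 = F D2" if D1: "D1 \<in> copies L' (restrict I (set ss)) A"
      and D2: "D2 \<in> copies L' (restrict I (set ss)) A" for D1 D2
    proof -
      \<comment> \<open>The colours known from \<open>a\<close> at \<open>ss\<close> are visible in
        \<open>b\<close> at \<open>\<beta>\<close>, through the agreement on
        \<open>\<Delta>\<close>.\<close>
      have colour: "R (map (\<lambda>j. b (\<beta> ! j) ! c) js) \<longleftrightarrow> F D = c"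
        if "enumerates js D" and c: "c < k" for js D c
      proof -
        note js = that(1)[unfolded enumerates_def, THEN conjunct1]
          that(1)[unfolded enumerates_def, THEN conjunct2, THEN conjunct1]
          that(1)[unfolded enumerates_def, THEN conjunct2, THEN conjunct2]
        let ?\<phi> = "Rl r (map (\<lambda>j. Var (j * k + c)) js) :: ('f, 'r) fm"
        have "?\<phi> \<in> \<Delta>" unfolding \<Delta>_def using js(1,2) c by (intro image_eqI[of _ _ "(js, c)"]) auto
        then have "holds N ?\<phi> (concat (map b \<beta>)) \<longleftrightarrow> holds N ?\<phi> (concat (map a ss))" using \<Delta> by blast
        moreover have "holds N ?\<phi> (concat (map b \<beta>)) \<longleftrightarrow> rl N r (map (\<lambda>j. b (\<beta> ! j) ! c) js)"
          using \<beta>I lenb by (intro holds_atomic_concat[OF _ c js(1)]) auto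
        moreover have "holds N ?\<phi> (concat (map a ss)) \<longleftrightarrow> rl N r (map (\<lambda>j. a (ss ! j) ! c) js)"
          using js(1) ss(2) by (intro holds_atomic_concat[OF _ c]) (auto simp: a_def)
        moreover have "map (\<lambda>j. a (ss ! j) ! c) js = map (\<lambda>i. pt i c) (map ((!) ss) js)"
          using c by (simp add: a_def)
        moreover have "ss ! j \<in> set ss" if "j \<in> set js" for j using that js(1) ss(2) by auto
        then have "set (map ((!) ss) js) \<subseteq> universe I" using ss(1) by auto
        then have "R (map (\<lambda>i. pt i c) (map ((!) ss) js)) \<longleftrightarrow> P c (map ((!) ss) js)"
          using js(2) by (intro ptR[OF c]) simp_all
        ultimately show ?thesis using js(3) by (simp only: N P_def simp_thms)
      qed
      obtain js1 js2 where e: "enumerates js1 D1" "enumerates js2 D2" using enum D1 D2 by metis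
      then have js1: "set js1 \<subseteq> {..<length \<beta>}" "length js1 = n" "qftp L' I (map ((!) ss) js1) = qftp L' I \<alpha>"
        and js2: "set js2 \<subseteq> {..<length \<beta>}" "length js2 = n" "qftp L' I (map ((!) ss) js2) = qftp L' I \<alpha>"
        by (simp_all only: enumerates_def)
      define c where "c = F D1"
      have "D1 \<in> copies L' I A" using D1 by (simp add: copies_restrict[OF ss(1)])
      then have c: "c < k" using Fk by (auto simp: c_def)
      have q: "qftp L' I (map ((!) \<beta>) js) = qftp L' I (map ((!) ss) js) \<and> set (map ((!) \<beta>) js) \<subseteq> universe I"
        if js: "set js \<subseteq> {..<length \<beta>}" for js
      proof -
        have sub\<beta>: "set (map ((!) \<beta>) js) \<subseteq> SB" using js by (auto simp: \<beta>[symmetric])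
        have "h (\<beta> ! j) = ss ! j" if "j < length \<beta>" for j using h(2) that by (metis nth_map)
        then have "map h (map ((!) \<beta>) js) = map ((!) ss) js" using js by auto
        then have "qftp L' I (map ((!) ss) js) = qftp L' I (map ((!) \<beta>) js)"
          using qftp_embedding_substructure[OF SB(2) hI sub\<beta>] by (simp only:)
        then show ?thesis using subset_trans[OF sub\<beta> substructureD(1)[OF SB(2)]] by simp
      qed
      \<comment> \<open>Both position lists select tuples of the type of \<open>\<alpha>\<close>
        from \<open>\<beta>\<close>, since \<open>h\<close> carries \<open>\<beta>\<close> to
        \<open>ss\<close>. Indiscernibility of \<open>b\<close> therefore forces equal
        colours.\<close>
      have "tp L N (concat (map b (map ((!) \<beta>) js1))) = tp L N (concat (map b (map ((!) \<beta>) js2)))"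
        using b(2)[unfolded indiscernible_def, rule_format, of "map ((!) \<beta>) js1" "map ((!) \<beta>) js2"]
          q[OF js1(1)] q[OF js2(1)] js1(2,3) js2(2,3) by simp
      moreover have "Rl r (map (\<lambda>j. Var (j * k + c)) [0..<n]) \<in> tp L N (concat (map b (map ((!) \<beta>) js))) \<longleftrightarrow>
          R (map (\<lambda>j. b (\<beta> ! j) ! c) js)" if js: "set js \<subseteq> {..<length \<beta>}" "length js = n" for js
      proof -
        let ?\<phi> = "Rl r (map (\<lambda>j. Var (j * k + c)) [0..<n]) :: ('f, 'r) fm" and ?t = "map ((!) \<beta>) js"
        have lent: "length (b x) = k" if "x \<in> set ?t" for x using that q[OF js(1)] lenb by blast
        have "length (concat (map b ?t)) = n * k" using concat_uniform(1)[of ?t b k] lent js(2) by simp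
        moreover have "?\<phi> \<in> formulas L (n * k)" unfolding L_def using c by (intro atomic_formula) auto
        ultimately have "?\<phi> \<in> formulas L (length (concat (map b ?t)))" by (simp only:)
        then have "?\<phi> \<in> tp L N (concat (map b ?t)) \<longleftrightarrow> holds N ?\<phi> (concat (map b ?t))" by (simp add: tp_def)
        also have "\<dots> \<longleftrightarrow> rl N r (map (\<lambda>j. b (?t ! j) ! c) [0..<n])"
          using js(2) by (intro holds_atomic_concat[OF lent c]) auto
        also have "map (\<lambda>j. b (?t ! j) ! c) [0..<n] = map (\<lambda>j. b (\<beta> ! j) ! c) js"
          using js(2) by (intro nth_equalityI) auto
        finally show ?thesis by (simp add: N)
      qed
      ultimately have "R (map (\<lambda>j. b (\<beta> ! j) ! c) js1) \<longleftrightarrow> R (map (\<lambda>j. b (\<beta> ! j) ! c) js2)"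
        using js1(1,2) js2(1,2) by metis
      then have "F D1 = c \<longleftrightarrow> F D2 = c" using colour[OF e(1) c] colour[OF e(2) c] by simp
      then show ?thesis by (simp add: c_def)
    qed
    \<comment> \<open>Badness of \<open>F\<close> is used twice: first, with an arbitrary colour, to
      get some copy of \<open>A\<close> in \<open>ss\<close>, and then with the colour of that copy
      for the contradiction.\<close>
    obtain D0 where D0: "D0 \<in> copies L' (restrict I (set ss)) A" using F[OF B'] by blast
    then show False using F[OF B', of "F D0"] same by metis
  qed
qed

theorem theorem3p13:
  fixes L' :: "('g, 'q) lang"
    and I :: "('g, 'q, 'i) struct"
    and lt :: 'q
    and \<kappa> :: "'k rel"
  assumes "is_struct L' I"
    and "locally_finite L' I"
    and "qfi L' I"
    and "strict_linear_order_rel L' I lt"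
    and "monster_setting \<kappa> TYPE('m) I"
  shows "modeling_property \<kappa> TYPE(('f, 'r, 'm) struct) L' I \<longleftrightarrow> ramsey_class L' (age L' I)"
  using modeling_imp_ramsey[OF assms(1,2,5)]
    ramsey_imp_modeling[OF assms(1,2,4) monster_setting_bounds(4,5)[OF assms(5)]] by blast

end
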